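(* Let $\omega = \frac{\sqrt5-1}{2}$ and $\lambda = 0.4 = 2/5$. For every $\varepsilon \in \{0.1,\,0.2,\,0.3,\,0.4,\,0.5,\,0.6,\,0.7\}$ (exact decimal values) there exists a parameter $\mu \in \mathbb{R}$ such that the dissipative standard map $$F_\mu(x,y) = \bigl(x + \varphi_\mu(x,y),\ \varphi_\mu(x,y)\bigr), \qquad \varphi_\mu(x,y) = \lambda y + \mu + \frac{\varepsilon}{2\pi}\sin(2\pi x),$$ on $\mathbb{T}\times\mathbb{R}$ has a real-analytic quasi-periodic invariant circle, homotopic to the zero section, with frequency $\omega$. That is, there exists a real-analytic map $K:\mathbb{T}\to\mathbb{T}\times\mathbb{R}$ of the form $K(\theta) = (\theta,0) + K_p(\theta)$, with $K_p:\mathbb{T}\to\mathbb{R}^2$ real-analytic, such that $$F_\mu(K(\theta)) = K(\theta+\omega) \quad\text{for all } \theta\in\mathbb{T}.$$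
   Context: $\mathbb{T} = \mathbb{R}/\mathbb{Z}$. In the formula for $F_\mu$ the first component is taken modulo $1$. A map $K_p:\mathbb{T}\to\mathbb{R}^2$ is real-analytic if it is the restriction to $\mathbb{T}$ of a map that is holomorphic on a complex strip $\{\theta\in\mathbb{C}/\mathbb{Z} : |\mathrm{Im}\,\theta|<r\}$ for some $r>0$. *)

theory Defs
  imports "HOL-Analysis.Analysis"
begin

quotient_type circle = real / "\<lambda>x y :: real. x - y \<in> \<int>"
  morphisms rep_circle to_circle
proof (rule equivpI)
  show "reflp (\<lambda>x y :: real. x - y \<in> \<int>)"
    by (simp add: reflp_def)
  show "symp (\<lambda>x y :: real. x - y \<in> \<int>)"
    by (auto simp: symp_def intro: Ints_minus [of "x - y" for x y :: real, simplified])
  show "transp (\<lambda>x y :: real. x - y \<in> \<int>)"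
  proof (rule transpI)
    fix x y z :: real
    assume "x - y \<in> \<int>" "y - z \<in> \<int>"
    then have "(x - y) + (y - z) \<in> \<int>" by (rule Ints_add)
    then show "x - z \<in> \<int>" by simp
  qed
qed

instantiation circle :: ab_group_add
begin

lift_definition zero_circle :: circle is "0 :: real" .

lift_definition plus_circle :: "circle \<Rightarrow> circle \<Rightarrow> circle" is "(+) :: real \<Rightarrow> real \<Rightarrow> real"
  by (metis Ints_add add_diff_add)

lift_definition uminus_circle :: "circle \<Rightarrow> circle" is "uminus :: real \<Rightarrow> real"
  by (metis Ints_minus minus_diff_minus)

lift_definition minus_circle :: "circle \<Rightarrow> circle \<Rightarrow> circle" is "(-) :: real \<Rightarrow> real \<Rightarrow> real"
  by (metis Ints_diff diff_diff_eq diff_diff_eq2 add_diff_eq diff_add_eq add.commute)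

instance
  by standard (transfer, simp add: algebra_simps)+

end

lemma to_circle_eq_iff: "to_circle x = to_circle y \<longleftrightarrow> x - y \<in> \<int>"
  by (rule circle.abs_eq_iff)

lemma to_circle_add: "to_circle (x + y) = to_circle x + to_circle y"
  by (simp add: plus_circle.abs_eq)

lift_definition sin_2pi :: "circle \<Rightarrow> real" is "\<lambda>x. sin (2 * pi * x)"
proof -
  fix x y :: real
  assume "x - y \<in> \<int>"
  then obtain n :: int where "x = y + of_int n"
    by (metis Ints_cases add.commute diff_add_cancel)
  then have "2 * pi * x = 2 * pi * y + 2 * pi * of_int n"
    by (simp add: algebra_simps)
  then show "sin (2 * pi * x) = sin (2 * pi * y)"
    by (simp add: sin_add sin_int_2pin cos_int_2pin)
qed

definition strip :: "real \<Rightarrow> complex set" where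
  "strip r = {z. \<bar>Im z\<bar> < r}"

(* A holomorphic function on the strip of C/Z is represented by its lift: a function that is
   holomorphic and 1-periodic on the strip of C. *)
definition real_analytic_on_circle :: "(circle \<Rightarrow> real) \<Rightarrow> bool" where
  "real_analytic_on_circle g \<longleftrightarrow>
     (\<exists>r>0. \<exists>f. f holomorphic_on strip r \<and>
        (\<forall>z\<in>strip r. f (z + 1) = f z) \<and>
        (\<forall>t. f (complex_of_real t) = complex_of_real (g (to_circle t))))"

(* A map into the plane: being the restriction of a holomorphic map into C^2 is a condition on
   each component (strips of different widths can be cut down to the smaller one). *)
definition real_analytic_circle_to_plane :: "(circle \<Rightarrow> real \<times> real) \<Rightarrow> bool" where
  "real_analytic_circle_to_plane g \<longleftrightarrow>
     real_analytic_on_circle (\<lambda>\<theta>. fst (g \<theta>)) \<and> real_analytic_on_circle (\<lambda>\<theta>. snd (g \<theta>))"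

definition dsm_phi :: "real \<Rightarrow> real \<Rightarrow> real \<Rightarrow> circle \<Rightarrow> real \<Rightarrow> real" where
  "dsm_phi lam \<epsilon> \<mu> x y = lam * y + \<mu> + \<epsilon> / (2 * pi) * sin_2pi x"

definition dissipative_standard_map ::
    "real \<Rightarrow> real \<Rightarrow> real \<Rightarrow> circle \<times> real \<Rightarrow> circle \<times> real" where
  "dissipative_standard_map lam \<epsilon> \<mu> =
     (\<lambda>(x, y). (x + to_circle (dsm_phi lam \<epsilon> \<mu> x y), dsm_phi lam \<epsilon> \<mu> x y))"

(* The action of the plane on the cylinder by translations; this is the meaning of the sum
   in K(\<theta>) = (\<theta>, 0) + K_p(\<theta>). *)
definition cylinder_translate :: "circle \<times> real \<Rightarrow> real \<times> real \<Rightarrow> circle \<times> real" where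
  "cylinder_translate p v = (fst p + to_circle (fst v), snd p + snd v)"

(* K = (\<theta>, 0) + Kp with Kp single-valued into the plane makes K homotopic to the zero section
   through s \<mapsto> (\<theta>, 0) + s Kp. *)
definition analytic_invariant_circle ::
    "(circle \<times> real \<Rightarrow> circle \<times> real) \<Rightarrow> real \<Rightarrow> (circle \<Rightarrow> circle \<times> real) \<Rightarrow> bool" where
  "analytic_invariant_circle F \<omega> K \<longleftrightarrow>
     (\<exists>Kp. real_analytic_circle_to_plane Kp \<and>
           (\<forall>\<theta>. K \<theta> = cylinder_translate (\<theta>, 0) (Kp \<theta>))) \<and>
     (\<forall>\<theta>. F (K \<theta>) = K (\<theta> + to_circle \<omega>))"

end

theory Submission
  imports Defs "HOL-Complex_Analysis.Complex_Analysis"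
begin

text \<open>
  Put \<open>t = 2\<pi>\<theta>\<close>, \<open>\<alpha> = 2\<pi>\<omega>\<close> and \<open>X(t) = t + U(t)\<close> for \<open>2\<pi>\<close> times the first component of \<open>K\<close>. The second
  component is determined by the first, and invariance becomes the scalar equation
  \<open>U(t+\<alpha>) - (1+\<lambda>) U(t) + \<lambda> U(t-\<alpha>) + (1-\<lambda>) \<alpha> = c + \<epsilon> sin(X(t))\<close> with \<open>c = 2\<pi>\<mu>\<close>.
  Let \<open>E\<close> be the defect of an approximate solution and \<open>a = 1 + U'\<close>. Differentiating the equation shows that
  the linearised operator maps \<open>a w\<close> to \<open>a(t+\<alpha>) W(t) - \<lambda> a(t-\<alpha>) W(t-\<alpha>) + E' w\<close> with
  \<open>W(t) = w(t+\<alpha>) - w(t)\<close>. Without the quadratically small term \<open>E' w\<close> it is inverted explicitly: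
  \<open>Z = a a(\<cdot>+\<alpha>) W\<close> satisfies \<open>Z - \<lambda> Z(\<cdot>-\<alpha>) = a f\<close>, a geometric series; the change of \<open>c\<close> makes \<open>W\<close>
  have mean zero; and \<open>w\<close> is recovered from \<open>W\<close> with the loss of one derivative, as \<open>\<omega>\<close> is the golden mean.
  The resulting Newton iteration converges quadratically in the algebras of functions with absolutely
  convergent Fourier series on shrinking strips, from any start with \<open>E\<close> at most \<open>2/10^8\<close>, \<open>a\<close> and
  \<open>1/a\<close> bounded by about 2, on a strip of half width \<open>6/100\<close>.

  For each \<open>\<epsilon>\<close> the start is a trigonometric polynomial with integer coefficients over a common denominator.
  To estimate \<open>E\<close>, one also gives a Laurent polynomial \<open>z\<close> with \<open>z(0) = 1\<close> for \<open>exp(iX)\<close>: since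
  \<open>(z exp(-iX))' = (z' - i a z) exp(-iX)\<close>, it is enough that the Laurent polynomial \<open>z' - i a z\<close> is small.
\<close>

section \<open>Absolutely convergent trigonometric series\<close>

text \<open>Nothing is perturbative in \<epsilon>: the only small quantity is the defect, and the
  Newton step uses \<epsilon> \<le> 7/10 merely to bound the quadratic remainder of the sine. All
  constants must therefore be explicit, which dictates the norm. The weighted coefficient sum is
  submultiplicative with constant 1, a power series with nonnegative coefficients is bounded by its
  own value at the norm, and for a trigonometric polynomial with integer coefficients the norm is a
  finite sum that integer arithmetic can bound. The two unbounded operations, d/dt and division by
  the small divisors exp(i k \<alpha>) - 1, are both Fourier multipliers of at most linear growth;
  each costs a strip width \<delta> and a factor of order 1/\<delta>. The new defect is then at most
  335 \<eta>^2/\<delta>^2 for an old one \<eta>; halving \<delta> at each step and asking \<eta> to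
  shrink by 8 determines which starts are admissible.\<close>

text \<open>The frequencies \<open>k n\<close> may repeat, so the \<open>c n\<close> need not be the
  Fourier coefficients: sums and products are formed by mere re-indexing. \<open>C\<close> is an
  upper bound for the weighted sum, hence for the supremum of the extension to the closed strip of
  half width \<rho>.\<close>

definition wiener :: "real \<Rightarrow> (real \<Rightarrow> complex) \<Rightarrow> real \<Rightarrow> bool" where
  "wiener \<rho> f C \<longleftrightarrow> (\<exists>(k::nat \<Rightarrow> int) c.
     (\<forall>t. ((\<lambda>n. c n * cis (of_int (k n) * t)) has_sum f t) UNIV) \<and>
     (\<exists>S\<le>C. ((\<lambda>n. norm (c n) * exp (\<rho> * of_int \<bar>k n\<bar>)) has_sum S) UNIV))"

lemma has_sum_countable_extend:
  fixes g :: "'i::countable \<Rightarrow> 'b::{comm_monoid_add, topological_space}"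
  assumes "(g has_sum x) UNIV"
  shows "((\<lambda>n. if n \<in> range (to_nat :: 'i \<Rightarrow> nat) then g (from_nat n) else 0) has_sum x) UNIV"
proof -
  have "((\<lambda>n. g (from_nat n)) has_sum x) (range (to_nat :: 'i \<Rightarrow> nat))"
    using assms by (subst has_sum_reindex) (auto simp: o_def inj_to_nat)
  then show ?thesis
    by (subst (asm) has_sum_cong_neutral[where T = UNIV]) auto
qed

text \<open>Any countable index type may be used, such as pairs or a single point; outside the range
  of \<open>to_nat\<close> the coefficients are padded with 0.\<close>

lemma wienerI:
  fixes k :: "'i::countable \<Rightarrow> int"
  assumes f: "\<And>t. ((\<lambda>n. c n * cis (of_int (k n) * t)) has_sum f t) UNIV"
    and S: "((\<lambda>n. norm (c n) * exp (\<rho> * of_int \<bar>k n\<bar>)) has_sum S) UNIV" "S \<le> C"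
  shows "wiener \<rho> f C"
proof -
  define c' where "c' n = (if n \<in> range (to_nat :: 'i \<Rightarrow> nat) then c (from_nat n) else 0)" for n
  define k' where "k' n = k (from_nat n)" for n
  have "((\<lambda>n. c' n * cis (of_int (k' n) * t)) has_sum f t) UNIV" for t
    using has_sum_countable_extend[OF f[of t]]
    by (rule has_sum_cong[THEN iffD1, rotated]) (auto simp: c'_def k'_def)
  moreover have "((\<lambda>n. norm (c' n) * exp (\<rho> * of_int \<bar>k' n\<bar>)) has_sum S) UNIV"
    using has_sum_countable_extend[OF S(1)]
    by (rule has_sum_cong[THEN iffD1, rotated]) (auto simp: c'_def k'_def)
  ultimately show ?thesis unfolding wiener_def using S(2) by blast
qed

lemma wienerE:
  assumes "wiener \<rho> f C"
  obtains k :: "nat \<Rightarrow> int" and c S where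
    "\<And>t. ((\<lambda>n. c n * cis (of_int (k n) * t)) has_sum f t) UNIV"
    "((\<lambda>n. norm (c n) * exp (\<rho> * of_int \<bar>k n\<bar>)) has_sum S) UNIV" "0 \<le> S" "S \<le> C"
proof -
  from assms obtain k :: "nat \<Rightarrow> int" and c S where
    *: "\<And>t. ((\<lambda>n. c n * cis (of_int (k n) * t)) has_sum f t) UNIV" "S \<le> C"
    "((\<lambda>n. norm (c n) * exp (\<rho> * of_int \<bar>k n\<bar>)) has_sum S) UNIV"
    unfolding wiener_def by blast
  have "0 \<le> S" using *(3) by (rule has_sum_nonneg) auto
  with * that show ?thesis by blast
qed

lemma wiener_nonneg: "wiener \<rho> f C \<Longrightarrow> 0 \<le> C"
  by (erule wienerE) simp

lemma wiener_mono: "wiener \<rho> f C \<Longrightarrow> C \<le> D \<Longrightarrow> wiener \<rho> f D"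
  unfolding wiener_def by (meson order_trans)


lemma has_sum_mono_exists:
  fixes f g :: "'i \<Rightarrow> real"
  assumes "(f has_sum S) UNIV" "\<And>n. 0 \<le> g n" "\<And>n. g n \<le> f n"
  obtains T where "(g has_sum T) UNIV" "0 \<le> T" "T \<le> S"
proof -
  have "g summable_on UNIV"
    using assms by (intro summable_on_comparison_test[where g = g and f = f]) (auto simp: summable_on_def)
  then obtain T where T: "(g has_sum T) UNIV" by (auto simp: summable_on_def)
  moreover have "T \<le> S" using has_sum_mono[OF T assms(1)] assms(3) by auto
  moreover have "0 \<le> T" using has_sum_nonneg[OF T] assms(2) by auto
  ultimately show ?thesis using that by blast
qed

lemma summable_on_trig:
  fixes k :: "'i \<Rightarrow> int"
  assumes "((\<lambda>n. norm (c n) * exp (\<rho> * of_int \<bar>k n\<bar>)) has_sum S) UNIV" "0 \<le> \<rho>"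
  shows "(\<lambda>n. c n * cis (of_int (k n) * t)) summable_on UNIV"
proof -
  have "norm (c n * cis (of_int (k n) * t)) \<le> norm (c n) * exp (\<rho> * of_int \<bar>k n\<bar>)" for n
    using assms(2) mult_left_mono[of 1 "exp (\<rho> * of_int \<bar>k n\<bar>)" "norm (c n)"]
    by (simp add: norm_mult)
  from has_sum_mono_exists[OF assms(1) norm_ge_zero this]
  obtain T where "((\<lambda>n. norm (c n * cis (of_int (k n) * t))) has_sum T) UNIV" by auto
  then have "(\<lambda>n. norm (c n * cis (of_int (k n) * t))) summable_on UNIV"
    by (rule has_sum_imp_summable)
  then show ?thesis by (rule abs_summable_summable)
qed

text \<open>The series of \<open>f\<close> is handed back together with \<open>g\<close>, so that
  \<open>f\<close> and \<open>g\<close> can be compared term by term without uniqueness of Fourier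
  coefficients. The hypothesis compares the weights at two widths: a growing \<open>m\<close> is
  paid for by \<sigma> < \<rho>.\<close>

lemma wiener_multiplier:
  assumes "wiener \<rho> f C" "0 \<le> \<sigma>"
    and m: "\<And>k::int. norm (m k) * exp (\<sigma> * of_int \<bar>k\<bar>) \<le> M * exp (\<rho> * of_int \<bar>k\<bar>)" "0 \<le> M"
  obtains k :: "nat \<Rightarrow> int" and c S g where
    "\<And>t. ((\<lambda>n. c n * cis (of_int (k n) * t)) has_sum f t) UNIV"
    "((\<lambda>n. norm (c n) * exp (\<rho> * of_int \<bar>k n\<bar>)) has_sum S) UNIV"
    "\<And>t. ((\<lambda>n. m (k n) * c n * cis (of_int (k n) * t)) has_sum g t) UNIV"
    "wiener \<sigma> g (M * C)"
proof -
  obtain k :: "nat \<Rightarrow> int" and c S where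
    *: "\<And>t. ((\<lambda>n. c n * cis (of_int (k n) * t)) has_sum f t) UNIV"
    "((\<lambda>n. norm (c n) * exp (\<rho> * of_int \<bar>k n\<bar>)) has_sum S) UNIV" "0 \<le> S" "S \<le> C" by (rule wienerE[OF assms(1)]) (rule that)
  have "((\<lambda>n. M * (norm (c n) * exp (\<rho> * of_int \<bar>k n\<bar>))) has_sum M * S) UNIV"
    using *(2) by (rule has_sum_cmult_right)
  moreover have "norm (m (k n) * c n) * exp (\<sigma> * of_int \<bar>k n\<bar>) \<le> M * (norm (c n) * exp (\<rho> * of_int \<bar>k n\<bar>))" for n
    using mult_left_mono[OF m(1)[of "k n"], of "norm (c n)"] by (simp add: norm_mult ac_simps)
  ultimately obtain T where T: "((\<lambda>n. norm (m (k n) * c n) * exp (\<sigma> * of_int \<bar>k n\<bar>)) has_sum T) UNIV" "T \<le> M * S"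
    using has_sum_mono_exists[of "\<lambda>n. M * (norm (c n) * exp (\<rho> * of_int \<bar>k n\<bar>))" "M * S"
        "\<lambda>n. norm (m (k n) * c n) * exp (\<sigma> * of_int \<bar>k n\<bar>)"] by auto
  define g where "g t = (\<Sum>\<^sub>\<infinity>n. m (k n) * c n * cis (of_int (k n) * t))" for t
  have g: "((\<lambda>n. m (k n) * c n * cis (of_int (k n) * t)) has_sum g t) UNIV" for t
    unfolding g_def by (rule has_sum_infsum, rule summable_on_trig[OF T(1) assms(2)])
  have "M * S \<le> M * C" using *(4) m(2) by (rule mult_left_mono)
  then have "wiener \<sigma> g (M * C)" using T by (intro wienerI[OF g T(1)]) simp
  then show ?thesis by (rule that[OF *(1,2) g])
qed

lemma wiener_mono_width:
  assumes "wiener \<rho> f C" "0 \<le> \<sigma>" "\<sigma> \<le> \<rho>"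
  shows "wiener \<sigma> f C"
proof -
  obtain k :: "nat \<Rightarrow> int" and c S where
    *: "\<And>t. ((\<lambda>n. c n * cis (of_int (k n) * t)) has_sum f t) UNIV"
    "((\<lambda>n. norm (c n) * exp (\<rho> * of_int \<bar>k n\<bar>)) has_sum S) UNIV" "0 \<le> S" "S \<le> C" by (rule wienerE[OF assms(1)]) (rule that)
  have le: "norm (c n) * exp (\<sigma> * of_int \<bar>k n\<bar>) \<le> norm (c n) * exp (\<rho> * of_int \<bar>k n\<bar>)" for n
    using mult_right_mono[OF assms(3), of "of_int \<bar>k n\<bar>"] by (intro mult_left_mono) auto
  obtain T where "((\<lambda>n. norm (c n) * exp (\<sigma> * of_int \<bar>k n\<bar>)) has_sum T) UNIV" "T \<le> S"
    using has_sum_mono_exists[OF *(2) _ le] by auto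
  then show ?thesis using wienerI[OF *(1) _ order_trans[OF _ *(4)]] by simp
qed

lemma wiener_cis: "wiener \<rho> (\<lambda>t. z * cis (of_int k * t)) (norm z * exp (\<rho> * of_int \<bar>k\<bar>))"
  proof (rule wienerI[where k = "\<lambda>_::unit. k" and c = "\<lambda>_. z", OF _ _ order_refl])
  show "((\<lambda>n::unit. z * cis (of_int k * t)) has_sum z * cis (of_int k * t)) UNIV" for t
    using has_sum_finite[of "UNIV::unit set" "\<lambda>_. z * cis (of_int k * t)"] by (simp add: UNIV_unit)
  show "((\<lambda>n::unit. norm z * exp (\<rho> * of_int \<bar>k\<bar>)) has_sum norm z * exp (\<rho> * of_int \<bar>k\<bar>)) UNIV"
    using has_sum_finite[of "UNIV::unit set" "\<lambda>_. norm z * exp (\<rho> * of_int \<bar>k\<bar>)"] by (simp add: UNIV_unit)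
qed

lemma wiener_const: "wiener \<rho> (\<lambda>_. z) (norm z)"
  using wiener_cis[of \<rho> z 0] by simp

text \<open>Completeness of the algebra: the double series over pairs (j, n) converges absolutely
  and may be summed in either order. Power series, sums of shifts and the limit of the Newton
  iteration all pass through this lemma.\<close>

lemma wiener_has_sum:
  assumes f: "\<And>j::nat. wiener \<rho> (f j) (C j)" and C: "(C has_sum D) UNIV" and "0 \<le> \<rho>"
  obtains F where "\<And>t. ((\<lambda>j. f j t) has_sum F t) UNIV" "wiener \<rho> F D"
proof -
  define Q where "Q j kk cc S \<longleftrightarrow> (\<forall>t. ((\<lambda>n. cc n * cis (of_int (kk n) * t)) has_sum f j t) UNIV) \<and>
     ((\<lambda>n. norm (cc n) * exp (\<rho> * of_int \<bar>kk n\<bar>)) has_sum S) UNIV \<and> 0 \<le> S \<and> S \<le> C j"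
    for j and kk :: "nat \<Rightarrow> int" and cc S
  have "\<exists>kk cc S. Q j kk cc S" for j
  proof -
    obtain kk :: "nat \<Rightarrow> int" and cc S where
      1: "\<And>t. ((\<lambda>n. cc n * cis (of_int (kk n) * t)) has_sum f j t) UNIV"
      and 2: "((\<lambda>n. norm (cc n) * exp (\<rho> * of_int \<bar>kk n\<bar>)) has_sum S) UNIV" "0 \<le> S" "S \<le> C j"
      by (rule wienerE[OF f[of j]]) (rule that)
    have "Q j kk cc S" unfolding Q_def by (intro conjI allI 1 2)
    then show ?thesis by blast
  qed
  then obtain k c S where Q: "\<And>j. Q j (k j) (c j) (S j)"
    by metis
  have *: "\<And>j t. ((\<lambda>n. c j n * cis (of_int (k j n) * t)) has_sum f j t) UNIV"
     "\<And>j. ((\<lambda>n. norm (c j n) * exp (\<rho> * of_int \<bar>k j n\<bar>)) has_sum S j) UNIV"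
     "\<And>j. 0 \<le> S j" "\<And>j. S j \<le> C j"
    using Q unfolding Q_def by simp_all
  obtain T where T: "(S has_sum T) UNIV" "T \<le> D"
    using has_sum_mono_exists[OF C *(3,4)] by auto
  let ?k = "\<lambda>(j, n). k j n" and ?c = "\<lambda>(j, n). c j n"
  have ss: "(\<lambda>x. norm (?c x) * exp (\<rho> * of_int \<bar>?k x\<bar>)) summable_on (UNIV \<times> UNIV)"
  proof (rule summable_on_SigmaI)
    show "((\<lambda>n. norm (?c (j, n)) * exp (\<rho> * of_int \<bar>?k (j, n)\<bar>)) has_sum S j) UNIV" for j
      using *(2)[of j] by simp
    show "S summable_on UNIV" using T(1) by (rule has_sum_imp_summable)
  qed simp
  have sw: "((\<lambda>x. norm (?c x) * exp (\<rho> * of_int \<bar>?k x\<bar>)) has_sum T) (UNIV \<times> UNIV)"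
  proof (rule has_sum_SigmaI[OF _ T(1) ss])
    show "((\<lambda>n. norm (?c (j, n)) * exp (\<rho> * of_int \<bar>?k (j, n)\<bar>)) has_sum S j) UNIV" for j
      using *(2)[of j] by simp
  qed
  define F where "F t = (\<Sum>\<^sub>\<infinity>x. ?c x * cis (of_int (?k x) * t))" for t
  have F: "((\<lambda>x. ?c x * cis (of_int (?k x) * t)) has_sum F t) UNIV" for t
    unfolding F_def using sw assms(3) by (intro has_sum_infsum summable_on_trig) auto
  have "wiener \<rho> F D"
    using F by (rule wienerI) (use sw T(2) in auto)
  moreover have "((\<lambda>j. f j t) has_sum F t) UNIV" for t
    by (rule has_sum_SigmaD[where f = "\<lambda>x. ?c x * cis (of_int (?k x) * t)" and B = "\<lambda>_. UNIV"])
       (use F[of t] *(1) in auto)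
  ultimately show ?thesis using that by blast
qed

section \<open>Algebra operations, shifts and conjugation\<close>

lemma wiener_add:
  assumes "wiener \<rho> f C" "wiener \<rho> g D" "0 \<le> \<rho>"
  shows "wiener \<rho> (\<lambda>t. f t + g t) (C + D)"
proof -
  \<comment> \<open>A sum of two functions is treated as the series f, g, 0, 0, ...\<close>
  define h where "h j = (if j = 0 then f else if j = Suc 0 then g else (\<lambda>_. 0))" for j :: nat
  define E where "E j = (if j = 0 then C else if j = Suc 0 then D else 0)" for j :: nat
  have 2: "(r has_sum s) UNIV \<longleftrightarrow> s = r 0 + r 1" if "\<And>j. j \<ge> 2 \<Longrightarrow> r j = 0" for r :: "nat \<Rightarrow> 'z::real_normed_vector" and s
  proof -
    have "(r has_sum s) UNIV \<longleftrightarrow> (r has_sum s) {0,1}"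
      by (rule has_sum_cong_neutral) (auto intro!: that)
    also have "\<dots> \<longleftrightarrow> s = r 0 + r 1"
      using has_sum_finite[of "{0,1::nat}" r] by (auto dest: has_sum_unique)
    finally show ?thesis .
  qed
  have h: "wiener \<rho> (h j) (E j)" for j
    using assms wiener_const[of \<rho> 0] by (auto simp: h_def E_def)
  have E: "(E has_sum C + D) UNIV" by (subst 2) (auto simp: E_def)
  obtain F where F: "\<And>t. ((\<lambda>j. h j t) has_sum F t) UNIV" "wiener \<rho> F (C + D)"
    using wiener_has_sum[OF h E assms(3)] by blast
  have "F t = f t + g t" for t
    using F(1)[of t] by (subst (asm) 2) (auto simp: h_def)
  then have "F = (\<lambda>t. f t + g t)" by auto
  with F(2) show ?thesis by simp
qed

text \<open>The product series is indexed by pairs and frequencies add. As |k + l| \<le> |k| + |l|,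
  the weight is submultiplicative, so no constant appears.\<close>

lemma wiener_mult:
  assumes "wiener \<rho> f C" "wiener \<rho> g D" "0 \<le> \<rho>"
  shows "wiener \<rho> (\<lambda>t. f t * g t) (C * D)"
proof -
  obtain k :: "nat \<Rightarrow> int" and c S where
    f: "\<And>t. ((\<lambda>n. c n * cis (of_int (k n) * t)) has_sum f t) UNIV"
    "((\<lambda>n. norm (c n) * exp (\<rho> * of_int \<bar>k n\<bar>)) has_sum S) UNIV" "0 \<le> S" "S \<le> C" by (rule wienerE[OF assms(1)]) (rule that)
  obtain l :: "nat \<Rightarrow> int" and d T where
    g: "\<And>t. ((\<lambda>n. d n * cis (of_int (l n) * t)) has_sum g t) UNIV"
    "((\<lambda>n. norm (d n) * exp (\<rho> * of_int \<bar>l n\<bar>)) has_sum T) UNIV" "0 \<le> T" "T \<le> D" by (rule wienerE[OF assms(2)]) (rule that)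
  let ?k = "\<lambda>(m, n). k m + l n" and ?c = "\<lambda>(m, n). c m * d n"
  have "((\<lambda>(m, n). (norm (c m) * exp (\<rho> * of_int \<bar>k m\<bar>)) * (norm (d n) * exp (\<rho> * of_int \<bar>l n\<bar>))) has_sum S * T) (UNIV \<times> UNIV)"
    (is "(?w has_sum _) _")
  proof -
    have 1: "((\<lambda>n. ?w (m, n)) has_sum (norm (c m) * exp (\<rho> * of_int \<bar>k m\<bar>)) * T) UNIV" for m
      using has_sum_cmult_right[OF g(2)] by simp
    have 2: "((\<lambda>m. (norm (c m) * exp (\<rho> * of_int \<bar>k m\<bar>)) * T) has_sum S * T) UNIV"
      by (rule has_sum_cmult_left[OF f(2)])
    have "?w summable_on (UNIV \<times> UNIV)"
      by (rule summable_on_SigmaI[OF 1 has_sum_imp_summable[OF 2]]) auto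
    then show ?thesis by (rule has_sum_SigmaI[OF 1 2])
  qed
  then have w1: "(?w has_sum S * T) UNIV" by simp
  have w2: "norm (?c x) * exp (\<rho> * of_int \<bar>?k x\<bar>) \<le> ?w x" for x
  proof -
    obtain m n where x: "x = (m, n)" by (cases x)
    have "exp (\<rho> * of_int \<bar>k m + l n\<bar>) \<le> exp (\<rho> * of_int \<bar>k m\<bar>) * exp (\<rho> * of_int \<bar>l n\<bar>)"
      using assms(3) by (auto simp flip: exp_add distrib_left intro!: mult_left_mono)
    then have "norm (c m * d n) * exp (\<rho> * of_int \<bar>k m + l n\<bar>) \<le> norm (c m * d n) * (exp (\<rho> * of_int \<bar>k m\<bar>) * exp (\<rho> * of_int \<bar>l n\<bar>))"
      by (rule mult_left_mono) auto
    then show ?thesis by (simp add: x norm_mult ac_simps)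
  qed
  have w0: "0 \<le> norm (?c x) * exp (\<rho> * of_int \<bar>?k x\<bar>)" for x by simp
  obtain R where R: "((\<lambda>x. norm (?c x) * exp (\<rho> * of_int \<bar>?k x\<bar>)) has_sum R) UNIV" "0 \<le> R" "R \<le> S * T"
    by (rule has_sum_mono_exists[OF w1 w0 w2]) (rule that)
  have s: "(\<lambda>x. ?c x * cis (of_int (?k x) * t)) summable_on UNIV" for t
    using R(1) assms(3) by (rule summable_on_trig)
  have "((\<lambda>x. ?c x * cis (of_int (?k x) * t)) has_sum f t * g t) (UNIV \<times> UNIV)" for t
  proof (rule has_sum_SigmaI[where g = "\<lambda>m. (c m * cis (of_int (k m) * t)) * g t"])
    show "((\<lambda>y. ?c (x, y) * cis (of_int (?k (x, y)) * t)) has_sum c x * cis (of_int (k x) * t) * g t) UNIV" for x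
      using has_sum_cmult_right[OF g(1)[of t], of "c x * cis (of_int (k x) * t)"]
      by (simp add: cis_mult ring_distribs ac_simps flip: cis_mult)
    show "((\<lambda>m. c m * cis (of_int (k m) * t) * g t) has_sum f t * g t) UNIV"
      by (rule has_sum_cmult_left[OF f(1)])
    show "(\<lambda>x. ?c x * cis (of_int (?k x) * t)) summable_on UNIV \<times> UNIV"
      using s by simp
  qed
  moreover have "S * T \<le> C * D"
    using f g by (intro mult_mono) auto
  ultimately show ?thesis
    by (intro wienerI[OF _ R(1)]) (use R in auto)
qed

lemma wiener_cmult:
  assumes "wiener \<rho> f C" "0 \<le> \<rho>"
  shows "wiener \<rho> (\<lambda>t. z * f t) (norm z * C)"
  using wiener_mult[OF wiener_const assms] .

lemma wiener_minus:
  assumes "wiener \<rho> f C" "0 \<le> \<rho>"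
  shows "wiener \<rho> (\<lambda>t. - f t) C"
  using wiener_cmult[OF assms, of "-1"] by simp

lemma wiener_diff:
  assumes "wiener \<rho> f C" "wiener \<rho> g D" "0 \<le> \<rho>"
  shows "wiener \<rho> (\<lambda>t. f t - g t) (C + D)"
  using wiener_add[OF assms(1) wiener_minus[OF assms(2,3)] assms(3)] by simp

lemma wiener_shift:
  assumes "wiener \<rho> f C"
  shows "wiener \<rho> (\<lambda>t. f (t + s)) C"
proof -
  obtain k :: "nat \<Rightarrow> int" and c S where
    f: "\<And>t. ((\<lambda>n. c n * cis (of_int (k n) * t)) has_sum f t) UNIV"
    "((\<lambda>n. norm (c n) * exp (\<rho> * of_int \<bar>k n\<bar>)) has_sum S) UNIV" "0 \<le> S" "S \<le> C" by (rule wienerE[OF assms]) (rule that)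
  show ?thesis
  proof (rule wienerI)
    show "((\<lambda>n. (c n * cis (of_int (k n) * s)) * cis (of_int (k n) * t)) has_sum f (t + s)) UNIV" for t
    proof -
      have "c n * cis (of_int (k n) * s) * cis (of_int (k n) * t) = c n * cis (of_int (k n) * (t + s))" for n
        by (simp add: cis_mult algebra_simps)
      then show ?thesis using f(1) by (simp only:)
    qed
    show "((\<lambda>n. norm (c n * cis (of_int (k n) * s)) * exp (\<rho> * of_int \<bar>k n\<bar>)) has_sum S) UNIV"
      using f(2) by (simp add: norm_mult)
  qed fact
qed

lemma wiener_cnj:
  assumes "wiener \<rho> f C"
  shows "wiener \<rho> (\<lambda>t. cnj (f t)) C"
proof -
  obtain k :: "nat \<Rightarrow> int" and c S where
    f: "\<And>t. ((\<lambda>n. c n * cis (of_int (k n) * t)) has_sum f t) UNIV"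
    "((\<lambda>n. norm (c n) * exp (\<rho> * of_int \<bar>k n\<bar>)) has_sum S) UNIV" "0 \<le> S" "S \<le> C" by (rule wienerE[OF assms]) (rule that)
  show ?thesis
  proof (rule wienerI)
    show "((\<lambda>n. cnj (c n) * cis (of_int (- k n) * t)) has_sum cnj (f t)) UNIV" for t
      using has_sum_cnj_iff[THEN iffD2, OF f(1)[of t]] by (simp add: cis_cnj)
    show "((\<lambda>n. norm (cnj (c n)) * exp (\<rho> * of_int \<bar>- k n\<bar>)) has_sum S) UNIV"
      using f(2) by simp
  qed fact
qed

lemma wiener_Re:
  assumes "wiener \<rho> f C" "0 \<le> \<rho>"
  shows "wiener \<rho> (\<lambda>t. of_real (Re (f t))) C"
proof -
  have "wiener \<rho> (\<lambda>t. (1/2) * (f t + cnj (f t))) (norm (1/2::complex) * (C + C))"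
    by (intro wiener_cmult wiener_add wiener_cnj assms)
  then show ?thesis by (simp add: complex_add_cnj)
qed

lemma wiener_norm_le:
  assumes "wiener \<rho> f C" "0 \<le> \<rho>"
  shows "norm (f t) \<le> C"
proof -
  obtain k :: "nat \<Rightarrow> int" and c S where
    f: "\<And>t. ((\<lambda>n. c n * cis (of_int (k n) * t)) has_sum f t) UNIV"
    "((\<lambda>n. norm (c n) * exp (\<rho> * of_int \<bar>k n\<bar>)) has_sum S) UNIV" "0 \<le> S" "S \<le> C" by (rule wienerE[OF assms(1)]) (rule that)
  have le: "norm (c n * cis (of_int (k n) * t)) \<le> norm (c n) * exp (\<rho> * of_int \<bar>k n\<bar>)" for n
    using assms(2) mult_left_mono[of 1 "exp (\<rho> * of_int \<bar>k n\<bar>)" "norm (c n)"]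
    by (simp add: norm_mult)
  obtain T where T: "((\<lambda>n. norm (c n * cis (of_int (k n) * t))) has_sum T) UNIV" "0 \<le> T" "T \<le> S"
    by (rule has_sum_mono_exists[OF f(2) norm_ge_zero le]) (rule that)
  have "norm (f t) \<le> T"
    using norm_infsum_bound[OF has_sum_imp_summable[OF T(1)]] infsumI[OF f(1)[of t]] infsumI[OF T(1)] by simp
  with T f show ?thesis by simp
qed

lemma wiener_periodic:
  assumes "wiener \<rho> f C"
  shows "f (t + 2 * pi) = f t"
proof -
  obtain k :: "nat \<Rightarrow> int" and c S where
    f: "\<And>t. ((\<lambda>n. c n * cis (of_int (k n) * t)) has_sum f t) UNIV" by (rule wienerE[OF assms]) (rule that)
  have "cis (of_int (k n) * (t + 2 * pi)) = cis (of_int (k n) * t)" for n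
  proof -
    have "cis (of_int (k n) * (t + 2 * pi)) = cis (of_int (k n) * t) * cis (2 * pi * of_int (k n))"
      by (simp add: cis_mult algebra_simps)
    then show ?thesis by simp
  qed
  then show ?thesis
    using f[of t] f[of "t + 2 * pi"] by (simp add: has_sum_unique)
qed

section \<open>Power series in the algebra\<close>

lemma wiener_power:
  assumes "wiener \<rho> f C" "0 \<le> \<rho>"
  shows "wiener \<rho> (\<lambda>t. f t ^ n) (C ^ n)"
  by (induction n) (use wiener_const[of \<rho> 1] in \<open>auto intro!: wiener_mult assms\<close>)

text \<open>Nonnegative coefficients make the bound \<open>D\<close> the value at \<open>C\<close>
  of the very same series.\<close>

lemma wiener_power_series:
  fixes a :: "nat \<Rightarrow> real"
  assumes f: "wiener \<rho> f C" "0 \<le> \<rho>" and a: "\<And>n. 0 \<le> a n" "(\<lambda>n. a n * C ^ n) sums D"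
    and F: "\<And>z. norm z \<le> C \<Longrightarrow> (\<lambda>n. of_real (a n) * z ^ n) sums F z"
  shows "wiener \<rho> (\<lambda>t. F (f t)) D"
proof -
  have C: "0 \<le> C" using f(1) by (rule wiener_nonneg)
  have w: "wiener \<rho> (\<lambda>t. of_real (a n) * f t ^ n) (a n * C ^ n)" for n
    using wiener_cmult[OF wiener_power[OF f] f(2), of "of_real (a n)" n] abs_of_nonneg[OF a(1)[of n]]
    unfolding norm_of_real by (simp only:)
  have "((\<lambda>n. a n * C ^ n) has_sum D) UNIV"
    using a C by (intro sums_nonneg_imp_has_sum) auto
  from wiener_has_sum[OF w this f(2)]
  obtain G where G: "\<And>t. ((\<lambda>n. of_real (a n) * f t ^ n) has_sum G t) UNIV" "wiener \<rho> G D"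
    by auto
  have "G t = F (f t)" for t
    using sums_unique2[OF has_sum_imp_sums[OF G(1)] F[OF wiener_norm_le[OF f]]] .
  then have "G = (\<lambda>t. F (f t))" by auto
  with G(2) show ?thesis by simp
qed

lemma wiener_exp:
  assumes "wiener \<rho> f C" "0 \<le> \<rho>"
  shows "wiener \<rho> (\<lambda>t. exp (f t)) (exp C)"
proof (rule wiener_power_series[OF assms, where a = "\<lambda>n. inverse (fact n)"])
  show "(\<lambda>n. inverse (fact n) * C ^ n) sums exp C"
    using exp_converges[of C] by (simp add: scaleR_conv_of_real)
  show "(\<lambda>n. of_real (inverse (fact n)) * z ^ n) sums exp z" for z :: complex
    using exp_converges[of z] by (simp add: scaleR_conv_of_real)
qed simp

text \<open>The bound is quadratic in \<open>C\<close>; it serves for the second order Taylor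
  remainder of the sine in the Newton step.\<close>

lemma wiener_exp_remainder:
  assumes "wiener \<rho> f C" "0 \<le> \<rho>"
  shows "wiener \<rho> (\<lambda>t. exp (f t) - 1 - f t) (exp C - 1 - C)"
proof (rule wiener_power_series[OF assms, where a = "\<lambda>n. if n < 2 then 0 else inverse (fact n)"])
  have *: "(\<lambda>n. of_real (if n < 2 then 0 else inverse (fact n)) * z ^ n) sums (exp z - 1 - z)"
    for z :: "'z::{real_normed_field, banach}"
  proof -
    have "(\<lambda>n. z ^ n /\<^sub>R fact n - (if n \<in> {0, 1} then z ^ n /\<^sub>R fact n else 0)) sums
       (exp z - (\<Sum>n\<in>{0, 1}. z ^ n /\<^sub>R fact n))"
      by (intro sums_diff exp_converges sums_If_finite_set) auto
    also have "(\<lambda>n. z ^ n /\<^sub>R fact n - (if n \<in> {0, 1} then z ^ n /\<^sub>R fact n else 0)) =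
      (\<lambda>n. of_real (if n < 2 then 0 else inverse (fact n)) * z ^ n)"
      by (auto simp: fun_eq_iff scaleR_conv_of_real)
    finally show ?thesis by (simp add: diff_diff_eq)
  qed
  show "(\<lambda>n. (if n < 2 then 0 else inverse (fact n)) * C ^ n) sums (exp C - 1 - C)"
    using *[of C] by (simp only: id_apply of_real_eq_id)
  show "(\<lambda>n. of_real (if n < 2 then 0 else inverse (fact n)) * z ^ n) sums (exp z - 1 - z)" for z :: complex
    by (rule *)
qed simp

lemma wiener_geometric:
  assumes "wiener \<rho> f C" "0 \<le> \<rho>" "C < 1"
  shows "wiener \<rho> (\<lambda>t. 1 / (1 - f t)) (1 / (1 - C))"
proof (rule wiener_power_series[OF assms(1,2), where a = "\<lambda>_. 1"])
  have "0 \<le> C" using assms(1) by (rule wiener_nonneg)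
  then show "(\<lambda>n. 1 * C ^ n) sums (1 / (1 - C))" using geometric_sums[of C] assms(3) by simp
  show "(\<lambda>n. of_real 1 * z ^ n) sums (1 / (1 - z))" if "norm z \<le> C" for z :: complex
    using geometric_sums[of z] assms(3) that by simp
qed simp

lemma wiener_inverse_perturb:
  assumes a: "wiener \<rho> (\<lambda>t. 1 / a t) B" and d: "wiener \<rho> d D" and "0 \<le> \<rho>" and "B * D < 1"
    and nz: "\<And>t. a t \<noteq> 0"
  shows "wiener \<rho> (\<lambda>t. 1 / (a t + d t)) (B / (1 - B * D))"
proof -
  have q: "wiener \<rho> (\<lambda>t. - ((1 / a t) * d t)) (B * D)"
    by (intro wiener_minus wiener_mult assms)
  have "wiener \<rho> (\<lambda>t. (1 / a t) * (1 / (1 - - ((1 / a t) * d t)))) (B * (1 / (1 - B * D)))"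
    by (intro wiener_mult wiener_geometric q assms)
  also have "(\<lambda>t. (1 / a t) * (1 / (1 - - ((1 / a t) * d t)))) = (\<lambda>t. 1 / (a t + d t))"
    using nz by (auto simp: fun_eq_iff field_simps)
  finally show ?thesis by simp
qed

section \<open>Loss of strip width, holomorphic extension, derivatives\<close>

text \<open>The maximum of the left side is attained at x = 1/d; the proof is exp y \<ge> 1 + y at y
  = d x - 1.\<close>

lemma mult_exp_neg_le:
  fixes d x :: real
  assumes "0 < d"
  shows "x * exp (- (d * x)) \<le> 1 / (exp 1 * d)"
proof -
  have "d * x \<le> exp (d * x - 1)" using exp_ge_add_one_self[of "d * x - 1"] by simp
  then have "(d * x) * exp (- (d * x)) \<le> exp (d * x - 1) * exp (- (d * x))"
    by (rule mult_right_mono) simp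
  also have "\<dots> = 1 / exp 1" by (simp add: exp_minus field_simps flip: exp_add)
  finally show ?thesis using assms by (simp add: field_simps)
qed

text \<open>The price of a multiplier of linear growth. It is applied with \<open>B\<close> = 1 for
  the derivative and, eventually, \<open>B\<close> = 7/10 for the small divisors.\<close>

lemma multiplier_width:
  assumes "0 < d" "0 \<le> B" "norm (m k) \<le> B * of_int \<bar>k\<bar>"
  shows "norm (m (k::int)) * exp ((\<rho> - d) * of_int \<bar>k\<bar>) \<le> (B / (exp 1 * d)) * exp (\<rho> * of_int \<bar>k\<bar>)"
proof -
  let ?x = "of_int \<bar>k\<bar> :: real"
  have "norm (m k) * exp ((\<rho> - d) * ?x) = norm (m k) * exp (- (d * ?x)) * exp (\<rho> * ?x)"
    by (simp add: algebra_simps flip: exp_add)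
  also have "\<dots> \<le> (B * ?x * exp (- (d * ?x))) * exp (\<rho> * ?x)"
    using assms(3) by (intro mult_right_mono) auto
  also have "\<dots> \<le> (B * (1 / (exp 1 * d))) * exp (\<rho> * ?x)"
    using mult_left_mono[OF mult_exp_neg_le[OF assms(1), of ?x] assms(2)] by (intro mult_right_mono) (auto simp: mult.assoc)
  finally show ?thesis by simp
qed


lemma trig_series_summable:
  fixes k :: "nat \<Rightarrow> int"
  assumes S: "((\<lambda>n. norm (c n) * exp (\<rho> * of_int \<bar>k n\<bar>)) has_sum S) UNIV" and z: "\<bar>Im z\<bar> \<le> \<rho>"
  shows "summable (\<lambda>n. c n * exp (\<i> * of_int (k n) * z))"
proof (rule summable_comparison_test)
  have "\<bar>of_int (k n) * Im z\<bar> \<le> \<rho> * of_int \<bar>k n\<bar>" for n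
    using mult_right_mono[OF z, of "of_int \<bar>k n\<bar>"] by (simp add: abs_mult mult.commute)
  then have "- (of_int (k n) * Im z) \<le> \<rho> * of_int \<bar>k n\<bar>" for n
    by (meson abs_ge_minus_self order_trans)
  then have "norm (c n * exp (\<i> * of_int (k n) * z)) \<le> norm (c n) * exp (\<rho> * of_int \<bar>k n\<bar>)" for n
    by (auto simp: norm_mult intro!: mult_left_mono)
  then show "\<exists>N. \<forall>n\<ge>N. norm (c n * exp (\<i> * of_int (k n) * z)) \<le> norm (c n) * exp (\<rho> * of_int \<bar>k n\<bar>)"
    by blast
  show "summable (\<lambda>n. norm (c n) * exp (\<rho> * of_int \<bar>k n\<bar>))"
    using S by (intro sums_summable[OF has_sum_imp_sums])
qed

lemma trig_series_has_field_derivative: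
  fixes k :: "nat \<Rightarrow> int"
  assumes S: "((\<lambda>n. norm (c n) * exp (\<rho> * of_int \<bar>k n\<bar>)) has_sum S) UNIV" and z: "\<bar>Im z\<bar> < \<rho>"
  shows "((\<lambda>z. \<Sum>n. c n * exp (\<i> * of_int (k n) * z)) has_field_derivative
     (\<Sum>n. c n * (\<i> * of_int (k n)) * exp (\<i> * of_int (k n) * z))) (at z)"
proof -
  \<comment> \<open>An intermediate strip: on it the factor \<open>k n\<close> of the differentiated
    series is absorbed by the width \<rho> - \<sigma>, which gives the uniform convergence needed
    for termwise differentiation.\<close>
  obtain \<sigma> where \<sigma>: "\<bar>Im z\<bar> < \<sigma>" "\<sigma> < \<rho>" using dense[OF z] by auto
  define T where "T = {w. \<bar>Im w\<bar> < \<sigma>}"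
  have T_eq: "T = {w. Im w < \<sigma>} \<inter> {w. Im w > - \<sigma>}" by (auto simp: T_def)
  have "convex T" unfolding T_eq
    by (intro convex_Int convex_halfspace_Im_lt convex_halfspace_Im_gt)
  have "open T" unfolding T_eq
    by (intro open_Int open_halfspace_Im_lt open_halfspace_Im_gt)
  have zT: "z \<in> T" using \<sigma> by (simp add: T_def)
  let ?d = "\<rho> - \<sigma>"
  let ?M = "\<lambda>n. (1 / (exp 1 * ?d)) * (norm (c n) * exp (\<rho> * of_int \<bar>k n\<bar>))"
  have M: "norm (c n * (\<i> * of_int (k n)) * exp (\<i> * of_int (k n) * w)) \<le> ?M n" if "w \<in> T" for n w
  proof -
    have "\<bar>of_int (k n) * Im w\<bar> \<le> \<sigma> * of_int \<bar>k n\<bar>"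
      using mult_right_mono[of "\<bar>Im w\<bar>" \<sigma> "of_int \<bar>k n\<bar>"] that by (simp add: abs_mult mult.commute T_def)
    then have 1: "- (of_int (k n) * Im w) \<le> (\<rho> - ?d) * of_int \<bar>k n\<bar>"
      by (simp add: abs_le_iff)
    have "norm (c n * (\<i> * of_int (k n)) * exp (\<i> * of_int (k n) * w))
        = norm (c n) * (of_int \<bar>k n\<bar> * exp (- (of_int (k n) * Im w)))"
      by (simp add: norm_mult)
    also have "\<dots> \<le> norm (c n) * (of_int \<bar>k n\<bar> * exp ((\<rho> - ?d) * of_int \<bar>k n\<bar>))"
      using 1 by (intro mult_left_mono) auto
    also have "\<dots> \<le> norm (c n) * ((1 / (exp 1 * ?d)) * exp (\<rho> * of_int \<bar>k n\<bar>))"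
      using multiplier_width[of ?d 1 "\<lambda>k. of_int k :: complex" "k n" \<rho>] \<sigma> by (intro mult_left_mono) auto
    finally show ?thesis by (simp add: ac_simps)
  qed
  have "summable ?M"
    using S by (intro summable_mult sums_summable[OF has_sum_imp_sums])
  with M have unif: "uniformly_convergent_on T (\<lambda>n w. \<Sum>i<n. c i * (\<i> * of_int (k i)) * exp (\<i> * of_int (k i) * w))"
    by (rule Weierstrass_m_test')
  show ?thesis
  proof (rule has_field_derivative_series'(2)[OF \<open>convex T\<close> _ unif zT])
    show "((\<lambda>z. c n * exp (\<i> * of_int (k n) * z)) has_field_derivative
        c n * (\<i> * of_int (k n)) * exp (\<i> * of_int (k n) * w)) (at w within T)" for n w
      by (auto intro!: derivative_eq_intros)
    show "summable (\<lambda>n. c n * exp (\<i> * of_int (k n) * z))"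
      using trig_series_summable[OF S] z by simp
    show "z \<in> interior T" using zT \<open>open T\<close> by (simp add: interior_open)
  qed
qed

lemma cis_of_int_mult: "cis (of_int k * t) = exp (\<i> * of_int k * complex_of_real t)"
  by (simp add: cis_conv_exp mult.assoc)

lemma wiener_holomorphic_extension:
  assumes "wiener \<rho> f C" "0 < \<rho>"
  obtains F where "F holomorphic_on {z. \<bar>Im z\<bar> < \<rho>}" "\<And>z. F (z + 2 * of_real pi) = F z"
    "\<And>t. F (of_real t) = f t"
proof -
  obtain k :: "nat \<Rightarrow> int" and c S where
    f: "\<And>t. ((\<lambda>n. c n * cis (of_int (k n) * t)) has_sum f t) UNIV"
    "((\<lambda>n. norm (c n) * exp (\<rho> * of_int \<bar>k n\<bar>)) has_sum S) UNIV" "0 \<le> S" "S \<le> C" by (rule wienerE[OF assms(1)]) (rule that)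
  define F where "F z = (\<Sum>n. c n * exp (\<i> * of_int (k n) * z))" for z
  have "F field_differentiable at z within {z. \<bar>Im z\<bar> < \<rho>}" if "\<bar>Im z\<bar> < \<rho>" for z
  proof -
    have "F = (\<lambda>z. \<Sum>n. c n * exp (\<i> * of_int (k n) * z))" by (rule ext) (rule F_def)
    then show ?thesis
      using has_field_derivative_at_within[OF trig_series_has_field_derivative[OF f(2) that]]
      unfolding field_differentiable_def by (simp only:) (rule exI)
  qed
  then have "F holomorphic_on {z. \<bar>Im z\<bar> < \<rho>}" by (auto simp: holomorphic_on_def)
  moreover have "exp (\<i> * of_int (k n) * (z + 2 * of_real pi)) = exp (\<i> * of_int (k n) * z)" for n z
  proof -
    have "exp (\<i> * of_int (k n) * (z + 2 * of_real pi)) = exp (\<i> * of_int (k n) * z + of_int (k n) * (of_real pi * 2) * \<i>)"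
      by (simp add: algebra_simps)
    then show ?thesis
      using exp_eq[of "\<i> * of_int (k n) * z + of_int (k n) * (of_real pi * 2) * \<i>" "\<i> * of_int (k n) * z"] 
      by (simp add: algebra_simps)
  qed
  then have "F (z + 2 * of_real pi) = F z" for z by (simp add: F_def)
  moreover have "F (of_real t) = f t" for t
    using sums_unique[OF has_sum_imp_sums[OF f(1)[of t]]] by (simp add: F_def cis_of_int_mult)
  ultimately show ?thesis by (rule that)
qed

lemma wiener_deriv:
  assumes "wiener \<rho> f C" "0 < \<delta>" "\<delta> \<le> \<rho>"
  obtains f' where "\<And>t. (f has_vector_derivative f' t) (at t)" "wiener (\<rho> - \<delta>) f' (C / (exp 1 * \<delta>))"
proof -
  obtain k :: "nat \<Rightarrow> int" and c S f' where
    f: "\<And>t. ((\<lambda>n. c n * cis (of_int (k n) * t)) has_sum f t) UNIV"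
    "((\<lambda>n. norm (c n) * exp (\<rho> * of_int \<bar>k n\<bar>)) has_sum S) UNIV"
    "\<And>t. ((\<lambda>n. \<i> * of_int (k n) * c n * cis (of_int (k n) * t)) has_sum f' t) UNIV"
    "wiener (\<rho> - \<delta>) f' (1 / (exp 1 * \<delta>) * C)"
    by (rule wiener_multiplier[OF assms(1), of "\<rho> - \<delta>" "\<lambda>k. \<i> * of_int k" "1 / (exp 1 * \<delta>)"])
       (use assms multiplier_width[of \<delta> 1 "\<lambda>k. \<i> * of_int k" _ \<rho>] in \<open>auto simp: norm_mult\<close>)
  have "(f has_vector_derivative f' t) (at t)" for t
  proof -
    have "((\<lambda>z. \<Sum>n. c n * exp (\<i> * of_int (k n) * z)) has_field_derivative
     (\<Sum>n. c n * (\<i> * of_int (k n)) * exp (\<i> * of_int (k n) * of_real t))) (at (of_real t))"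
      using assms by (intro trig_series_has_field_derivative[OF f(2)]) simp
    moreover have "(\<Sum>n. c n * (\<i> * of_int (k n)) * exp (\<i> * of_int (k n) * of_real t)) = f' t"
      using sums_unique[OF has_sum_imp_sums[OF f(3)[of t]]] 
      unfolding cis_of_int_mult mult.commute[of "\<i> * of_int _" "c _"] by (rule sym)
    ultimately have "((\<lambda>s. (\<Sum>n. c n * exp (\<i> * of_int (k n) * of_real s))) has_vector_derivative f' t) (at t)"
      using has_vector_derivative_real_field by fastforce
    moreover have "(\<Sum>n. c n * exp (\<i> * of_int (k n) * of_real s)) = f s" for s
      using sums_unique[OF has_sum_imp_sums[OF f(1)[of s]]] by (simp add: cis_of_int_mult)
    ultimately show ?thesis by simp
  qed
  then show ?thesis by (rule that) (use f(4) in simp)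
qed

section \<open>Mean values and the cohomological equation\<close>

lemma integral_cis_period:
  "((\<lambda>t. cis (of_int k * t)) has_integral (if k = 0 then 2 * of_real pi else 0)) {0..2*pi}"
proof (cases "k = 0")
  case True
  then show ?thesis using has_integral_const_real[of "1::complex" 0 "2*pi"] by (simp add: scaleR_conv_of_real)
next
  case False
  have "((\<lambda>t. cis (of_int k * t)) has_integral (cis (of_int k * (2 * pi)) / (\<i> * of_int k) - cis (of_int k * 0) / (\<i> * of_int k))) {0..2*pi}"
  proof (rule fundamental_theorem_of_calculus)
    fix t :: real
    have "((\<lambda>z. exp (\<i> * of_int k * z) / (\<i> * of_int k)) has_field_derivative exp (\<i> * of_int k * of_real t)) (at (of_real t))"
      using False by (auto intro!: derivative_eq_intros)
    from has_vector_derivative_real_field[OF this]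
    show "((\<lambda>t. cis (of_int k * t) / (\<i> * of_int k)) has_vector_derivative cis (of_int k * t)) (at t within {0..2*pi})"
      unfolding cis_of_int_mult by (rule has_vector_derivative_at_within)
  qed simp
  moreover have "cis (of_int k * (2 * pi)) = 1"
    using cis_multiple_2pi[of "of_int k"] by (simp add: ac_simps)
  ultimately show ?thesis using False by simp
qed

text \<open>Because frequencies may repeat, the mean is the sum of all coefficients with
  \<open>k n = 0\<close>, not a single one.\<close>

lemma trig_series_has_integral:
  fixes k :: "nat \<Rightarrow> int"
  assumes f: "\<And>t. ((\<lambda>n. c n * cis (of_int (k n) * t)) has_sum f t) UNIV"
    and S: "((\<lambda>n. norm (c n) * exp (\<rho> * of_int \<bar>k n\<bar>)) has_sum S) UNIV" and "0 \<le> \<rho>"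
  obtains m where "((\<lambda>n. if k n = 0 then c n else 0) has_sum m) UNIV"
    "(f has_integral 2 * of_real pi * m) {0..2*pi}"
proof -
  have le: "norm (if k n = 0 then c n else 0) \<le> norm (c n) * exp (\<rho> * of_int \<bar>k n\<bar>)" for n
    using assms(3) mult_left_mono[of 1 "exp (\<rho> * of_int \<bar>k n\<bar>)" "norm (c n)"] by auto
  obtain T where "((\<lambda>n. norm (if k n = 0 then c n else 0)) has_sum T) UNIV" "0 \<le> T" "T \<le> S"
    by (rule has_sum_mono_exists[OF S norm_ge_zero le]) (rule that)
  then have "(\<lambda>n. if k n = 0 then c n else 0) summable_on UNIV"
    by (auto intro: abs_summable_summable[OF has_sum_imp_summable])
  then obtain m where m: "((\<lambda>n. if k n = 0 then c n else 0) has_sum m) UNIV"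
    by (auto simp: summable_on_def)
  have "norm (c n * cis (of_int (k n) * t)) \<le> norm (c n) * exp (\<rho> * of_int \<bar>k n\<bar>)" for n t
    using assms(3) mult_left_mono[of 1 "exp (\<rho> * of_int \<bar>k n\<bar>)" "norm (c n)"] by (simp add: norm_mult)
  then have u: "uniform_limit {0..2*pi} (\<lambda>N t. \<Sum>n<N. c n * cis (of_int (k n) * t)) (\<lambda>t. \<Sum>n. c n * cis (of_int (k n) * t)) sequentially"
    by (rule Weierstrass_m_test) (rule sums_summable[OF has_sum_imp_sums[OF S]])
  have fe: "(\<lambda>t. \<Sum>n. c n * cis (of_int (k n) * t)) = f"
    using sums_unique[OF has_sum_imp_sums[OF f]] by (auto simp: fun_eq_iff)
  have cont: "continuous_on {0..2*pi} (\<lambda>t. \<Sum>n<N. c n * cis (of_int (k n) * t))" for N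
    by (intro continuous_intros)
  obtain I J where IJ: "\<And>N. ((\<lambda>t. \<Sum>n<N. c n * cis (of_int (k n) * t)) has_integral I N) {0..2*pi}"
      "(f has_integral J) {0..2*pi}" "I \<longlonglongrightarrow> J"
    by (rule uniform_limit_integral[OF u[unfolded fe] cont]) (auto intro: that)
  have lim: "(\<lambda>N. 2 * of_real pi * (\<Sum>n<N. if k n = 0 then c n else 0)) \<longlonglongrightarrow> 2 * of_real pi * m"
    using has_sum_imp_sums[OF m] unfolding sums_def by (rule tendsto_mult_left)
  have "I N = 2 * of_real pi * (\<Sum>n<N. if k n = 0 then c n else 0)" for N
  proof (rule has_integral_unique[OF IJ(1)])
    have "((\<lambda>t. \<Sum>n<N. c n * cis (of_int (k n) * t)) has_integral (\<Sum>n<N. c n * (if k n = 0 then 2 * of_real pi else 0))) {0..2*pi}"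
      by (intro has_integral_sum has_integral_mult_right integral_cis_period) auto
    moreover have "(\<Sum>n<N. c n * (if k n = 0 then 2 * of_real pi else 0)) = 2 * of_real pi * (\<Sum>n<N. if k n = 0 then c n else 0)"
      unfolding sum_distrib_left by (intro sum.cong) auto
    ultimately show "((\<lambda>t. \<Sum>n<N. c n * cis (of_int (k n) * t)) has_integral 2 * of_real pi * (\<Sum>n<N. if k n = 0 then c n else 0)) {0..2*pi}"
      by (simp only:)
  qed
  then have "I = (\<lambda>N. 2 * of_real pi * (\<Sum>n<N. if k n = 0 then c n else 0))" by (rule ext)
  with lim have "I \<longlonglongrightarrow> 2 * of_real pi * m" by (simp only:)
  then have "J = 2 * of_real pi * m"
    using IJ(3) LIMSEQ_unique by blast
  with IJ(2) m show ?thesis by (intro that) auto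
qed

lemma has_sum_diff':
  fixes f g :: "'i \<Rightarrow> complex"
  assumes "(f has_sum a) A" "(g has_sum b) A"
  shows "((\<lambda>x. f x - g x) has_sum (a - b)) A"
  using has_sum_add[OF assms(1) has_sum_uminusI[OF assms(2)]] by simp

text \<open>Frequency by frequency, \<open>W\<close> is divided by exp(i k \<alpha>) - 1. The
  condition \<open>dio\<close> bounds this multiplier by B |k|, and the vanishing mean removes the
  obstruction at k = 0, where the multiplier is set to 0.\<close>

lemma wiener_cohomological:
  assumes W: "wiener \<rho> W C" "0 < \<delta>" "\<delta> \<le> \<rho>" "(W has_integral 0) {0..2*pi}"
    and dio: "\<And>k::int. k \<noteq> 0 \<Longrightarrow> 1 \<le> B * of_int \<bar>k\<bar> * norm (cis (of_int k * \<alpha>) - 1)" and "0 \<le> B"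
  obtains w where "\<And>t. w (t + \<alpha>) - w t = W t" "wiener (\<rho> - \<delta>) w (B / (exp 1 * \<delta>) * C)"
proof -
  define m where "m k = (if k = 0 then 0 else 1 / (cis (of_int k * \<alpha>) - 1))" for k :: int
  have nz: "cis (of_int k * \<alpha>) - 1 \<noteq> 0" if "k \<noteq> 0" for k :: int
    using dio[OF that] by auto
  have "norm (m k) \<le> B * of_int \<bar>k\<bar>" for k
  proof (cases "k = 0")
    case False
    then have "0 < norm (cis (of_int k * \<alpha>) - 1)" using nz by simp
    then show ?thesis using dio[OF False] False by (simp add: m_def norm_divide field_simps)
  qed (simp add: m_def)
  then have mw: "norm (m k) * exp ((\<rho> - \<delta>) * of_int \<bar>k\<bar>) \<le> B / (exp 1 * \<delta>) * exp (\<rho> * of_int \<bar>k\<bar>)" for k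
    using assms by (intro multiplier_width) auto
  obtain k :: "nat \<Rightarrow> int" and c S w where
    f: "\<And>t. ((\<lambda>n. c n * cis (of_int (k n) * t)) has_sum W t) UNIV"
    "((\<lambda>n. norm (c n) * exp (\<rho> * of_int \<bar>k n\<bar>)) has_sum S) UNIV"
    "\<And>t. ((\<lambda>n. m (k n) * c n * cis (of_int (k n) * t)) has_sum w t) UNIV"
    "wiener (\<rho> - \<delta>) w (B / (exp 1 * \<delta>) * C)"
    by (rule wiener_multiplier[OF W(1) _ mw]) (use assms in auto)
  obtain a where a: "((\<lambda>n. if k n = 0 then c n else 0) has_sum a) UNIV"
    "(W has_integral 2 * of_real pi * a) {0..2*pi}"
    by (rule trig_series_has_integral[OF f(1,2)]) (use assms in auto)
  have "a = 0" using has_integral_unique[OF a(2) W(4)] by simp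
  have "w (t + \<alpha>) - w t = W t" for t
  proof -
    have 1: "((\<lambda>n. m (k n) * c n * cis (of_int (k n) * (t + \<alpha>)) - m (k n) * c n * cis (of_int (k n) * t)) has_sum (w (t + \<alpha>) - w t)) UNIV"
      by (intro has_sum_diff' f(3))
    \<comment> \<open>The coefficients of frequency 0 need not vanish individually, only their sum
      does. Subtracting their series, of sum 0, makes the two sides agree term by term.\<close>
    have 2: "((\<lambda>n. c n * cis (of_int (k n) * t) - (if k n = 0 then c n else 0)) has_sum (W t - 0)) UNIV"
      using a(1) \<open>a = 0\<close> by (intro has_sum_diff' f(1)) simp
    have eq: "m (k n) * c n * cis (of_int (k n) * (t + \<alpha>)) - m (k n) * c n * cis (of_int (k n) * t)
        = c n * cis (of_int (k n) * t) - (if k n = 0 then c n else 0)" for n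
    proof (cases "k n = 0")
      case False
      have c: "cis (of_int (k n) * (t + \<alpha>)) = cis (of_int (k n) * t) * cis (of_int (k n) * \<alpha>)"
        by (simp add: distrib_left cis_mult)
      have "m (k n) * c n * cis (of_int (k n) * (t + \<alpha>)) - m (k n) * c n * cis (of_int (k n) * t)
          = (m (k n) * (cis (of_int (k n) * \<alpha>) - 1)) * (c n * cis (of_int (k n) * t))"
        unfolding c by (simp add: algebra_simps)
      also have "m (k n) * (cis (of_int (k n) * \<alpha>) - 1) = 1"
        using False nz[OF False] by (simp add: m_def)
      finally show ?thesis using False by simp
    qed (simp add: m_def)
    show ?thesis using has_sum_unique[OF 1[unfolded eq] 2] by simp
  qed
  with f(4) show ?thesis by (intro that)
qed

section \<open>Real-valued functions\<close>

abbreviation wiener_real :: "real \<Rightarrow> (real \<Rightarrow> real) \<Rightarrow> real \<Rightarrow> bool" where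
  "wiener_real \<rho> u C \<equiv> wiener \<rho> (\<lambda>t. complex_of_real (u t)) C"

lemma wiener_real_mult:
  assumes "wiener_real \<rho> f C" "wiener_real \<rho> g D" "0 \<le> \<rho>"
  shows "wiener_real \<rho> (\<lambda>t. f t * g t) (C * D)"
  using wiener_mult[OF assms] by simp

lemma wiener_real_add:
  assumes "wiener_real \<rho> f C" "wiener_real \<rho> g D" "0 \<le> \<rho>"
  shows "wiener_real \<rho> (\<lambda>t. f t + g t) (C + D)"
  using wiener_add[OF assms] by simp

lemma wiener_real_diff:
  assumes "wiener_real \<rho> f C" "wiener_real \<rho> g D" "0 \<le> \<rho>"
  shows "wiener_real \<rho> (\<lambda>t. f t - g t) (C + D)"
  using wiener_diff[OF assms] by simp

lemma wiener_real_const: "wiener_real \<rho> (\<lambda>_. z) \<bar>z\<bar>"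
  using wiener_const[of \<rho> "of_real z"] by simp

lemma wiener_real_cmult:
  assumes "wiener_real \<rho> f C" "0 \<le> \<rho>"
  shows "wiener_real \<rho> (\<lambda>t. z * f t) (\<bar>z\<bar> * C)"
  using wiener_cmult[OF assms, of "of_real z"] by simp

lemma wiener_real_abs_le:
  assumes "wiener_real \<rho> f C" "0 \<le> \<rho>"
  shows "\<bar>f t\<bar> \<le> C"
  using wiener_norm_le[OF assms, of t] by simp

lemma wiener_real_deriv:
  assumes "wiener_real \<rho> f C" "0 < \<delta>" "\<delta> \<le> \<rho>"
  obtains f' where "\<And>t. (f has_real_derivative f' t) (at t)" "wiener_real (\<rho> - \<delta>) f' (C / (exp 1 * \<delta>))"
proof -
  obtain g where g: "\<And>t. ((\<lambda>t. complex_of_real (f t)) has_vector_derivative g t) (at t)"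
    "wiener (\<rho> - \<delta>) g (C / (exp 1 * \<delta>))"
    by (rule wiener_deriv[OF assms]) (rule that)
  have "(f has_real_derivative Re (g t)) (at t)" for t
    using bounded_linear.has_vector_derivative[OF bounded_linear_Re g(1)[of t]]
    by (simp add: has_real_derivative_iff_has_vector_derivative)
  moreover have "wiener_real (\<rho> - \<delta>) (\<lambda>t. Re (g t)) (C / (exp 1 * \<delta>))"
    using g(2) assms by (intro wiener_Re) auto
  ultimately show ?thesis by (rule that)
qed

lemma wiener_real_has_integral:
  assumes "wiener_real \<rho> f C" "0 \<le> \<rho>"
  obtains I where "(f has_integral I) {0..2*pi}"
proof -
  obtain k :: "nat \<Rightarrow> int" and c S where
    f: "\<And>t. ((\<lambda>n. c n * cis (of_int (k n) * t)) has_sum of_real (f t)) UNIV"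
    "((\<lambda>n. norm (c n) * exp (\<rho> * of_int \<bar>k n\<bar>)) has_sum S) UNIV" "0 \<le> S" "S \<le> C" by (rule wienerE[OF assms(1)]) (rule that)
  obtain m where "((\<lambda>t. complex_of_real (f t)) has_integral 2 * of_real pi * m) {0..2*pi}"
    by (rule trig_series_has_integral[OF f(1,2) assms(2)]) (rule that)
  from has_integral_linear[OF this bounded_linear_Re]
  have "(f has_integral Re (2 * of_real pi * m)) {0..2*pi}" by (simp add: o_def)
  then show ?thesis by (rule that)
qed

lemma wiener_real_cohomological:
  assumes W: "wiener_real \<rho> W C" "0 < \<delta>" "\<delta> \<le> \<rho>" "(W has_integral 0) {0..2*pi}"
    and dio: "\<And>k::int. k \<noteq> 0 \<Longrightarrow> 1 \<le> B * of_int \<bar>k\<bar> * norm (cis (of_int k * \<alpha>) - 1)" and "0 \<le> B"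
  obtains w where "\<And>t. w (t + \<alpha>) - w t = W t" "wiener_real (\<rho> - \<delta>) w (B / (exp 1 * \<delta>) * C)"
proof -
  have "((\<lambda>t. complex_of_real (W t)) has_integral 0) {0..2*pi}"
  proof -
    have "bounded_linear complex_of_real" by (rule bounded_linear_of_real)
    from has_integral_linear[OF W(4) this] show ?thesis by (simp add: o_def)
  qed
  then obtain w where w: "\<And>t. w (t + \<alpha>) - w t = complex_of_real (W t)"
    "wiener (\<rho> - \<delta>) w (B / (exp 1 * \<delta>) * C)"
    by (rule wiener_cohomological[OF W(1-3) _ dio \<open>0 \<le> B\<close>]) (auto intro: that)
  have "Re (w (t + \<alpha>)) - Re (w t) = W t" for t
    using arg_cong[OF w(1)[of t], of Re] by simp
  moreover have "wiener_real (\<rho> - \<delta>) (\<lambda>t. Re (w t)) (B / (exp 1 * \<delta>) * C)"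
    using w(2) assms by (intro wiener_Re) auto
  ultimately show ?thesis by (rule that)
qed

section \<open>Geometric sums of shifts\<close>

text \<open>The Neumann series for the bounded solution Z of Z(t) - q Z(t - \<alpha>) = g(t). It is
  a positive operator in \<open>g\<close>, which later controls the correction of the
  parameter.\<close>

definition geometric_shift_sum :: "real \<Rightarrow> real \<Rightarrow> (real \<Rightarrow> real) \<Rightarrow> real \<Rightarrow> real" where
  "geometric_shift_sum q \<alpha> g t = (\<Sum>n. q ^ n * g (t - of_nat n * \<alpha>))"

context
  fixes q \<alpha> :: real
  assumes q: "0 \<le> q" "q < 1"
begin

lemma geometric_shift_summable:
  assumes "\<And>t. \<bar>g t\<bar> \<le> C"
  shows "summable (\<lambda>n. q ^ n * g (t - of_nat n * \<alpha>))"
proof (rule summable_comparison_test)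
  show "\<exists>N. \<forall>n\<ge>N. norm (q ^ n * g (t - of_nat n * \<alpha>)) \<le> C * q ^ n"
    using assms q by (auto simp: abs_mult mult.commute[of C] intro!: mult_left_mono)
  show "summable (\<lambda>n. C * q ^ n)" using q by (intro summable_mult summable_geometric) auto
qed

lemma geometric_shift_sum_eq:
  assumes "\<And>t. \<bar>g t\<bar> \<le> C"
  shows "geometric_shift_sum q \<alpha> g t - q * geometric_shift_sum q \<alpha> g (t - \<alpha>) = g t"
proof -
  have s: "summable (\<lambda>n. q ^ n * g (t - of_nat n * \<alpha>))" for t
    using assms by (rule geometric_shift_summable)
  have "geometric_shift_sum q \<alpha> g t = (\<Sum>n. q ^ Suc n * g (t - of_nat (Suc n) * \<alpha>)) + g t"
    unfolding geometric_shift_sum_def using suminf_split_head[OF s[of t]] by simp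
  also have "(\<Sum>n. q ^ Suc n * g (t - of_nat (Suc n) * \<alpha>)) = (\<Sum>n. q * (q ^ n * g ((t - \<alpha>) - of_nat n * \<alpha>)))"
    by (simp add: algebra_simps)
  also have "\<dots> = q * geometric_shift_sum q \<alpha> g (t - \<alpha>)"
    unfolding geometric_shift_sum_def by (rule suminf_mult[OF s])
  finally show ?thesis by simp
qed

lemma geometric_shift_sum_lincomb:
  assumes "\<And>t. \<bar>g t\<bar> \<le> C" "\<And>t. \<bar>h t\<bar> \<le> D"
  shows "geometric_shift_sum q \<alpha> (\<lambda>t. b * g t - h t) t = b * geometric_shift_sum q \<alpha> g t - geometric_shift_sum q \<alpha> h t"
proof -
  have s: "summable (\<lambda>n. q ^ n * g (t - of_nat n * \<alpha>))" "summable (\<lambda>n. q ^ n * h (t - of_nat n * \<alpha>))"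
    using assms by (auto intro: geometric_shift_summable)
  have "geometric_shift_sum q \<alpha> (\<lambda>t. b * g t - h t) t
      = (\<Sum>n. b * (q ^ n * g (t - of_nat n * \<alpha>)) - q ^ n * h (t - of_nat n * \<alpha>))"
    unfolding geometric_shift_sum_def by (simp add: algebra_simps)
  also have "\<dots> = (\<Sum>n. b * (q ^ n * g (t - of_nat n * \<alpha>))) - (\<Sum>n. q ^ n * h (t - of_nat n * \<alpha>))"
    by (rule suminf_diff[OF summable_mult[OF s(1)] s(2), symmetric])
  also have "(\<Sum>n. b * (q ^ n * g (t - of_nat n * \<alpha>))) = b * geometric_shift_sum q \<alpha> g t"
    unfolding geometric_shift_sum_def by (rule suminf_mult[OF s(1)])
  finally show ?thesis unfolding geometric_shift_sum_def .
qed

lemma geometric_shift_sum_ge: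
  assumes "\<And>t. \<bar>g t\<bar> \<le> C" "\<And>t. 0 \<le> g t"
  shows "g t \<le> geometric_shift_sum q \<alpha> g t"
  unfolding geometric_shift_sum_def
  using sum_le_suminf[OF geometric_shift_summable[of g C t, OF assms(1)], of "{0}"] assms(2) q by auto

lemma geometric_shift_sum_mono:
  assumes "\<And>t. \<bar>g t\<bar> \<le> C" "\<And>t. \<bar>h t\<bar> \<le> D" "\<And>t. g t \<le> h t"
  shows "geometric_shift_sum q \<alpha> g t \<le> geometric_shift_sum q \<alpha> h t"
  unfolding geometric_shift_sum_def
  by (intro suminf_le mult_left_mono assms geometric_shift_summable[of g C, OF assms(1)] geometric_shift_summable[of h D, OF assms(2)])
     (use q in auto)

lemma geometric_shift_sum_wiener:
  assumes g: "wiener_real \<rho> g C" "0 \<le> \<rho>"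
  shows "wiener_real \<rho> (geometric_shift_sum q \<alpha> g) (C / (1 - q))"
proof -
  have w: "wiener \<rho> (\<lambda>t. complex_of_real (q ^ n * g (t - of_nat n * \<alpha>))) (q ^ n * C)" for n
  proof -
    have "wiener_real \<rho> (\<lambda>t. g (t + - (of_nat n * \<alpha>))) C"
      by (rule wiener_shift[OF g(1)])
    from wiener_real_cmult[OF this g(2), of "q ^ n"] q(1) show ?thesis by simp
  qed
  have C: "0 \<le> C" using g(1) by (rule wiener_nonneg)
  have "(\<lambda>n. q ^ n * C) sums (1 / (1 - q) * C)"
    using q by (intro sums_mult2 geometric_sums) auto
  then have "((\<lambda>n. q ^ n * C) has_sum (1 / (1 - q) * C)) UNIV"
    using q C by (intro sums_nonneg_imp_has_sum) auto
  from wiener_has_sum[OF w this g(2)] obtain F where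
    F: "\<And>t. ((\<lambda>n. complex_of_real (q ^ n * g (t - of_nat n * \<alpha>))) has_sum F t) UNIV" "wiener \<rho> F (1 / (1 - q) * C)"
    by auto
  have "F t = of_real (geometric_shift_sum q \<alpha> g t)" for t
  proof (rule sums_unique2[OF has_sum_imp_sums[OF F(1)]])
    show "(\<lambda>n. complex_of_real (q ^ n * g (t - of_nat n * \<alpha>))) sums complex_of_real (geometric_shift_sum q \<alpha> g t)"
      unfolding geometric_shift_sum_def
      by (intro sums_of_real summable_sums geometric_shift_summable[of g C, OF wiener_real_abs_le[OF g]])
  qed
  then have "F = (\<lambda>t. of_real (geometric_shift_sum q \<alpha> g t))" by auto
  with F(2) show ?thesis by simp
qed

end

section \<open>The Newton iteration\<close>

definition circle_defect :: "real \<Rightarrow> real \<Rightarrow> real \<Rightarrow> (real \<Rightarrow> real) \<Rightarrow> real \<Rightarrow> real \<Rightarrow> real" where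
  "circle_defect \<alpha> lam \<epsilon> U c t =
     U (t + \<alpha>) - (1 + lam) * U t + lam * U (t - \<alpha>) + (1 - lam) * \<alpha> - c - \<epsilon> * sin (t + U t)"

lemma exp_one_gt: "27 / 10 \<le> exp (1::real)"
  using exp_lower_Taylor_quadratic[of 1] e_approx_32 by (simp add: abs_if split: if_splits)

text \<open>The solution operator \<open>R\<close> is positive because \<open>a\<close> is. Hence
  the integral \<open>I1\<close> of \<open>R 1\<close> is positive, and \<open>d = IE / I1\<close>
  cancels the mean; from |E| \<le> \<eta> follows |R E| \<le> \<eta> R 1 pointwise, so |d| \<le>
  \<eta> with no dependence on the bounds of \<open>a\<close>.\<close>

lemma twisted_cohomological:
  assumes lam: "0 \<le> lam" "lam \<le> 2/5"
    and a: "\<And>t. 0 < a t" "wiener_real \<rho> a A" "wiener_real \<rho> (\<lambda>t. 1 / a t) B" "A \<le> 21/10" "B \<le> 2"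
    and E: "wiener_real \<rho> E \<eta>" and "0 \<le> \<rho>"
  obtains W d where "\<bar>d\<bar> \<le> \<eta>" "wiener_real \<rho> W (28 * \<eta>)" "(W has_integral 0) {0..2*pi}"
    "\<And>t. a (t + \<alpha>) * W t - lam * a (t - \<alpha>) * W (t - \<alpha>) = d - E t"
proof -
  note rho = \<open>0 \<le> \<rho>\<close>
  have q: "0 \<le> lam" "lam < 1" using lam by auto
  have A0: "0 \<le> A" "0 \<le> B" "0 \<le> \<eta>" using a E wiener_nonneg by blast+
  let ?S = "geometric_shift_sum lam \<alpha>"
  \<comment> \<open>\<open>R g\<close> is Z divided by a a(\<cdot> + \<alpha>), where Z - lam
    Z(\<cdot> - \<alpha>) = a g.\<close>
  define R where "R g t = (1 / a t) * ((1 / a (t + \<alpha>)) * ?S (\<lambda>t. a t * g t) t)" for g t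
  have R: "wiener_real \<rho> (R g) (B * (B * (A * C / (1 - lam))))" if "wiener_real \<rho> g C" for g C
  proof -
    have "wiener_real \<rho> (\<lambda>t. 1 / a (t + \<alpha>)) B" using a(3) by (rule wiener_shift)
    then show ?thesis unfolding R_def
      by (intro wiener_real_mult geometric_shift_sum_wiener[OF q] a rho that)
  qed
  have R_eq: "a (t + \<alpha>) * R g t - lam * a (t - \<alpha>) * R g (t - \<alpha>) = g t" if g: "wiener_real \<rho> g C" for g C t
  proof -
    have "\<bar>a t * g t\<bar> \<le> A * C" for t
      using wiener_real_abs_le[OF wiener_real_mult[OF a(2) g rho] rho] .
    from geometric_shift_sum_eq[OF q, where g = "\<lambda>t. a t * g t" and \<alpha> = \<alpha> and t = t, OF this]
    have "?S (\<lambda>t. a t * g t) t - lam * ?S (\<lambda>t. a t * g t) (t - \<alpha>) = a t * g t" .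
    moreover have "a t \<noteq> 0" "a (t + \<alpha>) \<noteq> 0" "a (t - \<alpha>) \<noteq> 0" using a(1) by (metis less_irrefl)+
    ultimately show ?thesis unfolding R_def by (simp add: field_simps)
  qed
  have one: "wiener_real \<rho> (\<lambda>_. 1) 1" using wiener_real_const[of \<rho> 1] by simp
  have bE: "\<bar>a t * E t\<bar> \<le> A * \<eta>" and b1: "\<bar>a t * 1\<bar> \<le> A * 1" for t
    using wiener_real_abs_le[OF wiener_real_mult[OF a(2) E rho] rho]
      wiener_real_abs_le[OF wiener_real_mult[OF a(2) one rho] rho] by auto
  obtain I1 where I1: "(R (\<lambda>_. 1) has_integral I1) {0..2*pi}" 
    by (rule wiener_real_has_integral[OF R[OF one] rho])
  obtain IE where IE: "(R E has_integral IE) {0..2*pi}"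
    by (rule wiener_real_has_integral[OF R[OF E] rho])
  have lin: "R (\<lambda>t. b * 1 - E t) t = b * R (\<lambda>_. 1) t - R E t" for b t
  proof -
    have "(\<lambda>t. a t * (b * 1 - E t)) = (\<lambda>t. b * (a t * 1) - a t * E t)" by (simp add: algebra_simps fun_eq_iff)
    then have "?S (\<lambda>t. a t * (b * 1 - E t)) t = b * ?S (\<lambda>t. a t * 1) t - ?S (\<lambda>t. a t * E t) t"
      using geometric_shift_sum_lincomb[OF q, where g = "\<lambda>t. a t * 1" and h = "\<lambda>t. a t * E t" and b = b and \<alpha> = \<alpha> and t = t, OF b1 bE]
      by (simp only:)
    then show ?thesis unfolding R_def by (simp only: right_diff_distrib mult.left_commute)
  qed
  \<comment> \<open>The zeroth term of the geometric sum is already \<open>a t\<close>; the other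
    terms are nonnegative.\<close>
  have R1_pos: "1 / A \<le> R (\<lambda>_. 1) t" for t
  proof -
    have "a t \<le> ?S (\<lambda>t. a t * 1) t"
      using geometric_shift_sum_ge[OF q, where g = "\<lambda>t. a t * 1" and \<alpha> = \<alpha> and t = t, OF b1] a(1) by (auto simp: less_imp_le)
    then have "(1 / a t) * ((1 / a (t + \<alpha>)) * a t) \<le> R (\<lambda>_. 1) t"
      unfolding R_def using a(1) by (intro mult_left_mono) (auto simp: less_imp_le)
    moreover have "1 / A \<le> 1 / a (t + \<alpha>)"
      using wiener_real_abs_le[OF a(2) rho, of "t + \<alpha>"] a(1)[of "t + \<alpha>"] by (intro divide_left_mono) auto
    ultimately show ?thesis using a(1)[of t] by simp
  qed
  have RE: "\<bar>R E t\<bar> \<le> \<eta> * R (\<lambda>_. 1) t" for t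
  proof -
    have bb: "\<bar>s * (a t * 1)\<bar> \<le> \<bar>s\<bar> * A" for s t
      using b1[of t] by (simp add: abs_mult mult_left_mono)
    have e: "\<bar>E t\<bar> \<le> \<eta>" for t using wiener_real_abs_le[OF E rho] .
    have z: "\<bar>0 * (a t * 1)\<bar> \<le> 0" for t by simp
    have sc: "?S (\<lambda>t. s * (a t * 1)) t = s * ?S (\<lambda>t. a t * 1) t" for s t
      using geometric_shift_sum_lincomb[OF q, where g = "\<lambda>t. a t * 1" and h = "\<lambda>_. 0" and D = 0 and b = s and \<alpha> = \<alpha> and t = t, OF b1] by (simp add: geometric_shift_sum_def)
    have "?S (\<lambda>t. a t * E t) t \<le> \<eta> * ?S (\<lambda>t. a t * 1) t"
      unfolding sc[symmetric] using e a(1)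
      by (intro geometric_shift_sum_mono[OF q, where g = "\<lambda>t. a t * E t" and h = "\<lambda>t. \<eta> * (a t * 1)", OF bE bb]) (auto simp: abs_le_iff mult.commute[of \<eta>] less_imp_le intro!: mult_left_mono)
    moreover have "- \<eta> * ?S (\<lambda>t. a t * 1) t \<le> ?S (\<lambda>t. a t * E t) t"
      unfolding sc[symmetric] using e a(1)
    proof (intro geometric_shift_sum_mono[OF q, where h = "\<lambda>t. a t * E t" and g = "\<lambda>t. - \<eta> * (a t * 1)", OF bb bE])
      fix t show "- \<eta> * (a t * 1) \<le> a t * E t"
        using e[of t] a(1)[of t] mult_left_mono[of "- \<eta>" "E t" "a t"] by (simp add: abs_le_iff mult.commute)
    qed
    ultimately have "\<bar>?S (\<lambda>t. a t * E t) t\<bar> \<le> \<eta> * ?S (\<lambda>t. a t * 1) t" by (simp add: abs_le_iff)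
    then have "(1 / a t) * ((1 / a (t + \<alpha>)) * \<bar>?S (\<lambda>t. a t * E t) t\<bar>) \<le> (1 / a t) * ((1 / a (t + \<alpha>)) * (\<eta> * ?S (\<lambda>t. a t * 1) t))"
      using a(1) by (intro mult_left_mono) (auto simp: less_imp_le)
    then show ?thesis
      unfolding R_def using a(1)[of t] a(1)[of "t + \<alpha>"] by (simp add: abs_mult ac_simps)
  qed
  have "0 < A" using wiener_real_abs_le[OF a(2) rho, of 0] a(1)[of 0] by simp
  have "(1 / A) * (2 * pi) \<le> I1"
    using has_integral_le[OF has_integral_const_real[of "1 / A" 0 "2 * pi"] I1] R1_pos by simp
  then have I1_pos: "0 < I1" using \<open>0 < A\<close> pi_gt_zero
    by (smt (verit) divide_pos_pos mult_pos_pos)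
  define d where "d = IE / I1"
  have "IE \<le> \<eta> * I1" "- (\<eta> * I1) \<le> IE"
    using has_integral_le[OF IE has_integral_mult_right[OF I1, of \<eta>]]
      has_integral_le[OF has_integral_neg[OF has_integral_mult_right[OF I1, of \<eta>]] IE] RE
    by (auto simp: abs_le_iff minus_le_iff)
  then have d: "\<bar>d\<bar> \<le> \<eta>" using I1_pos by (simp add: d_def abs_le_iff field_simps)
  have dE: "wiener_real \<rho> (\<lambda>t. d * 1 - E t) (\<bar>d * 1\<bar> + \<eta>)"
    by (intro wiener_real_diff E wiener_real_const rho)
  let ?W = "R (\<lambda>t. d * 1 - E t)"
  \<comment> \<open>Here |d| + \<eta> \<le> 2 \<eta> and 1 - lam \<ge> 3/5, so the constant is 2 * 2
    * (21/10) * 2 / (3/5) = 28.\<close>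
  have "B * (B * (A * (\<bar>d * 1\<bar> + \<eta>) / (1 - lam))) \<le> 2 * (2 * ((21/10) * (\<eta> + \<eta>) / (3/5)))"
    using a d A0 lam by (intro mult_mono frac_le add_mono mult_nonneg_nonneg divide_nonneg_pos) auto
  then have "wiener_real \<rho> ?W (28 * \<eta>)"
    by (intro wiener_mono[OF R[OF dE]]) (simp add: field_simps)
  moreover have "(?W has_integral 0) {0..2*pi}"
    using has_integral_diff[OF has_integral_mult_right[OF I1, of d] IE] I1_pos
    unfolding lin by (simp add: d_def)
  moreover have "a (t + \<alpha>) * ?W t - lam * a (t - \<alpha>) * ?W (t - \<alpha>) = d - E t" for t
    using R_eq[OF dE] by simp
  ultimately show ?thesis using d by (intro that)
qed

text \<open>One \<delta> pays for the small divisors in \<open>w\<close>, and likewise for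
  \<open>E'\<close>; a second \<delta> pays for \<open>v'\<close>. With 1/e \<le> 10/27 the
  constants are 7/10 * 28 * 10/27 \<le> 7.3 for \<open>w\<close>, 21/10 * 7.3 \<le> 154/10 for
  \<open>v\<close>, 154/10 * 10/27 \<le> 6 for \<open>v'\<close>, and 7.3 * 10/27 + 7/10 * 2 *
  (154/10)^2 \<le> 335 for the new defect.\<close>

lemma kam_step:
  assumes lam: "0 \<le> lam" "lam \<le> 2/5" and eps: "0 \<le> \<epsilon>" "\<epsilon> \<le> 7/10"
    and dio: "\<And>k::int. k \<noteq> 0 \<Longrightarrow> 1 \<le> 7/10 * of_int \<bar>k\<bar> * norm (cis (of_int k * \<alpha>) - 1)"
    and \<delta>: "0 < \<delta>" "2 * \<delta> \<le> \<rho>"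
    and U: "\<And>t. (U has_real_derivative a t - 1) (at t)"
    and a: "\<And>t. 0 < a t" "wiener_real \<rho> a A" "wiener_real \<rho> (\<lambda>t. 1 / a t) B" "A \<le> 21/10" "B \<le> 2"
    and V: "wiener \<rho> (\<lambda>t. cis (t + U t)) V" "V \<le> 2"
    and E: "wiener_real \<rho> (circle_defect \<alpha> lam \<epsilon> U c) \<eta>" "16 * \<eta> \<le> \<delta>"
  obtains v v' d where "\<bar>d\<bar> \<le> \<eta>" "\<And>t. (v has_real_derivative v' t) (at t)"
    "wiener_real (\<rho> - \<delta>) v (154/10 * \<eta> / \<delta>)" "wiener_real (\<rho> - 2 * \<delta>) v' (6 * \<eta> / \<delta>\<^sup>2)"
    "wiener_real (\<rho> - 2 * \<delta>) (circle_defect \<alpha> lam \<epsilon> (\<lambda>t. U t + v t) (c + d)) (335 * \<eta>\<^sup>2 / \<delta>\<^sup>2)"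
proof -
  let ?E = "circle_defect \<alpha> lam \<epsilon> U c"
  have rho: "0 \<le> \<rho>" "0 \<le> \<rho> - \<delta>" "0 \<le> \<rho> - 2 * \<delta>" "\<delta> \<le> \<rho>" using \<delta> by auto
  have \<eta>: "0 \<le> \<eta>" using E(1) by (rule wiener_nonneg)
  have A0: "0 \<le> A" using a(2) by (rule wiener_nonneg)
  have edelta: "C / (exp 1 * \<delta>) \<le> (10/27) * C / \<delta>" if "0 \<le> C" for C
  proof -
    have "C / (exp 1 * \<delta>) \<le> C / (27/10 * \<delta>)"
      using exp_one_gt \<delta> that by (intro divide_left_mono mult_right_mono) auto
    then show ?thesis by simp
  qed
  obtain W d where d: "\<bar>d\<bar> \<le> \<eta>" and W: "wiener_real \<rho> W (28 * \<eta>)" "(W has_integral 0) {0..2*pi}"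
    "\<And>t. a (t + \<alpha>) * W t - lam * a (t - \<alpha>) * W (t - \<alpha>) = d - ?E t"
    by (rule twisted_cohomological[OF lam a E(1) rho(1)]) (rule that)
  obtain w where w: "\<And>t. w (t + \<alpha>) - w t = W t"
    "wiener_real (\<rho> - \<delta>) w (7/10 / (exp 1 * \<delta>) * (28 * \<eta>))"
    by (rule wiener_real_cohomological[OF W(1) \<delta>(1) rho(4) W(2) dio]) (auto intro: that)
  have w': "wiener_real (\<rho> - \<delta>) w (7.3 * \<eta> / \<delta>)"
    by (rule wiener_mono[OF w(2)]) (use edelta[of "7/10 * (28 * \<eta>)"] \<eta> \<delta> in \<open>simp add: field_simps\<close>)
  define v where "v t = a t * w t" for t
  have a_d: "wiener_real (\<rho> - \<delta>) a A" "wiener_real (\<rho> - 2 * \<delta>) a A"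
    using a(2) rho \<delta> by (auto intro: wiener_mono_width)
  have "wiener_real (\<rho> - \<delta>) v (A * (7.3 * \<eta> / \<delta>))"
    unfolding v_def by (intro wiener_real_mult a_d w' rho)
  then have v: "wiener_real (\<rho> - \<delta>) v (154/10 * \<eta> / \<delta>)"
    by (rule wiener_mono) (use mult_right_mono[OF a(4), of "7.3 * \<eta> / \<delta>"] \<eta> \<delta> in \<open>simp add: field_simps\<close>)
  obtain v' where v': "\<And>t. (v has_real_derivative v' t) (at t)"
    "wiener_real (\<rho> - \<delta> - \<delta>) v' (154/10 * \<eta> / \<delta> / (exp 1 * \<delta>))"
    by (rule wiener_real_deriv[OF v \<delta>(1)]) (use \<delta> in \<open>auto intro: that\<close>)
  have rr: "\<rho> - \<delta> - \<delta> = \<rho> - 2 * \<delta>" by simp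
  have v'6: "wiener_real (\<rho> - 2 * \<delta>) v' (6 * \<eta> / \<delta>\<^sup>2)"
    using v'(2) unfolding rr
    by (rule wiener_mono) (use edelta[of "154/10 * \<eta> / \<delta>"] \<eta> \<delta> in \<open>simp add: field_simps power2_eq_square\<close>)
  obtain E' where E': "\<And>t. (?E has_real_derivative E' t) (at t)" "wiener_real (\<rho> - \<delta>) E' (\<eta> / (exp 1 * \<delta>))"
    by (rule wiener_real_deriv[OF E(1) \<delta>(1) rho(4)]) (rule that)
  have E'_eq: "E' t = a (t + \<alpha>) - (1 + lam) * a t + lam * a (t - \<alpha>) - \<epsilon> * cos (t + U t) * a t" for t
  proof (rule DERIV_unique[OF E'(1)])
    have U': "((\<lambda>t. U (t + s)) has_real_derivative a (t + s) - 1) (at t)" for s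
      using DERIV_shift[of U _ t s] U by blast
    have "?E = (\<lambda>t. U (t + \<alpha>) - (1 + lam) * U t + lam * U (t + - \<alpha>) + (1 - lam) * \<alpha> - c - \<epsilon> * sin (t + U t))"
      by (simp add: circle_defect_def fun_eq_iff)
    then show "(?E has_real_derivative a (t + \<alpha>) - (1 + lam) * a t + lam * a (t - \<alpha>) - \<epsilon> * cos (t + U t) * a t) (at t)"
      using U'[of \<alpha>] U'[of "-\<alpha>"] U[of t]
      by (auto intro!: derivative_eq_intros simp: algebra_simps)
  qed
  \<comment> \<open>This is the imaginary part of exp(i (t + U)) (exp(i v) - 1 - i v), so
    \<open>wiener_exp_remainder\<close> bounds it without a separate treatment of the sine.\<close>
  define Q where "Q t = sin (t + U t + v t) - sin (t + U t) - cos (t + U t) * v t" for t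
  \<comment> \<open>All terms linear in the correction cancel: \<open>W\<close> was chosen for the
    twisted equation, and the remaining multiples of \<open>w\<close> combine to
    \<open>E'\<close>.\<close>
  have new: "circle_defect \<alpha> lam \<epsilon> (\<lambda>t. U t + v t) (c + d) t = w t * E' t - \<epsilon> * Q t" for t
  proof -
    have "circle_defect \<alpha> lam \<epsilon> (\<lambda>t. U t + v t) (c + d) t = ?E t + v (t + \<alpha>) - (1 + lam) * v t + lam * v (t - \<alpha>)
        - d - \<epsilon> * cos (t + U t) * v t - \<epsilon> * Q t"
      by (simp add: circle_defect_def Q_def algebra_simps)
    moreover have "\<epsilon> * cos (t + U t) * v t = w t * (a (t + \<alpha>) - (1 + lam) * a t + lam * a (t - \<alpha>) - E' t)"
      unfolding E'_eq v_def by (simp add: algebra_simps)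
    moreover have "v (t + \<alpha>) = a (t + \<alpha>) * (w t + W t)" "v (t - \<alpha>) = a (t - \<alpha>) * (w t - W (t - \<alpha>))"
      using w(1)[of t] w(1)[of "t - \<alpha>"] by (auto simp: v_def)
    moreover have "v t = a t * w t" by (simp add: v_def)
    ultimately show ?thesis using W(3)[of t] by (simp add: algebra_simps)
  qed
  define x where "x = 154/10 * \<eta> / \<delta>"
  \<comment> \<open>The hypothesis 16 \<eta> \<le> \<delta> is what gives x \<le> 1, the range in
    which exp x - 1 - x \<le> x^2.\<close>
  have x: "0 \<le> x" "x \<le> 1" using \<eta> \<delta> E(2) by (auto simp: field_simps x_def)
  have vi: "wiener (\<rho> - \<delta>) (\<lambda>t. \<i> * of_real (v t)) x"
    using wiener_cmult[OF v rho(2), of \<i>] by (simp add: x_def)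
  have "wiener (\<rho> - \<delta>) (\<lambda>t. cis (t + U t)) V" using V(1) rho \<delta> by (auto intro: wiener_mono_width)
  then have "wiener (\<rho> - \<delta>) (\<lambda>t. - \<i> * (cis (t + U t) * (exp (\<i> * of_real (v t)) - 1 - \<i> * of_real (v t))))
      (norm (- \<i>) * (V * (exp x - 1 - x)))"
    by (intro wiener_cmult wiener_mult wiener_exp_remainder vi rho)
  from wiener_Re[OF this rho(2)]
  have "wiener (\<rho> - \<delta>) (\<lambda>t. of_real (Re (- \<i> * (cis (t + U t) * (exp (\<i> * of_real (v t)) - 1 - \<i> * of_real (v t)))))) (V * (exp x - 1 - x))"
    by simp
  also have "(\<lambda>t. Re (- \<i> * (cis (t + U t) * (exp (\<i> * of_real (v t)) - 1 - \<i> * of_real (v t))))) = Q"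
  proof
    fix t
    have "cis (t + U t) * (cis (v t) - 1 - \<i> * of_real (v t)) = cis (t + U t + v t) - cis (t + U t) - \<i> * of_real (v t) * cis (t + U t)"
      by (simp add: algebra_simps cis_mult)
    then show "Re (- \<i> * (cis (t + U t) * (exp (\<i> * of_real (v t)) - 1 - \<i> * of_real (v t)))) = Q t"
      by (simp add: Q_def flip: cis_conv_exp)
  qed
  finally have "wiener_real (\<rho> - \<delta>) Q (V * (exp x - 1 - x))" .
  moreover have "V * (exp x - 1 - x) \<le> 2 * x\<^sup>2"
  proof (rule mult_mono)
    show "exp x - 1 - x \<le> x\<^sup>2" "0 \<le> exp x - 1 - x"
      using exp_bound[OF x] exp_ge_add_one_self[of x] by linarith+
  qed (use V(2) in auto)
  ultimately have Q: "wiener_real (\<rho> - \<delta>) Q (2 * x\<^sup>2)" by (rule wiener_mono)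
  have E'4: "wiener_real (\<rho> - \<delta>) E' (10/27 * \<eta> / \<delta>)"
    using E'(2) by (rule wiener_mono) (rule edelta[OF \<eta>])
  have "wiener_real (\<rho> - \<delta>) (\<lambda>t. w t * E' t - \<epsilon> * Q t) (7.3 * \<eta> / \<delta> * (10/27 * \<eta> / \<delta>) + \<bar>\<epsilon>\<bar> * (2 * x\<^sup>2))"
    by (intro wiener_real_diff wiener_real_mult wiener_real_cmult w' E'4 Q rho)
  moreover have "7.3 * \<eta> / \<delta> * (10/27 * \<eta> / \<delta>) + \<bar>\<epsilon>\<bar> * (2 * x\<^sup>2) \<le> 335 * \<eta>\<^sup>2 / \<delta>\<^sup>2"
  proof -
    have "\<bar>\<epsilon>\<bar> * (2 * x\<^sup>2) \<le> 7/10 * (2 * x\<^sup>2)" using eps by (intro mult_right_mono) auto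
    moreover have "7.3 * \<eta> / \<delta> * (10/27 * \<eta> / \<delta>) = (73/27) * (\<eta> / \<delta>)\<^sup>2" by (simp add: power2_eq_square)
    moreover have "x\<^sup>2 = (154/10)\<^sup>2 * (\<eta> / \<delta>)\<^sup>2" by (simp add: power2_eq_square x_def)
    moreover have "335 * \<eta>\<^sup>2 / \<delta>\<^sup>2 = 335 * (\<eta> / \<delta>)\<^sup>2" by (simp add: power_divide)
    moreover have "73/27 * y + 7/10 * (2 * ((154/10)\<^sup>2 * y)) \<le> 335 * y" if "0 \<le> y" for y :: real
      using that by (simp add: power2_eq_square)
    moreover have "0 \<le> (\<eta> / \<delta>)\<^sup>2" by simp
    ultimately show ?thesis by (smt (verit))
  qed
  ultimately have "wiener_real (\<rho> - \<delta>) (\<lambda>t. w t * E' t - \<epsilon> * Q t) (335 * \<eta>\<^sup>2 / \<delta>\<^sup>2)" by (rule wiener_mono)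
  then have "wiener_real (\<rho> - 2 * \<delta>) (circle_defect \<alpha> lam \<epsilon> (\<lambda>t. U t + v t) (c + d)) (335 * \<eta>\<^sup>2 / \<delta>\<^sup>2)"
    using rho \<delta> unfolding new by (auto intro: wiener_mono_width)
  with d v'(1) v v'6 show ?thesis by (rule that)
qed

text \<open>The width descends from 6/100 towards 3/100, and the bounds relax from 208/100 and
  197/100 towards the values 21/10 and 2 allowed in \<open>kam_step\<close>. Only geometric decay of
  the defect is recorded; the rate 1/8 suffices, since \<eta>/\<delta>^2, the size of the change of
  \<open>a\<close>, then halves at each step.\<close>

definition kam_state :: "real \<Rightarrow> real \<Rightarrow> real \<Rightarrow> nat \<Rightarrow> (real \<Rightarrow> real) \<times> real \<Rightarrow> bool" where
  "kam_state \<alpha> lam \<epsilon> n = (\<lambda>(U, c). \<exists>a.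
     (\<forall>t. (U has_real_derivative a t - 1) (at t)) \<and> (\<forall>t. 0 < a t) \<and>
     wiener_real (3/100 * (1 + (1/2) ^ n)) a (21/10 - 2/100 * (1/2) ^ n) \<and>
     wiener_real (3/100 * (1 + (1/2) ^ n)) (\<lambda>t. 1 / a t) (2 - 3/100 * (1/2) ^ n) \<and>
     wiener (3/100 * (1 + (1/2) ^ n)) (\<lambda>t. cis (t + U t)) (2 - 3/100 * (1/2) ^ n) \<and>
     wiener_real (3/100 * (1 + (1/2) ^ n)) (circle_defect \<alpha> lam \<epsilon> U c) (2/10^8 * (1/8) ^ n))"

lemma kam_state_step:
  assumes lam: "0 \<le> lam" "lam \<le> 2/5" and eps: "0 \<le> \<epsilon>" "\<epsilon> \<le> 7/10"
    and dio: "\<And>k::int. k \<noteq> 0 \<Longrightarrow> 1 \<le> 7/10 * of_int \<bar>k\<bar> * norm (cis (of_int k * \<alpha>) - 1)"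
    and st: "kam_state \<alpha> lam \<epsilon> n (U, c)"
  obtains v d where "kam_state \<alpha> lam \<epsilon> (Suc n) (\<lambda>t. U t + v t, c + d)"
    "\<bar>d\<bar> \<le> (1/8) ^ n" "wiener_real (3/100) v ((1/4) ^ n)"
proof -
  define p :: real where "p = (1/2) ^ n"
  have p: "0 < p" "p \<le> 1" by (auto simp: p_def power_le_one)
  have p4: "(1/4) ^ n = p * p" and p8: "(1/8) ^ n = p * p * p"
    by (simp_all add: p_def flip: power_mult_distrib)
  have pS: "(1/2) ^ Suc n = p / 2" and p8S: "(1/8) ^ Suc n = p * p * p / 8" by (simp_all add: p_def p8[symmetric, unfolded p_def])
  \<comment> \<open>Twice this is exactly the difference 3/100 * p/2 of consecutive widths.\<close>
  define \<delta> where "\<delta> = 75/10000 * p"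
  define \<eta> where "\<eta> = 2/10^8 * (p * p * p)"
  define \<rho> where "\<rho> = 3/100 * (1 + p)"
  from st obtain a where U: "\<And>t. (U has_real_derivative a t - 1) (at t)" and a: "\<And>t. 0 < a t"
    and aw: "wiener_real \<rho> a (21/10 - 2/100 * p)"
      "wiener_real \<rho> (\<lambda>t. 1 / a t) (2 - 3/100 * p)"
    and V: "wiener \<rho> (\<lambda>t. cis (t + U t)) (2 - 3/100 * p)"
    and E: "wiener_real \<rho> (circle_defect \<alpha> lam \<epsilon> U c) \<eta>"
    unfolding kam_state_def p8 p_def[symmetric] \<eta>_def[symmetric] \<rho>_def[symmetric] by auto
  have pp: "p * p \<le> 1" "p * p * p \<le> p" "p * p \<le> p" "0 < p * p"
    using p mult_le_one[of p p] mult_right_mono[of "p * p" 1 p] mult_right_mono[of p 1 p] by auto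
  have \<delta>: "0 < \<delta>" "2 * \<delta> \<le> \<rho>" "16 * \<eta> \<le> \<delta>"
    using p pp by (auto simp: \<delta>_def \<rho>_def \<eta>_def)
  obtain v v' d where d: "\<bar>d\<bar> \<le> \<eta>" and v': "\<And>t. (v has_real_derivative v' t) (at t)"
    and v: "wiener_real (\<rho> - \<delta>) v (154/10 * \<eta> / \<delta>)" and v'w: "wiener_real (\<rho> - 2 * \<delta>) v' (6 * \<eta> / \<delta>\<^sup>2)"
    and E': "wiener_real (\<rho> - 2 * \<delta>) (circle_defect \<alpha> lam \<epsilon> (\<lambda>t. U t + v t) (c + d)) (335 * \<eta>\<^sup>2 / \<delta>\<^sup>2)"
    by (rule kam_step[OF lam eps dio \<delta>(1,2) U a aw _ _ V _ E \<delta>(3)]) (use p in \<open>auto intro: that\<close>)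
  define \<sigma> where "\<sigma> = 3/100 * (1 + p / 2)"
  have \<sigma>: "\<sigma> = \<rho> - 2 * \<delta>" "0 \<le> \<sigma>" "\<sigma> \<le> \<rho> - \<delta>" "\<sigma> \<le> \<rho>" "3/100 \<le> \<sigma>"
    using p by (simp_all add: \<sigma>_def \<rho>_def \<delta>_def field_simps)
  have vb: "154/10 * \<eta> / \<delta> \<le> 5/10^5 * (p * p)"
    using p by (simp add: \<eta>_def \<delta>_def field_simps)
  have vb': "6 * \<eta> / \<delta>\<^sup>2 \<le> 22/10^4 * p"
    using p by (simp add: \<eta>_def \<delta>_def field_simps power2_eq_square)
  \<comment> \<open>With \<eta> of order p^3 and \<delta> of order p the left side is of order p^4
    \<le> p^3. What remains is 335 * (2/10^8) / (75/10000)^2, about 0.119, against 1/8; this is why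
    the start must have defect at most about 2/10^8.\<close>
  have Eb: "335 * \<eta>\<^sup>2 / \<delta>\<^sup>2 \<le> 2/10^8 * (p * p * p / 8)"
  proof -
    have "335 * \<eta>\<^sup>2 / \<delta>\<^sup>2 = 335 * (2/10^8)\<^sup>2 / (75/10000)\<^sup>2 * (p * p * p * p)"
      using p by (simp add: \<eta>_def \<delta>_def field_simps power2_eq_square)
    also have "\<dots> \<le> 2/10^8/8 * (p * p * p * 1)"
      using p by (intro mult_mono) (auto simp: power2_eq_square)
    finally show ?thesis by simp
  qed
  have v\<sigma>: "wiener_real \<sigma> v (5/10^5 * (p * p))"
    using wiener_mono_width[OF wiener_mono[OF v vb] \<sigma>(2,3)] .
  have v'\<sigma>: "wiener_real \<sigma> v' (22/10^4 * p)"
    using wiener_mono[OF v'w vb'] \<sigma>(1) by simp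
  have aw\<sigma>: "wiener_real \<sigma> a (21/10 - 2/100 * p)" "wiener_real \<sigma> (\<lambda>t. 1 / a t) (2 - 3/100 * p)"
    "wiener \<sigma> (\<lambda>t. cis (t + U t)) (2 - 3/100 * p)"
    using aw V \<sigma> by (auto intro: wiener_mono_width)
  define a' where "a' t = a t + v' t" for t
  have 1: "((\<lambda>t. U t + v t) has_real_derivative a' t - 1) (at t)" for t
    using DERIV_add[OF U v'] by (simp add: a'_def algebra_simps)
  have 2: "0 < a' t" for t
  proof -
    have "\<bar>1 / a t\<bar> \<le> 2 - 3/100 * p" using \<delta> by (intro wiener_real_abs_le[OF aw(2)]) simp
    then have "1 / a t \<le> 2" using p by linarith
    then have "1 / 2 \<le> a t" using a[of t] by (simp add: field_simps)
    moreover have "\<bar>v' t\<bar> \<le> 22/10^4 * p" by (rule wiener_real_abs_le[OF v'\<sigma> \<sigma>(2)])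
    ultimately show ?thesis using p by (simp add: a'_def abs_le_iff)
  qed
  have 3: "wiener_real \<sigma> a' (21/10 - 2/100 * (p / 2))"
    unfolding a'_def by (rule wiener_mono[OF wiener_real_add[OF aw\<sigma>(1) v'\<sigma> \<sigma>(2)]]) (use p in simp)
  have 4: "wiener_real \<sigma> (\<lambda>t. 1 / a' t) (2 - 3/100 * (p / 2))"
  proof -
    let ?B = "2 - 3/100 * p" and ?D = "22/10^4 * p"
    have BD: "?B * ?D \<le> 44/10^4 * p" using p mult_right_mono[of ?B 2 ?D] by simp
    also have "44/10^4 * p < 1" using p by simp
    finally have BD1: "?B * ?D < 1" .
    have "wiener \<sigma> (\<lambda>t. 1 / (complex_of_real (a t) + of_real (v' t))) (?B / (1 - ?B * ?D))"
      using aw\<sigma>(2) less_imp_neq[OF a] by (intro wiener_inverse_perturb v'\<sigma> \<sigma>(2) BD1) (auto dest: sym)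
    moreover have "?B / (1 - ?B * ?D) \<le> 2 - 3/100 * (p / 2)"
    proof -
      have "?B \<le> (2 - 3/100 * (p / 2)) * (1 - 44/10^4 * p)"
        using p pp by (simp add: field_simps)
      also have "\<dots> \<le> (2 - 3/100 * (p / 2)) * (1 - ?B * ?D)"
        using BD p by (intro mult_left_mono) auto
      finally show ?thesis using BD1 pos_divide_le_eq[of "1 - ?B * ?D" ?B] by simp
    qed
    ultimately show ?thesis unfolding a'_def by (auto intro: wiener_mono)
  qed
  have 5: "wiener \<sigma> (\<lambda>t. cis (t + (U t + v t))) (2 - 3/100 * (p / 2))"
  proof -
    let ?x = "5/10^5 * (p * p)"
    have "wiener \<sigma> (\<lambda>t. cis (t + U t) * exp (\<i> * of_real (v t))) ((2 - 3/100 * p) * exp (norm \<i> * ?x))"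
      by (intro wiener_mult aw\<sigma> wiener_exp wiener_cmult v\<sigma> \<sigma>)
    moreover have "(2 - 3/100 * p) * exp (norm \<i> * ?x) \<le> 2 - 3/100 * (p / 2)"
    proof -
      have "exp ?x \<le> 1 + ?x + ?x\<^sup>2" using pp by (intro exp_bound) auto
      also have "\<dots> \<le> 1 + 2 * ?x"
      proof -
        have "?x * ?x \<le> 1 * ?x" using pp by (intro mult_right_mono) auto
        then show ?thesis unfolding power2_eq_square by linarith
      qed
      also have "\<dots> \<le> 1 + 1/10^4 * p" using pp by simp
      finally have "exp ?x \<le> 1 + 1/10^4 * p" .
      then have "(2 - 3/100 * p) * exp ?x \<le> (2 - 3/100 * p) * (1 + 1/10^4 * p)"
        using p by (intro mult_left_mono) auto
      also have "\<dots> \<le> 2 - 3/100 * (p / 2)" using p pp by (simp add: field_simps)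
      finally show ?thesis by simp
    qed
    moreover have "(\<lambda>t. cis (t + U t) * exp (\<i> * of_real (v t))) = (\<lambda>t. cis (t + (U t + v t)))"
      by (simp add: cis_mult add.assoc flip: cis_conv_exp)
    ultimately show ?thesis by (auto intro: wiener_mono)
  qed
  have 6: "wiener_real \<sigma> (circle_defect \<alpha> lam \<epsilon> (\<lambda>t. U t + v t) (c + d)) (2/10^8 * (p * p * p / 8))"
    using wiener_mono[OF E' Eb] \<sigma>(1) by simp
  have "kam_state \<alpha> lam \<epsilon> (Suc n) (\<lambda>t. U t + v t, c + d)"
    unfolding kam_state_def pS p8S prod.case \<sigma>_def[symmetric]
    using 1 2 3 4 5 6 by blast
  moreover have "\<bar>d\<bar> \<le> (1/8) ^ n" using d p by (simp add: \<eta>_def p8)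
  moreover have "wiener_real (3/100) v ((1/4) ^ n)"
    by (rule wiener_mono[OF wiener_mono_width[OF v\<sigma> _ \<sigma>(5)]]) (use p in \<open>auto simp: p4\<close>)
  ultimately show ?thesis by (rule that)
qed

text \<open>The corrections of \<open>U\<close> and \<open>c\<close> are at most 4^(-n) and 8^(-n),
  the former at the fixed width 3/100, so both series converge. Each step yields mere existence,
  hence the dependent choice.\<close>

theorem kam_iteration:
  assumes lam: "0 \<le> lam" "lam \<le> 2/5" and eps: "0 \<le> \<epsilon>" "\<epsilon> \<le> 7/10"
    and dio: "\<And>k::int. k \<noteq> 0 \<Longrightarrow> 1 \<le> 7/10 * of_int \<bar>k\<bar> * norm (cis (of_int k * \<alpha>) - 1)"
    and st: "kam_state \<alpha> lam \<epsilon> 0 (U, c)" and U: "wiener_real (3/100) U C"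
  obtains U' c' C' where "wiener_real (3/100) U' C'" "\<And>t. circle_defect \<alpha> lam \<epsilon> U' c' t = 0"
proof -
  define step where "step n x y \<longleftrightarrow> \<bar>snd y - snd x\<bar> \<le> (1/8) ^ n \<and>
     wiener_real (3/100) (\<lambda>t. fst y t - fst x t) ((1/4) ^ n)" for n and x y :: "(real \<Rightarrow> real) \<times> real"
  have "\<exists>f. (\<forall>n. kam_state \<alpha> lam \<epsilon> n (f n)) \<and> (\<forall>n. step n (f n) (f (Suc n))) \<and> f 0 = (U, c)"
  proof -
    \<comment> \<open>The second conjunct pins the sequence to the given start.\<close>
    define P where "P n x \<longleftrightarrow> kam_state \<alpha> lam \<epsilon> n x \<and> (n = 0 \<longrightarrow> x = (U, c))" for n x
    have "\<exists>f. \<forall>n. P n (f n) \<and> step n (f n) (f (Suc n))"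
    proof (rule dependent_nat_choice)
      show "\<exists>x. P 0 x" using st by (auto simp: P_def)
      show "\<exists>y. P (Suc n) y \<and> step n x y" if Pn: "P n x" for x n
      proof -
        obtain u b where x: "x = (u, b)" by (cases x)
        obtain v d where vd: "kam_state \<alpha> lam \<epsilon> (Suc n) (\<lambda>t. u t + v t, b + d)"
          "\<bar>d\<bar> \<le> (1/8) ^ n" "wiener_real (3/100) v ((1/4) ^ n)"
          by (rule kam_state_step[OF lam eps dio, of n u b]) (use Pn x that in \<open>auto simp: P_def\<close>)
        have "P (Suc n) (\<lambda>t. u t + v t, b + d) \<and> step n x (\<lambda>t. u t + v t, b + d)"
          using vd by (simp add: P_def step_def x)
        then show ?thesis by blast
      qed
    qed
    then show ?thesis unfolding P_def by blast
  qed
  then obtain f where f: "\<And>n. kam_state \<alpha> lam \<epsilon> n (f n)" "\<And>n. step n (f n) (f (Suc n))" "f 0 = (U, c)"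
    by blast
  define u where "u n = fst (f n)" for n
  define b where "b n = snd (f n)" for n
  have ub: "f n = (u n, b n)" for n by (simp add: u_def b_def)
  have u0: "u 0 = U" by (simp add: u_def f(3))
  have "summable (\<lambda>n. b (Suc n) - b n)"
    by (rule summable_comparison_test'[of "\<lambda>n. (1/8::real) ^ n" 0])
       (use f(2) in \<open>auto simp: step_def b_def intro!: summable_geometric\<close>)
  then obtain c' where "(\<lambda>n. b (Suc n) - b n) sums c'" by (auto simp: summable_def)
  then have "(\<lambda>n. b n - b 0) \<longlonglongrightarrow> c'" unfolding sums_def by (simp add: sum_lessThan_telescope)
  then have "(\<lambda>n. (b n - b 0) + b 0) \<longlonglongrightarrow> c' + b 0" by (intro tendsto_add tendsto_const)
  then have b_lim: "b \<longlonglongrightarrow> c' + b 0" by simp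
  have w: "wiener (3/100) (\<lambda>t. complex_of_real (u (Suc n) t - u n t)) ((1/4) ^ n)" for n
    using f(2)[of n] unfolding step_def u_def by blast
  have "((\<lambda>n. (1/4::real) ^ n) has_sum (1 / (1 - 1/4))) UNIV"
    by (intro sums_nonneg_imp_has_sum geometric_sums) auto
  from wiener_has_sum[OF w this] obtain F where
    F: "\<And>t. ((\<lambda>n. complex_of_real (u (Suc n) t - u n t)) has_sum F t) UNIV" "wiener (3/100) F (1 / (1 - 1/4))"
    by auto
  define U' where "U' t = U t + Re (F t)" for t
  have U'w: "wiener_real (3/100) U' (C + 1 / (1 - 1/4))"
    unfolding U'_def by (intro wiener_real_add U wiener_Re F) auto
  have u_lim: "(\<lambda>n. u n t) \<longlonglongrightarrow> U' t" for t
  proof -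
    have "(\<lambda>n. u (Suc n) t - u n t) sums Re (F t)"
      using sums_Re[OF has_sum_imp_sums[OF F(1)[of t]]] by simp
    then have "(\<lambda>n. u n t - u 0 t) \<longlonglongrightarrow> Re (F t)"
      unfolding sums_def by (simp only: sum_lessThan_telescope[of "\<lambda>n. u n t"])
    then have "(\<lambda>n. (u n t - u 0 t) + u 0 t) \<longlonglongrightarrow> Re (F t) + u 0 t" by (intro tendsto_add tendsto_const)
    then show ?thesis by (simp add: U'_def u0 add.commute)
  qed
  \<comment> \<open>The defect contains no derivative of \<open>U\<close>, so pointwise limits are
    enough.\<close>
  have "circle_defect \<alpha> lam \<epsilon> U' (c' + b 0) t = 0" for t
  proof (rule LIMSEQ_unique)
    show "(\<lambda>n. circle_defect \<alpha> lam \<epsilon> (u n) (b n) t) \<longlonglongrightarrow> circle_defect \<alpha> lam \<epsilon> U' (c' + b 0) t"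
      unfolding circle_defect_def by (intro tendsto_intros u_lim b_lim)
    show "(\<lambda>n. circle_defect \<alpha> lam \<epsilon> (u n) (b n) t) \<longlonglongrightarrow> 0"
    proof (rule Lim_null_comparison)
      have "\<bar>circle_defect \<alpha> lam \<epsilon> (u n) (b n) t\<bar> \<le> 2/10^8 * (1/8) ^ n" for n
      proof -
        have "wiener_real (3/100 * (1 + (1/2) ^ n)) (circle_defect \<alpha> lam \<epsilon> (u n) (b n)) (2/10^8 * (1/8) ^ n)"
          using f(1)[of n] unfolding kam_state_def ub by auto
        then show ?thesis by (rule wiener_real_abs_le) simp
      qed
      then show "\<forall>\<^sub>F n in sequentially. norm (circle_defect \<alpha> lam \<epsilon> (u n) (b n) t) \<le> 2/10^8 * (1/8) ^ n"
        by simp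
      show "(\<lambda>n. 2/10^8 * (1/8::real) ^ n) \<longlonglongrightarrow> 0"
        by (intro tendsto_mult_right_zero LIMSEQ_power_zero) simp
    qed
  qed
  with U'w show ?thesis by (rule that)
qed

section \<open>Certificates for approximate solutions\<close>

text \<open>Integration has the multiplier 1/(i k), of modulus at most 1 for k \<noteq> 0, so no
  width is lost; periodicity of \<open>H\<close> gives \<open>g\<close> mean zero. The factor 2
  comes from H - H(0) = G - G(0), where \<open>G\<close> is the primitive of mean zero.\<close>

lemma wiener_primitive:
  assumes g: "wiener \<rho> g C" "0 < \<rho>" and H: "\<And>t. (H has_vector_derivative g t) (at t)" "H (2 * pi) = H 0"
  shows "wiener \<rho> (\<lambda>t. H t - H 0) (2 * C)"
proof -
  define m :: "int \<Rightarrow> complex" where "m k = (if k = 0 then 0 else 1 / (\<i> * of_int k))" for k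
  have m1: "norm (m k) \<le> 1" for k
    by (auto simp: m_def norm_divide norm_mult divide_simps)
  then have mw: "norm (m k) * exp (\<rho> * of_int \<bar>k\<bar>) \<le> 1 * exp (\<rho> * of_int \<bar>k\<bar>)" for k
    by (intro mult_right_mono) auto
  obtain k :: "nat \<Rightarrow> int" and c S G where
    f: "\<And>t. ((\<lambda>n. c n * cis (of_int (k n) * t)) has_sum g t) UNIV"
    "((\<lambda>n. norm (c n) * exp (\<rho> * of_int \<bar>k n\<bar>)) has_sum S) UNIV"
    "\<And>t. ((\<lambda>n. m (k n) * c n * cis (of_int (k n) * t)) has_sum G t) UNIV"
    "wiener \<rho> G (1 * C)"
    by (rule wiener_multiplier[OF g(1) _ mw]) (use g in auto)
  obtain a where a: "((\<lambda>n. if k n = 0 then c n else 0) has_sum a) UNIV"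
    "(g has_integral 2 * of_real pi * a) {0..2*pi}"
    by (rule trig_series_has_integral[OF f(1,2)]) (use g in auto)
  have "(g has_integral (H (2 * pi) - H 0)) {0..2*pi}"
    by (rule fundamental_theorem_of_calculus) (auto intro: has_vector_derivative_at_within H(1))
  then have "(g has_integral 0) {0..2*pi}" using H(2) by simp
  from has_integral_unique[OF a(2) this] have "a = 0" by simp
  have le: "norm (m (k n) * c n) * exp (\<rho> * of_int \<bar>k n\<bar>) \<le> norm (c n) * exp (\<rho> * of_int \<bar>k n\<bar>)" for n
    using mult_right_mono[OF m1[of "k n"], of "norm (c n)"] by (intro mult_right_mono) (auto simp: norm_mult)
  have nonneg: "0 \<le> norm (m (k n) * c n) * exp (\<rho> * of_int \<bar>k n\<bar>)" for n by simp
  obtain T where T: "((\<lambda>n. norm (m (k n) * c n) * exp (\<rho> * of_int \<bar>k n\<bar>)) has_sum T) UNIV" "0 \<le> T" "T \<le> S"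
    by (rule has_sum_mono_exists[OF f(2) nonneg le]) (rule that)
  have "(G has_vector_derivative g t) (at t)" for t
  proof -
    have "((\<lambda>z. \<Sum>n. m (k n) * c n * exp (\<i> * of_int (k n) * z)) has_field_derivative
     (\<Sum>n. m (k n) * c n * (\<i> * of_int (k n)) * exp (\<i> * of_int (k n) * of_real t))) (at (of_real t))"
      using g(2) by (intro trig_series_has_field_derivative[OF T(1)]) simp
    from has_vector_derivative_real_field[OF this]
    have "((\<lambda>s. \<Sum>n. m (k n) * c n * exp (\<i> * of_int (k n) * of_real s)) has_vector_derivative
      (\<Sum>n. m (k n) * c n * (\<i> * of_int (k n)) * exp (\<i> * of_int (k n) * of_real t))) (at t)" .
    moreover have "(\<Sum>n. m (k n) * c n * exp (\<i> * of_int (k n) * of_real s)) = G s" for s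
      using sums_unique[OF has_sum_imp_sums[OF f(3)[of s]]] by (simp add: cis_of_int_mult)
    moreover have "(\<Sum>n. m (k n) * c n * (\<i> * of_int (k n)) * exp (\<i> * of_int (k n) * of_real t)) = g t"
    proof -
      have 2: "((\<lambda>n. c n * cis (of_int (k n) * t) - (if k n = 0 then c n else 0)) has_sum (g t - 0)) UNIV"
        using a(1) \<open>a = 0\<close> by (intro has_sum_diff' f(1)) simp
      have eq: "m (k n) * c n * (\<i> * of_int (k n)) * exp (\<i> * of_int (k n) * of_real t) =
         c n * cis (of_int (k n) * t) - (if k n = 0 then c n else 0)" for n
        by (simp add: m_def cis_of_int_mult)
      show ?thesis unfolding eq using sums_unique[OF has_sum_imp_sums[OF 2]] by simp
    qed
    ultimately show ?thesis by simp
  qed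
  then have "((\<lambda>t. H t - G t) has_vector_derivative 0) (at t)" for t
    using has_vector_derivative_diff[OF H(1)[of t]] by fastforce
  then have "H t - G t = H 0 - G 0" for t
    using has_vector_derivative_zero_constant[of UNIV "\<lambda>t. H t - G t"] by (metis UNIV_I convex_UNIV has_vector_derivative_at_within)
  then have eq: "H t - H 0 = G t + (- G 0)" for t by (simp add: algebra_simps)
  have "wiener \<rho> (\<lambda>t. G t + (- G 0)) (C + norm (- G 0))"
    using f(4) g(2) by (intro wiener_add wiener_const) auto
  moreover have "norm (- G 0) \<le> C" using wiener_norm_le[OF f(4), of 0] g(2) by simp
  ultimately show ?thesis unfolding eq by (auto intro: wiener_mono)
qed

section \<open>Trigonometric polynomials as integer lists\<close>

text \<open>\<open>k\<close> is the frequency of the head and may be negative. Integer coefficients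
  let every certificate be evaluated exactly; complex coefficients are kept as a pair of
  lists.\<close>

primrec trig_poly :: "int list \<Rightarrow> int \<Rightarrow> real \<Rightarrow> complex" where
  "trig_poly [] k t = 0"
| "trig_poly (x # xs) k t = of_int x * cis (of_int k * t) + trig_poly xs (k + 1) t"

primrec smul :: "int \<Rightarrow> int list \<Rightarrow> int list" where
  "smul c [] = []"
| "smul c (x # xs) = c * x # smul c xs"

fun addl :: "int list \<Rightarrow> int list \<Rightarrow> int list" where
  "addl [] ys = ys"
| "addl (x # xs) [] = x # xs"
| "addl (x # xs) (y # ys) = (x + y) # addl xs ys"

fun subl :: "int list \<Rightarrow> int list \<Rightarrow> int list" where
  "subl xs [] = xs"
| "subl [] (y # ys) = - y # subl [] ys"
| "subl (x # xs) (y # ys) = (x - y) # subl xs ys"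

primrec pmul :: "int list \<Rightarrow> int list \<Rightarrow> int list" where
  "pmul [] ys = []"
| "pmul (x # xs) ys = addl (smul x ys) (0 # pmul xs ys)"

fun mull :: "int list \<Rightarrow> int list \<Rightarrow> int list" where
  "mull [] ys = []"
| "mull (x # xs) [] = []"
| "mull (x # xs) (y # ys) = x * y # mull xs ys"

primrec derl :: "int list \<Rightarrow> int \<Rightarrow> int list" where
  "derl [] k = []"
| "derl (x # xs) k = k * x # derl xs (k + 1)"

text \<open>Only the length of the first list counts: it is a unary number by which the second list
  is moved, in order to align lists whose lowest frequencies differ.\<close>

primrec zpad :: "int list \<Rightarrow> int list \<Rightarrow> int list" where
  "zpad [] ys = ys"
| "zpad (x # xs) ys = 0 # zpad xs ys"

primrec revapp :: "int list \<Rightarrow> int list \<Rightarrow> int list" where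
  "revapp [] ys = ys"
| "revapp (x # xs) ys = revapp xs (x # ys)"

text \<open>A running budget: each frequency spends (|x| + |y|) w of \<open>b\<close>, which
  majorises the weighted modulus of x + \<sigma> y whenever |\<sigma>| = 1.\<close>

fun wle :: "int list \<Rightarrow> int list \<Rightarrow> int list \<Rightarrow> int \<Rightarrow> bool" where
  "wle ws [] [] b \<longleftrightarrow> 0 \<le> b"
| "wle (w # ws) (x # xs) (y # ys) b \<longleftrightarrow> wle ws xs ys (b - (\<bar>x\<bar> + \<bar>y\<bar>) * w)"
| "wle _ _ _ _ \<longleftrightarrow> False"

text \<open>Integer majorants of 4096 exp(6/100 |k|), because exp(6/100) \<le> 17/16. The scale 4096
  leaves room for rounding.\<close>

primrec weights :: "int list \<Rightarrow> int \<Rightarrow> bool" where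
  "weights [] k \<longleftrightarrow> True"
| "weights (w # ws) k \<longleftrightarrow> 4096 * (17/16) ^ nat \<bar>k\<bar> \<le> (of_int w :: real) \<and> weights ws (k + 1)"

lemma trig_poly_addl [simp]: "trig_poly (addl xs ys) k t = trig_poly xs k t + trig_poly ys k t"
  by (induction xs ys arbitrary: k rule: addl.induct) (auto simp: algebra_simps)

lemma trig_poly_subl [simp]: "trig_poly (subl xs ys) k t = trig_poly xs k t - trig_poly ys k t"
  by (induction xs ys arbitrary: k rule: subl.induct) (auto simp: algebra_simps)

lemma trig_poly_smul [simp]: "trig_poly (smul c xs) k t = of_int c * trig_poly xs k t"
  by (induction xs arbitrary: k) (auto simp: algebra_simps)

lemma trig_poly_shift: "cis (of_int l * t) * trig_poly xs k t = trig_poly xs (k + l) t"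
proof (induction xs arbitrary: k)
  case (Cons x xs)
  have "cis (of_int l * t) * cis (of_int k * t) = cis (of_int (k + l) * t)"
    by (simp add: cis_mult algebra_simps)
  moreover have "cis (of_int l * t) * trig_poly xs (k + 1) t = trig_poly xs (k + l + 1) t"
    using Cons[of "k + 1"] by (simp add: algebra_simps)
  ultimately show ?case by (simp add: distrib_left mult.left_commute)
qed simp

lemma trig_poly_pmul: "trig_poly (pmul xs ys) (k + l) t = trig_poly xs k t * trig_poly ys l t"
proof (induction xs arbitrary: k)
  case (Cons x xs)
  have "trig_poly (pmul xs ys) (k + l + 1) t = trig_poly xs (k + 1) t * trig_poly ys l t"
    using Cons[of "k + 1"] by (simp add: algebra_simps)
  moreover have "trig_poly ys (k + l) t = cis (of_int k * t) * trig_poly ys l t"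
    by (simp add: trig_poly_shift add.commute)
  ultimately show ?case by (simp add: algebra_simps)
qed simp

lemma trig_poly_zpad [simp]: "trig_poly (zpad xs ys) k t = trig_poly ys (k + int (length xs)) t"
  by (induction xs arbitrary: k) (auto simp: algebra_simps)

text \<open>Coefficients are real, so conjugation only reflects frequencies. A list of positive
  frequencies, reversed and put in front, thus supplies the negative half of a Laurent
  polynomial.\<close>

lemma trig_poly_revapp:
  "trig_poly (revapp xs ys) (k - int (length xs)) t = cnj (trig_poly xs (1 - k) t) + trig_poly ys k t"
proof (induction xs arbitrary: ys k)
  case (Cons x xs)
  show ?case using Cons[of "x # ys" "k - 1"] by (simp add: algebra_simps cis_cnj)
qed simp

lemma trig_poly_0: "trig_poly xs k 0 = of_int (sum_list xs)"
  by (induction xs arbitrary: k) auto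

lemma trig_poly_periodic: "trig_poly xs k (t + 2 * pi) = trig_poly xs k t"
proof (induction xs arbitrary: k)
  case (Cons x xs)
  have "cis (of_int k * (t + 2 * pi)) = cis (of_int k * t) * cis (2 * pi * of_int k)"
    by (simp add: cis_mult algebra_simps)
  with Cons show ?case by simp
qed simp

lemma trig_poly_deriv:
  "(trig_poly xs k has_vector_derivative \<i> * trig_poly (derl xs k) k t) (at t)"
proof (induction xs arbitrary: k)
  case Nil
  have "trig_poly [] k = (\<lambda>_. 0)" by auto
  then show ?case by simp
next
  case (Cons x xs)
  have "((\<lambda>z. of_int x * exp (\<i> * of_int k * z)) has_field_derivative of_int x * (\<i> * of_int k * exp (\<i> * of_int k * of_real t))) (at (of_real t))"
    by (auto intro!: derivative_eq_intros)
  from has_vector_derivative_real_field[OF this]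
  have "((\<lambda>t. of_int x * cis (of_int k * t)) has_vector_derivative of_int x * (\<i> * of_int k * cis (of_int k * t))) (at t)"
    by (simp add: cis_of_int_mult)
  from has_vector_derivative_add[OF this Cons[of "k + 1"]]
  have "((\<lambda>t. of_int x * cis (of_int k * t) + trig_poly xs (k + 1) t) has_vector_derivative
      \<i> * trig_poly (derl (x # xs) k) k t) (at t)"
    by (simp add: distrib_left mult.left_commute mult.assoc)
  moreover have "trig_poly (x # xs) k = (\<lambda>t. of_int x * cis (of_int k * t) + trig_poly xs (k + 1) t)" by auto
  ultimately show ?case by (simp only:)
qed

lemma exp_weight: "exp (6/100) \<le> (17/16 :: real)"
proof -
  have "exp (15/1000 :: real) \<le> 1 + 15/1000 + (15/1000)\<^sup>2" by (rule exp_bound) auto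
  then have "exp (15/1000 :: real) ^ 4 \<le> (1 + 15/1000 + (15/1000)\<^sup>2) ^ 4" by (rule power_mono) simp
  also have "\<dots> \<le> 17/16" by (simp add: power2_eq_square eval_nat_numeral)
  finally show ?thesis by (simp flip: exp_of_nat_mult)
qed

lemma exp_weight_power: "exp (6/100 * of_int \<bar>k\<bar>) \<le> (17/16 :: real) ^ nat \<bar>k\<bar>"
proof -
  have "exp (6/100 * of_int \<bar>k\<bar>) = exp (6/100 :: real) ^ nat \<bar>k\<bar>"
    by (simp add: mult.commute flip: exp_of_nat_mult)
  then show ?thesis using power_mono[OF exp_weight, of "nat \<bar>k\<bar>"] by simp
qed

text \<open>The unit factor \<sigma> covers both conventions in use, i for pairs x + i y and -i for
  \<open>P\<close> below.\<close>

lemma wiener_wle: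
  assumes "wle ws xs ys b" "weights ws k" "norm \<sigma> = 1"
  shows "wiener (6/100) (\<lambda>t. trig_poly xs k t + \<sigma> * trig_poly ys k t) (of_int b / 4096)"
  using assms(1,2)
proof (induction ws xs ys b arbitrary: k rule: wle.induct)
  case (1 ws b)
  then show ?case by (auto intro: wiener_mono[OF wiener_const[of _ 0, simplified]])
next
  case (2 w ws x xs y ys b)
  let ?n = "\<bar>x\<bar> + \<bar>y\<bar>"
  have IH: "wiener (6/100) (\<lambda>t. trig_poly xs (k+1) t + \<sigma> * trig_poly ys (k+1) t) (of_int (b - ?n * w) / 4096)"
    using 2 by simp
  have w: "exp (6/100 * of_int \<bar>k\<bar>) \<le> (of_int w / 4096 :: real)"
    using exp_weight_power[of k] 2(3) by simp
  have "norm (of_int x + \<sigma> * of_int y) \<le> norm (of_int x :: complex) + norm (\<sigma> * of_int y)" by (rule norm_triangle_ineq)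
  then have n: "norm (of_int x + \<sigma> * of_int y) \<le> of_int ?n" by (simp add: norm_mult assms(3))
  have "wiener (6/100) (\<lambda>t. (of_int x + \<sigma> * of_int y) * cis (of_int k * t)) (of_int ?n * (of_int w / 4096))"
    using mult_mono[OF n w] by (intro wiener_mono[OF wiener_cis]) auto
  from wiener_add[OF this IH] show ?case by (simp add: algebra_simps diff_divide_distrib)
qed auto

primrec symbol_table :: "real \<Rightarrow> int \<Rightarrow> real \<Rightarrow> int list \<Rightarrow> int list \<Rightarrow> int \<Rightarrow> bool" where
  "symbol_table \<alpha> T \<delta> [] ws k \<longleftrightarrow> True"
| "symbol_table \<alpha> T \<delta> (u # us) ws k \<longleftrightarrow> ws \<noteq> [] \<and>
     norm (5 * of_int T * (cis (of_int k * \<alpha>) - 7/5 + 2/5 * cis (of_int k * - \<alpha>)) - (of_int u + \<i> * of_int (hd ws))) \<le> \<delta> \<and>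
     symbol_table \<alpha> T \<delta> us (tl ws) (k + 1)"

text \<open>An error \<delta> at each frequency gives in total \<delta> times the weighted sum of
  the coefficients. The combined lists are the real and imaginary parts of (al - i be)(us + i
  ws).\<close>

lemma wiener_symbol_table:
  assumes "wle W al be b" "weights W k" "symbol_table \<alpha> T \<delta> us ws k" "length al \<le> length us" "0 \<le> \<delta>"
  defines "P \<equiv> \<lambda>k al be t. trig_poly al k t - \<i> * trig_poly be k t"
  shows "wiener (6/100) (\<lambda>t. 5 * of_int T * (P k al be (t + \<alpha>) - 7/5 * P k al be t + 2/5 * P k al be (t - \<alpha>))
     - (trig_poly (addl (mull al us) (mull be ws)) k t + \<i> * trig_poly (subl (mull al ws) (mull be us)) k t))
     (\<delta> * of_int b / 4096)"
  using assms(1-4)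
proof (induction W al be b arbitrary: k us ws rule: wle.induct)
  case (1 W b)
  then show ?case using \<open>0 \<le> \<delta>\<close> unfolding P_def by (auto intro: wiener_mono[OF wiener_const[of _ 0, simplified]])
next
  case (2 w W x al y be b)
  let ?n = "\<bar>x\<bar> + \<bar>y\<bar>"
  obtain u us' where us: "us = u # us'" using 2(5) by (cases us) auto
  obtain v ws' where ws: "ws = v # ws'" using 2(4) us by (cases ws) auto
  let ?F = "\<lambda>k al be us ws t. 5 * of_int T * (P k al be (t + \<alpha>) - 7/5 * P k al be t + 2/5 * P k al be (t - \<alpha>))
     - (trig_poly (addl (mull al us) (mull be ws)) k t + \<i> * trig_poly (subl (mull al ws) (mull be us)) k t)"
  have IH: "wiener (6/100) (?F (k + 1) al be us' ws') (\<delta> * of_int (b - ?n * w) / 4096)"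
    using 2 us ws by (intro 2(1)) auto
  have w: "exp (6/100 * of_int \<bar>k\<bar>) \<le> (of_int w / 4096 :: real)"
    using exp_weight_power[of k] 2(3) by simp
  define \<gamma> :: complex where "\<gamma> = of_int x - \<i> * of_int y"
  define \<tau> where "\<tau> = 5 * of_int T * (cis (of_int k * \<alpha>) - 7/5 + 2/5 * cis (of_int k * - \<alpha>)) - (of_int u + \<i> * of_int v)"
  have "norm \<gamma> \<le> norm (of_int x :: complex) + norm (\<i> * of_int y :: complex)"
    unfolding \<gamma>_def by (rule norm_triangle_ineq4)
  then have n: "norm \<gamma> \<le> of_int ?n" by (simp add: norm_mult)
  have "norm \<tau> \<le> \<delta>" using 2(4) us ws by (simp add: \<tau>_def)
  then have "norm (\<gamma> * \<tau>) * exp (6/100 * of_int \<bar>k\<bar>) \<le> (of_int ?n * \<delta>) * (of_int w / 4096)"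
    unfolding norm_mult using n w \<open>0 \<le> \<delta>\<close> by (intro mult_mono) auto
  then have "wiener (6/100) (\<lambda>t. \<gamma> * \<tau> * cis (of_int k * t)) ((of_int ?n * \<delta>) * (of_int w / 4096))"
    by (rule wiener_mono[OF wiener_cis])
  from wiener_add[OF this IH]
  have "wiener (6/100) (\<lambda>t. \<gamma> * \<tau> * cis (of_int k * t) + ?F (k + 1) al be us' ws' t) (\<delta> * of_int b / 4096)"
    by (simp add: algebra_simps diff_divide_distrib)
  moreover have "?F k (x # al) (y # be) us ws t = \<gamma> * \<tau> * cis (of_int k * t) + ?F (k + 1) al be us' ws' t" for t
  proof -
    have 1: "cis (of_int k * (t + \<alpha>)) = cis (of_int k * \<alpha>) * cis (of_int k * t)"
      "cis (of_int k * (t - \<alpha>)) = cis (of_int k * - \<alpha>) * cis (of_int k * t)"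
      by (simp_all add: cis_mult algebra_simps)
    show ?thesis
      unfolding us ws P_def \<gamma>_def \<tau>_def trig_poly.simps mull.simps trig_poly_addl trig_poly_subl 1
      by (simp add: algebra_simps)
  qed
  ultimately show ?case by (simp only:)
qed auto

lemma exp_06: "exp (6/10 :: real) \<le> 185/100"
proof -
  have "exp (3/80 :: real) \<le> 1 + 3/80 + (3/80)\<^sup>2" by (rule exp_bound) auto
  then have "exp (3/80 :: real) ^ 16 \<le> (1 + 3/80 + (3/80)\<^sup>2) ^ 16" by (rule power_mono) simp
  also have "\<dots> \<le> 185/100" by (simp add: power2_eq_square eval_nat_numeral)
  finally show ?thesis by (simp flip: exp_of_nat_mult)
qed

text \<open>Weights depend on |k| only, so the negative side is obtained by reflecting as many of
  them as the first list has entries.\<close>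

fun wrev :: "int list \<Rightarrow> int list \<Rightarrow> int list \<Rightarrow> int list" where
  "wrev [] ws acc = acc"
| "wrev (x # xs) (w # ws) acc = wrev xs ws (w # acc)"
| "wrev (x # xs) [] acc = []"

lemma weights_wrev:
  "weights acc k \<Longrightarrow> weights ws (1 - k) \<Longrightarrow> weights (wrev xs ws acc) (k - int (length xs))"
proof (induction xs ws acc arbitrary: k rule: wrev.induct)
  case (2 x xs w ws acc)
  have "\<bar>k - 1\<bar> = \<bar>1 - k\<bar>" by simp
  then have "weights (w # acc) (k - 1)" "weights ws (1 - (k - 1))"
    using 2(2,3) by (auto simp: algebra_simps)
  from 2(1)[OF this] show ?case by (simp add: algebra_simps)
qed auto

lemma length_derl [simp]: "length (derl xs k) = length xs" by (induction xs arbitrary: k) auto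
lemma length_smul [simp]: "length (smul c xs) = length xs" by (induction xs) auto
lemma length_zpad [simp]: "length (zpad xs ys) = length xs + length ys" by (induction xs) auto

text \<open>
  The data: \<open>U = (\<Sum>j\<ge>1. al\<^sub>j (cos jt - 1) + be\<^sub>j sin jt) / D\<close>; \<open>(x + i y) / D\<close> is a Laurent polynomial
  close to \<open>exp (i (t + U))\<close>, with coefficients of negative index in \<open>xm\<close>, \<open>ym\<close>; \<open>(g + i h) / (2 D)\<close> is
  \<open>1 + U'\<close>, and \<open>(bg + i bh) / Db\<close> is an approximate inverse of \<open>1 + U'\<close>. The list \<open>wt\<close> bounds
  \<open>4096 (17/16)^k\<close> for \<open>k \<ge> 1\<close>, and \<open>us + i ws\<close> approximates \<open>5 T\<close> times the symbol of the linear
  operator \<open>U(t + \<alpha>) - 7/5 U(t) + 2/5 U(t - \<alpha>)\<close>.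
\<close>

locale circle_certificate =
  fixes D T Db e x0 y0 b0 m :: int
    and al be xm xp ym yp gb hb us ws gp hp g h x y bg bh wt :: "int list"
    and Ab Bb Qb Ub Rb Eb :: int and \<alpha> \<delta> :: real
  assumes gp_def: "gp = derl be 1" and hp_def: "hp = derl al 1"
    and g_def: "g = revapp gp (2 * D # gp)" and h_def: "h = revapp (smul (-1) hp) (0 # hp)"
    and x_def: "x = revapp xm (x0 # xp)" and y_def: "y = revapp ym (y0 # yp)"
    and bg_def: "bg = revapp gb (b0 # gb)" and bh_def: "bh = revapp (smul (-1) hb) (0 # hb)"
    and pos: "0 < D" "0 < T" "0 < Db" "0 \<le> e" "e \<le> 7"
    and m: "m = int (length xm)"
    and len: "length be = length al" "length ym = length xm" "length hb = length gb" "length al \<le> length us"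
    and wt: "weights (4096 # wt) 0"
    and A: "wle (wrev al wt (4096 # wt)) g h Ab" "100 * Ab \<le> 208 * 8192 * D"
    and B: "wle (wrev gb wt (4096 # wt)) bg bh Bb" "100 * Bb \<le> 195 * 4096 * Db"
    and Q: "wle (wrev (zpad al gb) wt (4096 # wt)) (subl (subl (pmul bg g) (pmul bh h)) (zpad al (zpad gb [2 * D * Db])))
        (addl (pmul bg h) (pmul bh g)) Qb" "100 * Qb \<le> 8192 * D * Db"
    and U: "wle wt al be Ub" "10 * Ub \<le> 6 * 4096 * D"
    and init: "sum_list x = D" "sum_list y = 0"
    and R0: "wle (wrev (zpad al xm) wt (4096 # wt)) (subl (zpad al (smul (2 * D) (derl x (- m)))) (subl (pmul g x) (pmul h y)))
        (subl (zpad al (smul (2 * D) (derl y (- m)))) (addl (pmul g y) (pmul h x))) Rb"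
      "10^9 * Rb \<le> 2 * 8192 * D * D"
    and E: "wle wt (addl (smul 2 (addl (mull al us) (mull be ws))) (smul (- (e * T)) (addl yp ym)))
        (addl (smul 2 (subl (mull al ws) (mull be us))) (smul (e * T) (subl xp xm))) Eb"
      "10^9 * Eb \<le> 8 * 40960 * T * D"
    and table: "symbol_table \<alpha> T \<delta> us ws 1" "0 \<le> \<delta>" "\<delta> \<le> 8 * of_int T / 10^9"
begin

section \<open>From a certificate to the initial state of the iteration\<close>

lemmas R = R0[unfolded m]

lemma wt1: "weights wt 1" using wt by simp

lemma weights: "weights (wrev al wt (4096 # wt)) (- int (length al))"
  "weights (wrev gb wt (4096 # wt)) (- int (length gb))"
  "weights (wrev (zpad al gb) wt (4096 # wt)) (- int (length al + length gb))"
  "weights wt 1"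
  "weights (wrev (zpad al xm) wt (4096 # wt)) (- int (length al + length xm))"
  using weights_wrev[OF wt, of wt al] weights_wrev[OF wt, of wt gb] weights_wrev[OF wt, of wt "zpad al gb"]
    weights_wrev[OF wt, of wt "zpad al xm"] wt1 by simp_all

text \<open>al cos(jt) + be sin(jt) is the real part of (al - i be) exp(i j t), whence the minus
  sign.\<close>

definition P where "P t = trig_poly al 1 t - \<i> * trig_poly be 1 t"
text \<open>The subtracted constant makes u(0) = 0, so that exp(i (t + u)) starts at 1, like
  \<open>z\<close>.\<close>

definition u where "u t = (Re (P t) - of_int (sum_list al)) / of_int D"
definition a where "a t = 1 + (Re (trig_poly gp 1 t) - Im (trig_poly hp 1 t)) / of_int D"
definition z where "z t = (trig_poly x (- int (length xm)) t + \<i> * trig_poly y (- int (length xm)) t) / of_int D"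

lemma D_pos: "0 < (of_int D :: real)" using pos by simp

lemma u_deriv: "(u has_real_derivative a t - 1) (at t)"
proof -
  have "(P has_vector_derivative \<i> * trig_poly (derl al 1) 1 t - \<i> * (\<i> * trig_poly (derl be 1) 1 t)) (at t)"
    unfolding P_def[abs_def]
    by (intro has_vector_derivative_diff trig_poly_deriv has_vector_derivative_mult_right)
  from bounded_linear.has_vector_derivative[OF bounded_linear_Re this]
  have "((\<lambda>t. Re (P t)) has_real_derivative Re (trig_poly gp 1 t) - Im (trig_poly hp 1 t)) (at t)"
    by (simp add: has_real_derivative_iff_has_vector_derivative gp_def hp_def)
  then have "((\<lambda>t. (Re (P t) - of_int (sum_list al)) / of_int D) has_real_derivative
      (Re (trig_poly gp 1 t) - Im (trig_poly hp 1 t) - 0) / of_int D) (at t)"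
    by (intro DERIV_cdivide DERIV_diff DERIV_const)
  then show ?thesis unfolding u_def[abs_def] a_def by simp
qed

text \<open>A real part is half the sum with the conjugate: \<open>g\<close> is symmetric,
  \<open>h\<close> antisymmetric, and the denominator becomes 2 D.\<close>

lemma a_eq: "of_real (a t) = (trig_poly g (- int (length al)) t + \<i> * trig_poly h (- int (length al)) t) / (2 * of_int D)"
proof -
  have g: "trig_poly g (- int (length al)) t = cnj (trig_poly gp 1 t) + (2 * of_int D + trig_poly gp 1 t)"
    using trig_poly_revapp[of gp "2 * D # gp" 0 t] len by (simp add: g_def gp_def)
  have h: "trig_poly h (- int (length al)) t = cnj (- trig_poly hp 1 t) + trig_poly hp 1 t"
    using trig_poly_revapp[of "smul (-1) hp" "0 # hp" 0 t] by (simp add: h_def hp_def)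
  show ?thesis unfolding g h a_def using D_pos by (auto simp: complex_eq_iff field_simps)
qed

lemma wiener_a: "wiener_real (6/100) a (208/100)"
proof -
  have "wiener (6/100) (\<lambda>t. (1 / (2 * of_int D)) * (trig_poly g (- int (length al)) t + \<i> * trig_poly h (- int (length al)) t))
      (norm (1 / (2 * of_int D) :: complex) * (of_int Ab / 4096))"
    by (intro wiener_cmult wiener_wle[OF A(1) weights(1)]) auto
  then have "wiener_real (6/100) a (norm (1 / (2 * of_int D) :: complex) * (of_int Ab / 4096))"
    unfolding a_eq by simp
  moreover have "real_of_int (100 * Ab) \<le> of_int (208 * 8192 * D)" using A(2) by (simp only: of_int_le_iff)
  then have "norm (1 / (2 * of_int D) :: complex) * (of_int Ab / 4096) \<le> 208/100"
    using D_pos by (simp add: norm_divide norm_mult field_simps)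
  ultimately show ?thesis by (rule wiener_mono)
qed

text \<open>With the approximate inverse \<open>b\<close> and q = 1 - b a of norm at most 1/100,
  neither factor can vanish and 1/a = b/(1 - q); the bound is (195/100)/(99/100) \<le>
  197/100.\<close>

lemma wiener_inverse_a: "a t \<noteq> 0" "wiener_real (6/100) (\<lambda>t. 1 / a t) (197/100)"
proof -
  have Db: "0 < (of_int Db :: real)" using pos by simp
  define b where "b t = (trig_poly bg (- int (length gb)) t + \<i> * trig_poly bh (- int (length gb)) t) / of_int Db" for t
  have b: "wiener (6/100) b (195/100)"
  proof -
    have "wiener (6/100) (\<lambda>t. (1 / of_int Db) * (trig_poly bg (- int (length gb)) t + \<i> * trig_poly bh (- int (length gb)) t))
        (norm (1 / of_int Db :: complex) * (of_int Bb / 4096))"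
      by (intro wiener_cmult wiener_wle[OF B(1) weights(2)]) auto
    then have "wiener (6/100) b (norm (1 / of_int Db :: complex) * (of_int Bb / 4096))"
      unfolding b_def[abs_def] by simp
    moreover have "real_of_int (100 * Bb) \<le> of_int (195 * 4096 * Db)" using B(2) by (simp only: of_int_le_iff)
    then have "norm (1 / of_int Db :: complex) * (of_int Bb / 4096) \<le> 195/100"
      using Db by (simp add: norm_divide norm_mult field_simps)
    ultimately show ?thesis by (rule wiener_mono)
  qed
  define q where "q t = 1 - b t * of_real (a t)" for t
  have q: "wiener (6/100) q (1/100)"
  proof -
    let ?n = "- int (length al + length gb)"
    let ?X = "subl (subl (pmul bg g) (pmul bh h)) (zpad al (zpad gb [2 * D * Db]))" and ?Y = "addl (pmul bg h) (pmul bh g)"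
    have pm: "trig_poly (pmul xs ys) ?n t = trig_poly xs (- int (length gb)) t * trig_poly ys (- int (length al)) t" for xs ys t
      using trig_poly_pmul[of xs ys "- int (length gb)" "- int (length al)" t] by (simp add: algebra_simps)
    have X: "trig_poly ?X ?n t + \<i> * trig_poly ?Y ?n t =
        (trig_poly bg (- int (length gb)) t + \<i> * trig_poly bh (- int (length gb)) t) *
        (trig_poly g (- int (length al)) t + \<i> * trig_poly h (- int (length al)) t) - 2 * of_int D * of_int Db" for t
      unfolding trig_poly_addl trig_poly_subl pm trig_poly_zpad by (simp add: algebra_simps)
    have qe: "q t = (- 1 / (2 * of_int D * of_int Db)) * (trig_poly ?X ?n t + \<i> * trig_poly ?Y ?n t)" for t
      unfolding X q_def b_def a_eq using D_pos Db by (auto simp: field_simps)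
    have "wiener (6/100) q (norm (- 1 / (2 * of_int D * of_int Db) :: complex) * (of_int Qb / 4096))"
      unfolding qe[abs_def] by (intro wiener_cmult wiener_wle[OF Q(1) weights(3)]) auto
    moreover have "real_of_int (100 * Qb) \<le> of_int (8192 * D * Db)" using Q(2) by (simp only: of_int_le_iff)
    then have "norm (- 1 / (2 * of_int D * of_int Db) :: complex) * (of_int Qb / 4096) \<le> 1/100"
      using D_pos Db by (simp add: norm_divide norm_mult field_simps)
    ultimately show ?thesis by (rule wiener_mono)
  qed
  have nz: "a t \<noteq> 0" "b t \<noteq> 0" for t
    using wiener_norm_le[OF q, of t] by (auto simp: q_def)
  show "a t \<noteq> 0" by (rule nz)
  have "wiener (6/100) (\<lambda>t. b t * (1 / (1 - q t))) (195/100 * (1 / (1 - 1/100)))"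
    by (intro wiener_mult b wiener_geometric q) auto
  moreover have "b t * (1 / (1 - q t)) = of_real (1 / a t)" for t
    using nz[of t] by (simp add: q_def)
  ultimately show "wiener_real (6/100) (\<lambda>t. 1 / a t) (197/100)"
    by (auto intro: wiener_mono)
qed

lemma u_periodic: "u (t + 2 * pi) = u t"
  by (simp add: u_def P_def trig_poly_periodic)

text \<open>\<open>a\<close> is continuous without zeros, and by periodicity of \<open>u\<close> the
  mean value theorem gives a point where it equals 1; so it cannot change sign.\<close>

lemma a_pos: "0 < a t"
proof (rule ccontr)
  assume "\<not> 0 < a t"
  then have neg: "a t < 0" using wiener_inverse_a(1)[of t] by simp
  have "\<exists>s>0. s < 2 * pi \<and> (2 * pi + u (2 * pi)) - (0 + u 0) = (2 * pi - 0) * a s"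
  proof (rule MVT2)
    show "((\<lambda>t. t + u t) has_real_derivative a s) (at s)" for s
      using u_deriv[of s] by (auto intro!: derivative_eq_intros)
  qed simp
  then obtain s where "a s = 1" using u_periodic[of 0] by auto
  have cont: "continuous_on UNIV a"
    unfolding a_def[abs_def]
    by (intro continuous_intros continuous_at_imp_continuous_on ballI)
       (use D_pos has_vector_derivative_continuous[OF trig_poly_deriv] in auto)
  have "connected (a ` UNIV)" by (rule connected_continuous_image[OF cont connected_UNIV])
  then have "0 \<in> a ` UNIV"
    using connectedD_interval[of "a ` UNIV" "a t" "a s" 0] neg \<open>a s = 1\<close> by auto
  then show False using wiener_inverse_a(1) by auto
qed

lemma u_0: "u 0 = 0"
  by (simp add: u_def P_def trig_poly_0)

lemma wiener_P: "wiener (6/100) P (of_int Ub / 4096)"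
  using wiener_wle[OF U(1) weights(4), of "-\<i>"] by (simp add: P_def[abs_def])

lemma Ub_bound: "of_int Ub / 4096 / of_int D \<le> (6/10 :: real)"
proof -
  have "real_of_int (10 * Ub) \<le> of_int (6 * 4096 * D)" using U(2) by (simp only: of_int_le_iff)
  then show ?thesis using D_pos by (simp add: field_simps)
qed

lemma wiener_Re_P: "wiener_real (6/100) (\<lambda>t. (1 / of_int D) * Re (P t)) (6/10)"
proof -
  have "wiener_real (6/100) (\<lambda>t. (1 / of_int D) * Re (P t)) (\<bar>1 / of_int D\<bar> * (of_int Ub / 4096))"
    by (intro wiener_real_cmult wiener_Re wiener_P) auto
  then show ?thesis by (rule wiener_mono) (use Ub_bound D_pos in \<open>simp add: field_simps\<close>)
qed

lemma wiener_u: "\<exists>C. wiener_real (6/100) u C"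
proof -
  have "wiener_real (6/100) (\<lambda>t. (1 / of_int D) * Re (P t) - of_int (sum_list al) / of_int D) (6/10 + \<bar>of_int (sum_list al) / of_int D\<bar>)"
    by (intro wiener_real_diff wiener_Re_P wiener_real_const) auto
  then show ?thesis unfolding u_def[abs_def] by (auto simp: diff_divide_distrib)
qed

text \<open>The constant in \<open>u\<close> contributes only a unit factor. There remain 17/16 from
  exp(i t) and exp(6/10) \<le> 185/100, with product below 197/100.\<close>

lemma wiener_V: "wiener (6/100) (\<lambda>t. cis (t + u t)) (197/100)"
proof -
  let ?s = "- of_int (sum_list al) / of_int D :: real"
  have "wiener (6/100) (\<lambda>t. (cis ?s * cis (of_int 1 * t)) * exp (\<i> * of_real ((1 / of_int D) * Re (P t))))
      ((norm (cis ?s) * exp (6/100 * of_int \<bar>1\<bar>)) * exp (norm \<i> * (6/10)))"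
    by (intro wiener_mult wiener_exp wiener_cmult wiener_Re_P wiener_cis) auto
  moreover have "(cis ?s * cis (of_int 1 * t)) * exp (\<i> * of_real ((1 / of_int D) * Re (P t))) = cis (t + u t)" for t
    unfolding cis_conv_exp[symmetric] cis_mult by (simp add: u_def diff_divide_distrib algebra_simps)
  moreover have "(norm (cis ?s) * exp (6/100 * of_int \<bar>1\<bar>)) * exp (norm \<i> * (6/10)) \<le> 197/100"
    using mult_mono[OF exp_weight exp_06] by simp
  ultimately show ?thesis by (auto intro: wiener_mono)
qed

lemma wiener_V_cnj: "wiener (6/100) (\<lambda>t. cis (- (t + u t))) (197/100)"
  using wiener_cnj[OF wiener_V] by (simp add: cis_cnj)

lemma z_approx: "wiener (6/100) (\<lambda>t. z t - cis (t + u t)) (156/10^10)"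
proof -
  let ?m = "- int (length xm)" and ?n = "- int (length al + length xm)"
  let ?X = "subl (zpad al (smul (2 * D) (derl x ?m))) (subl (pmul g x) (pmul h y))"
    and ?Y = "subl (zpad al (smul (2 * D) (derl y ?m))) (addl (pmul g y) (pmul h x))"
  define r where "r t = (\<i> / (2 * of_int D * of_int D)) * (trig_poly ?X ?n t + \<i> * trig_poly ?Y ?n t)" for t
  have r: "wiener (6/100) r (2/10^9)"
  proof -
    have "wiener (6/100) r (norm (\<i> / (2 * of_int D * of_int D) :: complex) * (of_int Rb / 4096))"
      unfolding r_def[abs_def] by (intro wiener_cmult wiener_wle[OF R(1) weights(5)]) auto
    moreover have "real_of_int (10^9 * Rb) \<le> of_int (2 * 8192 * D * D)" using R(2) by (simp only: of_int_le_iff)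
    then have "norm (\<i> / (2 * of_int D * of_int D) :: complex) * (of_int Rb / 4096) \<le> 2/10^9"
      using D_pos by (simp add: norm_divide norm_mult field_simps)
    ultimately show ?thesis by (rule wiener_mono)
  qed
  have pm: "trig_poly (pmul xs ys) ?n t = trig_poly xs (- int (length al)) t * trig_poly ys ?m t" for xs ys t
    using trig_poly_pmul[of xs ys "- int (length al)" ?m t] by simp
  have r_eq: "r t = \<i> * (trig_poly (derl x ?m) ?m t + \<i> * trig_poly (derl y ?m) ?m t) / of_int D - \<i> * of_real (a t) * z t" for t
    unfolding r_def a_eq z_def trig_poly_addl trig_poly_subl pm trig_poly_zpad trig_poly_smul
    using D_pos by (simp add: field_simps)
  define H where "H t = z t * cis (- (t + u t))" for t
  have H: "(H has_vector_derivative r t * cis (- (t + u t))) (at t)" for t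
  proof -
    have "(z has_vector_derivative (\<i> * trig_poly (derl x ?m) ?m t + \<i> * (\<i> * trig_poly (derl y ?m) ?m t)) / of_int D) (at t)"
      unfolding z_def[abs_def]
      by (intro has_vector_derivative_divide has_vector_derivative_add trig_poly_deriv has_vector_derivative_mult_right)
    moreover have "((\<lambda>t. cis (- (t + u t))) has_vector_derivative (- \<i> * of_real (a t)) * cis (- (t + u t))) (at t)"
    proof -
      have "((\<lambda>t. - (t + u t)) has_real_derivative - a t) (at t)"
        using u_deriv[of t] by (auto intro!: derivative_eq_intros)
      then have "((\<lambda>t. - (t + u t)) has_vector_derivative - a t) (at t)"
        by (simp add: has_real_derivative_iff_has_vector_derivative)
      moreover have "((\<lambda>s. exp (\<i> * of_real s)) has_vector_derivative \<i> * exp (\<i> * of_real s)) (at s)" for s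
        by (rule has_vector_derivative_real_field) (auto intro!: derivative_eq_intros)
      ultimately have "((\<lambda>s. exp (\<i> * of_real s)) \<circ> (\<lambda>t. - (t + u t)) has_vector_derivative
          (- a t) *\<^sub>R (\<i> * exp (\<i> * of_real (- (t + u t))))) (at t)"
        by (rule vector_diff_chain_at)
      then show ?thesis by (simp add: o_def cis_conv_exp scaleR_conv_of_real ac_simps)
    qed
    ultimately have "(H has_vector_derivative z t * ((- \<i> * of_real (a t)) * cis (- (t + u t))) +
       ((\<i> * trig_poly (derl x ?m) ?m t + \<i> * (\<i> * trig_poly (derl y ?m) ?m t)) / of_int D) * cis (- (t + u t))) (at t)"
      unfolding H_def[abs_def] by (rule has_vector_derivative_mult)
    moreover have "z t * ((- \<i> * of_real (a t)) * cis (- (t + u t))) +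
       ((\<i> * trig_poly (derl x ?m) ?m t + \<i> * (\<i> * trig_poly (derl y ?m) ?m t)) / of_int D) * cis (- (t + u t)) =
       r t * cis (- (t + u t))"
      unfolding r_eq by (simp add: algebra_simps add_divide_distrib)
    ultimately show ?thesis by (simp only:)
  qed
  have "H 0 = 1"
    using D_pos by (simp add: H_def z_def u_0 trig_poly_0 init)
  moreover have "H (2 * pi) = H 0"
  proof -
    have "z (2 * pi) = z 0" using trig_poly_periodic[of _ _ 0] by (simp add: z_def)
    moreover have "cis (- (2 * pi + u (2 * pi))) = cis (- (0 + u 0))"
    proof -
      have "cis (- (2 * pi)) = 1" by (simp flip: cis_cnj)
      then show ?thesis using u_periodic[of 0] by (simp add: u_0)
    qed
    ultimately show ?thesis unfolding H_def by (simp only:)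
  qed
  \<comment> \<open>The factor 2 is that of \<open>wiener_primitive\<close>, 2/10^9 bounds
    \<open>r\<close>, and exp(-iX) costs 197/100. Multiplying back by exp(iX) costs 197/100 again,
    and 4 * (197/100)^2 / 10^9 \<le> 156/10^10.\<close>
  ultimately have "wiener (6/100) (\<lambda>t. H t - 1) (2 * (2/10^9 * (197/100)))"
    using wiener_primitive[OF wiener_mult[OF r wiener_V_cnj] _ H] by simp
  then have "wiener (6/100) (\<lambda>t. cis (t + u t) * (H t - 1)) (197/100 * (2 * (2/10^9 * (197/100))))"
    by (intro wiener_mult wiener_V) auto
  moreover have "cis (t + u t) * (H t - 1) = z t - cis (t + u t)" for t
    by (simp add: H_def algebra_simps cis_mult)
  ultimately show ?thesis by (auto intro: wiener_mono)
qed

text \<open>Taking the imaginary part folds negative frequencies onto positive ones, so that the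
  sine term can be compared with \<open>P\<close> at frequencies at least 1; the constant
  \<open>y0\<close> is left for the parameter.\<close>

lemma Im_z: "of_int D * Im (z t) = of_int y0 + Re (trig_poly (addl yp ym) 1 t - \<i> * trig_poly (subl xp xm) 1 t)"
proof -
  have "trig_poly x (- int (length xm)) t = cnj (trig_poly xm 1 t) + (of_int x0 + trig_poly xp 1 t)"
    using trig_poly_revapp[of xm "x0 # xp" 0 t] by (simp add: x_def)
  moreover have "trig_poly y (- int (length xm)) t = cnj (trig_poly ym 1 t) + (of_int y0 + trig_poly yp 1 t)"
    using trig_poly_revapp[of ym "y0 # yp" 0 t] len by (simp add: y_def)
  ultimately show ?thesis using D_pos by (simp add: z_def)
qed

text \<open>The parameter is chosen to cancel all constant terms. The budget of 2/10^8 is 1/10^9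
  from the symbol table, 8/10^9 from the coefficients checked in \<open>E\<close>, and at most 7/10
  * 156/10^10 from replacing exp(iX) by \<open>z\<close>.\<close>

lemma wiener_defect:
  "wiener_real (6/100) (circle_defect \<alpha> (2/5) (of_int e / 10) u (3/5 * \<alpha> - of_int e / 10 * (of_int y0 / of_int D))) (2/10^8)"
proof -
  let ?\<epsilon> = "of_int e / 10 :: real"
  let ?RE = "addl (smul 2 (addl (mull al us) (mull be ws))) (smul (- (e * T)) (addl yp ym))"
    and ?IM = "addl (smul 2 (subl (mull al ws) (mull be us))) (smul (e * T) (subl xp xm))"
  define F where "F t = 5 * of_int T * (P (t + \<alpha>) - 7/5 * P t + 2/5 * P (t - \<alpha>))
     - (trig_poly (addl (mull al us) (mull be ws)) 1 t + \<i> * trig_poly (subl (mull al ws) (mull be us)) 1 t)" for t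
  have T: "0 < (of_int T :: real)" using pos by simp
  have F: "wiener (6/100) F (\<delta> * of_int Ub / 4096)"
    using wiener_symbol_table[OF U(1) weights(4) table(1) len(4) table(2)] unfolding F_def[abs_def] P_def[abs_def] .
  have RE: "wiener (6/100) (\<lambda>t. trig_poly ?RE 1 t + \<i> * trig_poly ?IM 1 t) (of_int Eb / 4096)"
    by (rule wiener_wle[OF E(1) weights(4)]) simp
  define K where "K t = (1 / (10 * of_int T * of_int D)) * (2 * F t + (trig_poly ?RE 1 t + \<i> * trig_poly ?IM 1 t))" for t
  have "wiener (6/100) K (norm (1 / (10 * of_int T * of_int D) :: complex) * (norm (2 :: complex) * (\<delta> * of_int Ub / 4096) + of_int Eb / 4096))"
    unfolding K_def[abs_def] by (intro wiener_cmult wiener_add F RE) auto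
  moreover have "norm (1 / (10 * of_int T * of_int D) :: complex) * (norm (2 :: complex) * (\<delta> * of_int Ub / 4096) + of_int Eb / 4096) \<le> 9/10^9"
  proof -
    have "norm (1 / (10 * of_int T * of_int D) :: complex) * (norm (2 :: complex) * (\<delta> * of_int Ub / 4096) + of_int Eb / 4096)
       = (\<delta> / (5 * of_int T)) * (of_int Ub / 4096 / of_int D) + of_int Eb / (40960 * of_int T * of_int D)"
      using T D_pos by (simp add: norm_divide norm_mult field_simps)
    also have "(\<delta> / (5 * of_int T)) * (of_int Ub / 4096 / of_int D) \<le> (\<delta> / (5 * of_int T)) * (6/10)"
      using Ub_bound table(2) T by (intro mult_left_mono) auto
    also have "(\<delta> / (5 * of_int T)) * (6/10) \<le> 1/10^9"
      using table T by (simp add: field_simps)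
    also have "real_of_int (10^9 * Eb) \<le> of_int (8 * 40960 * T * D)" using E(2) by (simp only: of_int_le_iff)
    then have "of_int Eb / (40960 * of_int T * of_int D) \<le> (8/10^9 :: real)"
      using T D_pos by (simp add: field_simps)
    finally show ?thesis by simp
  qed
  ultimately have "wiener (6/100) K (9/10^9)" by (rule wiener_mono)
  then have K: "wiener_real (6/100) (\<lambda>t. Re (K t)) (9/10^9)" by (intro wiener_Re) auto
  have zz: "wiener_real (6/100) (\<lambda>t. ?\<epsilon> * Re (- \<i> * (z t - cis (t + u t)))) (\<bar>?\<epsilon>\<bar> * (norm (- \<i>) * (156/10^10)))"
    by (intro wiener_real_cmult wiener_Re wiener_cmult z_approx) auto
  have "wiener_real (6/100) (\<lambda>t. Re (K t) + ?\<epsilon> * Re (- \<i> * (z t - cis (t + u t)))) (9/10^9 + \<bar>?\<epsilon>\<bar> * (norm (- \<i>) * (156/10^10)))"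
    by (intro wiener_real_add K zz) auto
  note sum = this
  have eq: "Re (K t) + ?\<epsilon> * Re (- \<i> * (z t - cis (t + u t))) =
      circle_defect \<alpha> (2/5) ?\<epsilon> u (3/5 * \<alpha> - ?\<epsilon> * (of_int y0 / of_int D)) t" for t
  proof -
    have "2 * F t + (trig_poly ?RE 1 t + \<i> * trig_poly ?IM 1 t) = 10 * of_int T * (P (t + \<alpha>) - 7/5 * P t + 2/5 * P (t - \<alpha>))
        - of_int e * of_int T * (trig_poly (addl yp ym) 1 t - \<i> * trig_poly (subl xp xm) 1 t)"
      unfolding F_def trig_poly_addl[of "smul _ _"] trig_poly_smul by (simp add: algebra_simps)
    also have "Re \<dots> = 10 * of_int T * (Re (P (t + \<alpha>)) - 7/5 * Re (P t) + 2/5 * Re (P (t - \<alpha>)))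
        - of_int e * of_int T * (of_int D * Im (z t) - of_int y0)"
      unfolding Im_z by simp
    finally have 1: "Re (2 * F t + (trig_poly ?RE 1 t + \<i> * trig_poly ?IM 1 t)) = \<dots>" .
    have "Re (K t) = (1 / (10 * of_int T * of_int D)) * Re (2 * F t + (trig_poly ?RE 1 t + \<i> * trig_poly ?IM 1 t))"
    proof -
      have "Re (of_real r * w) = r * Re w" for r w by simp
      moreover have "K t = of_real (1 / (10 * of_int T * of_int D)) * (2 * F t + (trig_poly ?RE 1 t + \<i> * trig_poly ?IM 1 t))"
        unfolding K_def by simp
      ultimately show ?thesis by (simp only:)
    qed
    then have "Re (K t) = (Re (P (t + \<alpha>)) - 7/5 * Re (P t) + 2/5 * Re (P (t - \<alpha>))) / of_int D
        - ?\<epsilon> * (Im (z t) - of_int y0 / of_int D)"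
    proof -
      have "(1 / (10 * \<tau> * d)) * (10 * \<tau> * A - \<kappa> * \<tau> * (d * i - y)) = A / d - \<kappa> / 10 * (i - y / d)"
        if "0 < \<tau>" "0 < d" for \<tau> d A \<kappa> i y :: real
        using that by (simp add: field_simps)
      from this[OF T D_pos] show "Re (K t) = (1 / (10 * of_int T * of_int D)) * Re (2 * F t + (trig_poly ?RE 1 t + \<i> * trig_poly ?IM 1 t)) \<Longrightarrow> ?thesis"
        unfolding 1 by (simp only:)
    qed
    moreover have "(Re (P (t + \<alpha>)) - 7/5 * Re (P t) + 2/5 * Re (P (t - \<alpha>))) / of_int D = u (t + \<alpha>) - 7/5 * u t + 2/5 * u (t - \<alpha>)"
      unfolding u_def using D_pos by (simp add: field_simps)
    ultimately show ?thesis unfolding circle_defect_def by (simp add: algebra_simps)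
  qed
  have "9/10^9 + \<bar>?\<epsilon>\<bar> * (norm (- \<i>) * (156/10^10)) \<le> 2/10^8"
    using pos by simp
  then show ?thesis by (rule wiener_mono[OF sum[unfolded eq]])
qed

lemma initial_state:
  "kam_state \<alpha> (2/5) (of_int e / 10) 0 (u, 3/5 * \<alpha> - of_int e / 10 * (of_int y0 / of_int D))"
  unfolding kam_state_def prod.case
proof (rule exI[of _ a], intro conjI allI)
  show "(u has_real_derivative a t - 1) (at t)" "0 < a t" for t
    by (rule u_deriv, rule a_pos)
qed (use wiener_a wiener_inverse_a(2) wiener_V wiener_defect in simp_all)

lemma invariant_circle:
  assumes "\<And>k::int. k \<noteq> 0 \<Longrightarrow> 1 \<le> 7/10 * of_int \<bar>k\<bar> * norm (cis (of_int k * \<alpha>) - 1)"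
  obtains U c C where "wiener_real (3/100) U C" "\<And>t. circle_defect \<alpha> (2/5) (of_int e / 10) U c t = 0"
proof -
  obtain C where "wiener_real (6/100) u C" using wiener_u by blast
  then have w: "wiener_real (3/100) u C" by (rule wiener_mono_width) auto
  show ?thesis
    by (rule kam_iteration[OF _ _ _ _ assms initial_state w]) (use pos that in auto)
qed

end

section \<open>The golden mean\<close>

text \<open>Jordan's inequality: the sine is concave on this interval and lies above its
  chord.\<close>

lemma sin_ge_linear:
  assumes "0 \<le> x" "x \<le> pi / 2"
  shows "2 / pi * x \<le> sin x"
proof -
  have "convex_on {0..pi/2} (\<lambda>x. - sin x)"
  proof (rule f''_ge0_imp_convex)
    show "((\<lambda>x. - sin x) has_real_derivative - cos x) (at x)" for x :: real
      by (auto intro!: derivative_eq_intros)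
    show "((\<lambda>x. - cos x) has_real_derivative sin x) (at x)" for x :: real
      by (auto intro!: derivative_eq_intros)
    show "0 \<le> sin x" if "x \<in> {0..pi/2}" for x
      using that by (intro sin_ge_zero) auto
  qed simp
  from convex_onD[OF this, of "2 / pi * x" 0 "pi/2"] assms show ?thesis
    by (simp add: field_simps)
qed

lemma abs_sin_ge_linear:
  assumes "\<bar>x\<bar> \<le> pi / 2"
  shows "2 / pi * \<bar>x\<bar> \<le> \<bar>sin x\<bar>"
  using sin_ge_linear[of "\<bar>x\<bar>"] assms by (auto simp: abs_if split: if_splits)

text \<open>Infinite descent: the form is odd unless \<open>k\<close> and \<open>m\<close> are both
  even, and then both may be halved.\<close>

lemma golden_form_nonzero:
  fixes k m :: int
  assumes "m * m + k * m - k * k = 0"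
  shows "k = 0"
  using assms
proof (induction "nat \<bar>k\<bar>" arbitrary: k m rule: less_induct)
  case less
  show ?case
  proof (rule ccontr)
    assume "k \<noteq> 0"
    have "even (m * m + k * m - k * k)" using less(2) by simp
    then have "even m \<and> even k" by auto
    then obtain m' k' where mk: "m = 2 * m'" "k = 2 * k'" by (auto elim!: evenE)
    have "m' * m' + k' * m' - k' * k' = 0" using less(2) unfolding mk by (simp add: algebra_simps)
    then have "k' = 0" using less(1)[of k' m'] \<open>k \<noteq> 0\<close> mk by (auto simp: abs_mult)
    with mk \<open>k \<noteq> 0\<close> show False by simp
  qed
qed

text \<open>The golden mean \<open>\<omega>\<close> and its conjugate are the roots of \<open>X\<^sup>2 + X - 1\<close>, whose homogenised norm form
  takes nonzero integer values.\<close>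

lemma golden_diophantine:
  fixes k :: int
  assumes "k \<noteq> 0"
  shows "1 \<le> 7/10 * of_int \<bar>k\<bar> * norm (cis (of_int k * (2 * pi * ((sqrt 5 - 1) / 2))) - 1)"
proof -
  define \<omega> :: real where "\<omega> = (sqrt 5 - 1) / 2"
  define m where "m = round (of_int k * \<omega>)"
  define d where "d = of_int k * \<omega> - of_int m"
  have d: "\<bar>d\<bar> \<le> 1 / 2"
    using of_int_round_abs_le[of "of_int k * \<omega>"] by (simp add: d_def m_def abs_minus_commute)
  have s5: "sqrt 5 \<le> (2237/1000 :: real)" by (rule real_le_lsqrt) (auto simp: power2_eq_square)
  \<comment> \<open>The second factor is k \<omega>' - m for the conjugate root \<omega>' = \<omega>
    - \<open>sqrt 5\<close>, so the product is the norm form.\<close>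
  have "d * (d - of_int k * sqrt 5) = of_int (m * m + k * m - k * k)"
    unfolding d_def \<omega>_def by (simp add: field_simps power2_eq_square flip: power2_eq_square[of "sqrt 5"])
  moreover have "m * m + k * m - k * k \<noteq> 0" using golden_form_nonzero assms by blast
  then have "1 \<le> \<bar>m * m + k * m - k * k\<bar>" by linarith
  then have "(1::real) \<le> \<bar>of_int (m * m + k * m - k * k)\<bar>" by (metis of_int_1_le_iff of_int_abs)
  ultimately have 1: "1 \<le> \<bar>d\<bar> * \<bar>d - of_int k * sqrt 5\<bar>" by (simp only: abs_mult[symmetric])
  have k1: "1 \<le> (of_int \<bar>k\<bar> :: real)" using assms by linarith
  have "\<bar>d - of_int k * sqrt 5\<bar> \<le> \<bar>d\<bar> + of_int \<bar>k\<bar> * sqrt 5"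
    using abs_triangle_ineq4[of d "of_int k * sqrt 5"] by (simp add: abs_mult)
  also have "\<dots> \<le> 1/2 * of_int \<bar>k\<bar> + of_int \<bar>k\<bar> * (2237/1000)"
    using d k1 s5 by (intro add_mono mult_left_mono) auto
  finally have "\<bar>d - of_int k * sqrt 5\<bar> \<le> 2737/1000 * of_int \<bar>k\<bar>" by simp
  then have "\<bar>d\<bar> * \<bar>d - of_int k * sqrt 5\<bar> \<le> \<bar>d\<bar> * (2737/1000 * of_int \<bar>k\<bar>)"
    by (rule mult_left_mono) simp
  with 1 have dk: "1000/2737 \<le> \<bar>d\<bar> * of_int \<bar>k\<bar>" by simp
  have "norm (cis (of_int k * (2 * pi * \<omega>)) - 1) = 2 * \<bar>sin (pi * d)\<bar>"
  proof -
    have "cis (of_int k * (2 * pi * \<omega>)) = cis (2 * pi * d) * cis (2 * pi * of_int m)"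
      by (simp add: cis_mult d_def algebra_simps)
    also have "cis (2 * pi * of_int m) = 1" by simp
    finally show ?thesis
      using dist_exp_i_1[of "2 * pi * d"] by (simp add: cis_conv_exp)
  qed
  moreover have "2 / pi * \<bar>pi * d\<bar> \<le> \<bar>sin (pi * d)\<bar>"
    using d by (intro abs_sin_ge_linear) (simp add: abs_mult)
  then have "2 * \<bar>d\<bar> \<le> \<bar>sin (pi * d)\<bar>" by (simp add: abs_mult)
  ultimately have "4 * \<bar>d\<bar> \<le> norm (cis (of_int k * (2 * pi * \<omega>)) - 1)" by simp
  then have "7/10 * of_int \<bar>k\<bar> * (4 * \<bar>d\<bar>) \<le> 7/10 * of_int \<bar>k\<bar> * norm (cis (of_int k * (2 * pi * \<omega>)) - 1)"
    by (rule mult_left_mono) simp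
  \<comment> \<open>7/10 * 4 * 1000/2737 = 2800/2737; this is where the constant 7/10 comes
    from.\<close>
  moreover have "1 \<le> 7/10 * of_int \<bar>k\<bar> * (4 * \<bar>d\<bar>)" using dk by simp
  ultimately show ?thesis unfolding \<omega>_def by linarith
qed

section \<open>Certified values of the symbol\<close>

text \<open>Each row is a rounded product of the preceding one with (c1 + i s1)/T. In the scale T^2
  of such products, a tolerance T means an error of at most 1/T in each component.\<close>

fun rotation_table :: "int \<Rightarrow> int \<Rightarrow> int \<Rightarrow> int \<Rightarrow> int \<Rightarrow> int list \<Rightarrow> int list \<Rightarrow> bool" where
  "rotation_table T c1 s1 c s [] [] \<longleftrightarrow> True"
| "rotation_table T c1 s1 c s (c' # cs) (s' # ss) \<longleftrightarrow>
     \<bar>c * c1 - s * s1 - T * c'\<bar> \<le> T \<and> \<bar>c * s1 + s * c1 - T * s'\<bar> \<le> T \<and> rotation_table T c1 s1 c' s' cs ss"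
| "rotation_table _ _ _ _ _ _ _ \<longleftrightarrow> False"

lemma norm_mult_approx:
  fixes z w z1 w1 :: complex
  assumes "norm (z - w) \<le> E" "norm (z1 - w1) \<le> e" "norm z1 = 1" "norm z = 1" "E \<le> 1" "norm (w * w1 - w') \<le> r"
  shows "norm (z * z1 - w') \<le> E + 2 * e + r"
proof -
  have "z * z1 - w' = (z - w) * z1 + w * (z1 - w1) + (w * w1 - w')" by (simp add: algebra_simps)
  also have "norm \<dots> \<le> norm ((z - w) * z1) + norm (w * (z1 - w1)) + norm (w * w1 - w')"
    by (meson add_mono norm_triangle_ineq norm_triangle_mono order_refl)
  also have "\<dots> \<le> E + 2 * e + r"
  proof (intro add_mono)
    have "norm w \<le> norm z + norm (z - w)" by (metis norm_minus_commute norm_triangle_sub)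
    then have "norm w \<le> 2" using assms by linarith
    then show "norm (w * (z1 - w1)) \<le> 2 * e" unfolding norm_mult
      using assms by (intro mult_mono) auto
  qed (use assms in \<open>auto simp: norm_mult\<close>)
  finally show ?thesis .
qed

text \<open>Errors along the table add up to at most k (2 e + 2/T). For an entry c + i s the scaled
  symbol is 5 (c + i s) - 7 T + 2 (c - i s) = 7 (c - T) + 3 i s, and 5 + 2 = 7 is the amplification
  of the error.\<close>

lemma symbol_table_rotation:
  assumes "rotation_table T c1 s1 c s cs ss" "0 < T"
    and e: "norm (cis \<alpha> - Complex (of_int c1 / of_int T) (of_int s1 / of_int T)) \<le> e"
    and E: "norm (cis (of_int (k - 1) * \<alpha>) - Complex (of_int c / of_int T) (of_int s / of_int T)) \<le> of_int (k - 1) * (2 * e + 2 / of_int T)"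
    and small: "of_int (k - 1 + int (length cs)) * (2 * e + 2 / of_int T) \<le> M" "M \<le> 1"
  shows "symbol_table \<alpha> T (7 * of_int T * M) (map (\<lambda>c. 7 * (c - T)) cs) (map (\<lambda>s. 3 * s) ss) k"
  using assms
proof (induction T c1 s1 c s cs ss arbitrary: k rule: rotation_table.induct)
  case (2 T c1 s1 c s c' cs s' ss)
  have T: "0 < (of_int T :: real)" using 2(3) by simp
  let ?w = "Complex (of_int c / of_int T) (of_int s / of_int T)"
  let ?w1 = "Complex (of_int c1 / of_int T) (of_int s1 / of_int T)"
  let ?w' = "Complex (of_int c' / of_int T) (of_int s' / of_int T)"
  have e0: "0 \<le> e" using order_trans[OF norm_ge_zero 2(4)] .
  then have \<eta>: "0 \<le> 2 * e + 2 / of_int T" using T by simp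
  have kM: "of_int j * (2 * e + 2 / of_int T) \<le> M" if "j \<le> k + int (length cs)" for j
  proof -
    have "of_int j * (2 * e + 2 / of_int T) \<le> of_int (k + int (length cs)) * (2 * e + 2 / of_int T)"
      using that \<eta> by (intro mult_right_mono) auto
    then show ?thesis using 2(6) by simp
  qed
  have r: "norm (?w * ?w1 - ?w') \<le> 2 / of_int T"
  proof -
    have a: "\<bar>c * c1 - s * s1 - T * c'\<bar> \<le> T" "\<bar>c * s1 + s * c1 - T * s'\<bar> \<le> T" using 2(2) by auto
    have "?w * ?w1 - ?w' = Complex (of_int (c * c1 - s * s1 - T * c') / (of_int T * of_int T)) (of_int (c * s1 + s * c1 - T * s') / (of_int T * of_int T))"
      using T by (simp add: complex_eq_iff field_simps)
    also have "norm \<dots> \<le> \<bar>of_int (c * c1 - s * s1 - T * c') / (of_int T * of_int T)\<bar> + \<bar>of_int (c * s1 + s * c1 - T * s') / (of_int T * of_int T)\<bar>"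
      by (rule order_trans[OF cmod_le]) simp
    also have "\<dots> = of_int \<bar>c * c1 - s * s1 - T * c'\<bar> / (of_int T * of_int T) + of_int \<bar>c * s1 + s * c1 - T * s'\<bar> / (of_int T * of_int T)"
      using T by (simp add: abs_divide abs_mult)
    also have "\<dots> \<le> of_int T / (of_int T * of_int T) + of_int T / (of_int T * of_int T)"
      using a T by (intro add_mono divide_right_mono) (simp_all only: of_int_le_iff, simp_all)
    finally show ?thesis using T by simp
  qed
  have "norm (cis (of_int (k - 1) * \<alpha>) * cis \<alpha> - ?w') \<le> of_int (k - 1) * (2 * e + 2 / of_int T) + 2 * e + 2 / of_int T"
    using kM[of "k - 1"] 2(7) by (intro norm_mult_approx[OF 2(5,4) _ _ _ r]) auto
  also have "cis (of_int (k - 1) * \<alpha>) * cis \<alpha> = cis (of_int k * \<alpha>)" by (simp add: cis_mult algebra_simps)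
  also have "of_int (k - 1) * (2 * e + 2 / of_int T) + 2 * e + 2 / of_int T = of_int k * (2 * e + 2 / of_int T)"
    using T by (simp add: field_simps)
  finally have k: "norm (cis (of_int k * \<alpha>) - ?w') \<le> of_int k * (2 * e + 2 / of_int T)" .
  have "symbol_table \<alpha> T (7 * of_int T * M) (map (\<lambda>c. 7 * (c - T)) cs) (map (\<lambda>s. 3 * s) ss) (k + 1)"
    using 2(2,3,4,6,7) k by (intro 2(1)) (auto simp: algebra_simps)
  moreover have "norm (5 * of_int T * (cis (of_int k * \<alpha>) - 7/5 + 2/5 * cis (of_int k * - \<alpha>)) - (of_int (7 * (c' - T)) + \<i> * of_int (3 * s')))
      \<le> 7 * of_int T * M"
  proof -
    let ?d = "cis (of_int k * \<alpha>) - ?w'"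
    have "5 * of_int T * (cis (of_int k * \<alpha>) - 7/5 + 2/5 * cis (of_int k * - \<alpha>)) - (of_int (7 * (c' - T)) + \<i> * of_int (3 * s'))
        = of_int T * (5 * ?d + 2 * cnj ?d)"
      using T by (auto simp: complex_eq_iff field_simps)
    also have "norm \<dots> = of_int T * norm (5 * ?d + 2 * cnj ?d)" using T by (simp add: norm_mult)
    also have "\<dots> \<le> of_int T * (norm (5 * ?d) + norm (2 * cnj ?d))"
      using T by (intro mult_left_mono norm_triangle_ineq) auto
    also have "\<dots> = 7 * of_int T * norm ?d" by (simp only: norm_mult complex_mod_cnj norm_numeral) simp
    also have "\<dots> \<le> 7 * of_int T * M" using k kM[of k] T by (intro mult_left_mono) auto
    finally show ?thesis .
  qed
  ultimately show ?case by simp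
qed auto


lemma norm_diff_triangle: "norm (a - c) \<le> norm (a - b) + norm (b - c)" for a b c :: complex
  using norm_triangle_ineq[of "a - b" "b - c"] by simp

lemma norm_cis_diff_le: "norm (cis x - cis y) \<le> \<bar>x - y\<bar>"
proof -
  have "cis x - cis y = cis y * (cis (x - y) - 1)" by (simp add: right_diff_distrib cis_mult)
  then have "norm (cis x - cis y) = 2 * \<bar>sin ((x - y) / 2)\<bar>"
    using dist_exp_i_1[of "x - y"] by (simp add: norm_mult cis_conv_exp)
  also have "\<dots> \<le> 2 * \<bar>(x - y) / 2\<bar>" by (intro mult_left_mono abs_sin_x_le_abs_x) auto
  finally show ?thesis by simp
qed

lemma cis_double_approx:
  assumes "norm (cis x - w) \<le> e" "e \<le> 1/100" "norm (w * w - w') \<le> r"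
  shows "norm (cis (2 * x) - w') \<le> 201/100 * e + r"
proof -
  have "cis (2 * x) - w' = (cis x + w) * (cis x - w) + (w * w - w')"
    using cis_mult[of x x] by (simp add: algebra_simps)
  also have "norm \<dots> \<le> norm ((cis x + w) * (cis x - w)) + norm (w * w - w')" by (rule norm_triangle_ineq)
  also have "norm ((cis x + w) * (cis x - w)) \<le> 201/100 * e"
    unfolding norm_mult
  proof (intro mult_mono)
    have "cis x + w = 2 * cis x - (cis x - w)" by simp
    then have "norm (cis x + w) \<le> norm (2 * cis x) + norm (cis x - w)" by (metis norm_triangle_ineq4)
    then show "norm (cis x + w) \<le> 201/100" using assms by (simp add: norm_mult)
  qed (use assms in auto)
  finally show ?thesis using assms(3) by linarith
qed

lemma cos_taylor_12: "(\<Sum>m<12. cos_coeff m * x ^ m) = 1 - x^2/2 + x^4/24 - x^6/720 + x^8/40320 - x^10/3628800"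
  by (simp add: cos_coeff_def lessThan_nat_numeral fact_numeral algebra_simps)

lemma sin_taylor_13: "(\<Sum>m<13. sin_coeff m * x ^ m) = x - x^3/6 + x^5/120 - x^7/5040 + x^9/362880 - x^11/39916800"
  by (simp add: sin_coeff_def lessThan_nat_numeral fact_numeral algebra_simps)

lemma norm_Complex_square_le:
  assumes "\<bar>a * a - b * b - c\<bar> \<le> e" "\<bar>2 * a * b - d\<bar> \<le> e"
  shows "norm (Complex a b * Complex a b - Complex c d) \<le> 2 * e"
proof -
  have "norm (Complex a b * Complex a b - Complex c d) \<le> \<bar>a * a - b * b - c\<bar> + \<bar>2 * a * b - d\<bar>"
    by (rule order_trans[OF cmod_le]) (simp add: algebra_simps)
  with assms show ?thesis by linarith
qed

text \<open>\<open>2\<pi>\<omega> = 2\<pi> - 8\<theta>\<close> with \<open>\<theta> = \<pi>(3 - \<surd>5)/8\<close> close to \<open>3/10\<close>, where the Taylor series converge quickly.\<close>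

lemma cis_golden_approx:
  "norm (cis (2 * pi * ((sqrt 5 - 1) / 2)) - Complex (of_int (-202686413852) / of_int (2^38)) (of_int (-185677358248) / of_int (2^38))) \<le> 6 / 10^12" (is "norm (_ - ?w) \<le> _")
proof -
  define \<theta> where "\<theta> = pi * (3 - sqrt 5) / 8"
  have s5: "22360679774997 / 10^13 \<le> sqrt 5" "sqrt 5 \<le> 22360679774998 / 10^13"
    by (rule real_le_rsqrt, simp add: power2_eq_square) (rule real_le_lsqrt, simp_all add: power2_eq_square)
  have "\<theta> \<le> 3.1415926535899 * (3 - 22360679774997 / 10^13) / 8"
    unfolding \<theta>_def using s5 pi_approx by (intro divide_right_mono mult_mono) auto
  moreover have "3.141592653588 * (3 - 22360679774998 / 10^13) / 8 \<le> \<theta>"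
    unfolding \<theta>_def using s5 pi_approx by (intro divide_right_mono mult_mono) auto
  ultimately have \<theta>: "\<bar>\<theta> - (0.29999540371608)\<bar> \<le> 175 / 10^15" by (intro abs_leI) simp_all
  let ?x = "0.29999540371608 :: real"
  obtain t where t: "cos ?x = (\<Sum>m<12. cos_coeff m * ?x ^ m) + (cos (t + 1/2 * real 12 * pi) / fact 12) * ?x ^ 12"
    using Maclaurin_cos_expansion[of ?x 12] by blast
  have "\<bar>cos (t + 1/2 * real 12 * pi) / fact 12 * ?x ^ 12\<bar> = \<bar>cos (t + 1/2 * real 12 * pi)\<bar> * (?x ^ 12 / fact 12)"
    by (simp add: abs_mult)
  also have "\<dots> \<le> 1 * (?x ^ 12 / fact 12)" by (intro mult_right_mono abs_cos_le_one) simp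
  also have "\<dots> \<le> 1 / 10^14" by (simp add: fact_numeral power_divide)
  finally have "\<bar>cos ?x - (\<Sum>m<12. cos_coeff m * ?x ^ m)\<bar> \<le> 1 / 10^14" using t by simp
  moreover have "\<bar>(\<Sum>m<12. cos_coeff m * ?x ^ m) - 95533784741029 / 10^14\<bar> \<le> 1 / 10^14"
    unfolding cos_taylor_12 by (intro abs_leI) (simp_all add: power_divide)
  ultimately have c: "\<bar>cos ?x - 95533784741029 / 10^14\<bar> \<le> 2 / 10^14" by linarith
  have "\<bar>sin ?x - (\<Sum>m<13. sin_coeff m * ?x ^ m)\<bar> \<le> inverse (fact 13) * \<bar>?x\<bar> ^ 13"
    by (rule Maclaurin_sin_bound)
  also have "\<dots> \<le> 1 / 10^14" by (simp add: fact_numeral power_divide)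
  finally have "\<bar>sin ?x - (\<Sum>m<13. sin_coeff m * ?x ^ m)\<bar> \<le> 1 / 10^14" .
  moreover have "\<bar>(\<Sum>m<13. sin_coeff m * ?x ^ m) - 29551581566048 / 10^14\<bar> \<le> 1 / 10^14"
    unfolding sin_taylor_13 by (intro abs_leI) (simp_all add: power_divide)
  ultimately have s: "\<bar>sin ?x - 29551581566048 / 10^14\<bar> \<le> 2 / 10^14" by linarith
  have "norm (cis ?x - Complex (95533784741029 / 10^14) (29551581566048 / 10^14)) \<le> \<bar>cos ?x - 95533784741029 / 10^14\<bar> + \<bar>sin ?x - 29551581566048 / 10^14\<bar>"
    by (rule order_trans[OF cmod_le]) simp
  then have "norm (cis ?x - Complex (95533784741029 / 10^14) (29551581566048 / 10^14)) \<le> 4 / 10^14" using c s by simp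
  moreover have "norm (cis \<theta> - Complex (95533784741029 / 10^14) (29551581566048 / 10^14)) \<le> norm (cis \<theta> - cis ?x) + norm (cis ?x - Complex (95533784741029 / 10^14) (29551581566048 / 10^14))"
    by (rule norm_diff_triangle)
  ultimately have 1: "norm (cis \<theta> - Complex (95533784741029 / 10^14) (29551581566048 / 10^14)) \<le> 25 / 10^14"
    using norm_cis_diff_le[of \<theta> ?x] \<theta> by simp
  \<comment> \<open>Each of the three doublings slightly more than doubles the error; the last step,
    rounding to multiples of 2^(-38), adds at most 3/10^12.\<close>
  have 2: "norm (cis (2 * \<theta>) - Complex (82534080538905 / 10^14) (56463488641755 / 10^14)) \<le> 201/100 * (25 / 10^14) + 2 * (1 / 10^14)"
    by (rule cis_double_approx[OF 1 _ norm_Complex_square_le]) (auto simp: abs_le_iff)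
  have 3: "norm (cis (2 * (2 * \<theta>)) - Complex (36237489008048 / 10^14) (93203242381323 / 10^14)) \<le> 201/100 * (201/100 * (25 / 10^14) + 2 * (1 / 10^14)) + 2 * (1 / 10^14)"
    by (rule cis_double_approx[OF 2 _ norm_Complex_square_le]) (auto simp: abs_le_iff)
  have 4: "norm (cis (2 * (2 * (2 * \<theta>))) - Complex (-73736887807832 / 10^14) (67549029426152 / 10^14)) \<le> 201/100 * (201/100 * (201/100 * (25 / 10^14) + 2 * (1 / 10^14)) + 2 * (1 / 10^14)) + 2 * (1 / 10^14)"
    by (rule cis_double_approx[OF 3 _ norm_Complex_square_le]) (auto simp: abs_le_iff)
  have "2 * pi * ((sqrt 5 - 1) / 2) = - (2 * (2 * (2 * \<theta>))) + 2 * pi"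
    by (simp add: \<theta>_def field_simps)
  then have "cis (2 * pi * ((sqrt 5 - 1) / 2)) = cnj (cis (2 * (2 * (2 * \<theta>))))"
    using cis_mult[of "- (2 * (2 * (2 * \<theta>)))" "2 * pi"] by (simp only: cis_cnj cis_2pi mult_1_right)
  then have 5: "norm (cis (2 * pi * ((sqrt 5 - 1) / 2)) - cnj (Complex (-73736887807832 / 10^14) (67549029426152 / 10^14))) \<le> 201/100 * (201/100 * (201/100 * (25 / 10^14) + 2 * (1 / 10^14)) + 2 * (1 / 10^14)) + 2 * (1 / 10^14)"
    using 4 by (metis complex_cnj_diff complex_mod_cnj)
  have "norm (cnj (Complex (-73736887807832 / 10^14) (67549029426152 / 10^14)) - ?w) \<le> 3 / 10^12"
    by (rule order_trans[OF cmod_le]) (simp add: abs_le_iff)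
  moreover have "norm (cis (2 * pi * ((sqrt 5 - 1) / 2)) - ?w) \<le>
      norm (cis (2 * pi * ((sqrt 5 - 1) / 2)) - cnj (Complex (-73736887807832 / 10^14) (67549029426152 / 10^14))) + norm (cnj (Complex (-73736887807832 / 10^14) (67549029426152 / 10^14)) - ?w)"
    by (rule norm_diff_triangle)
  ultimately show ?thesis using 5 by simp
qed

text \<open>The 43 entries cover the frequencies of the longest start, that for \<epsilon> =
  7/10.\<close>

definition golden_cos :: "int list" where
  "golden_cos = [- 202686413852, 24031400223, 167246400610, - 270675981785, 231929689413, - 71359487965,
     - 126693158252, 258198671886, - 254082171767, 116505899985, 82266522244, - 237827446407,
     268466592423, - 158090373706, - 35324749434, 210185115424, - 274643176064, 194841545788,
     - 12697007977, - 176116788735, 272423085817, - 225635821568, 60330579390, 136664038291,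
     - 261874196567, 249531726750, - 106119662230, - 93033054190, 243319019814, - 265798691121,
     148664345519, 46557767791, - 217324843523, 273939384304, - 186663909408, 1340930611, 184686388408,
     - 273704920645, 218956592113, - 49198632703, - 146401510916, 265102468409, - 244555108497]"

definition golden_sin :: "int list" where
  "golden_sin = [- 185677358248, 273825410672, - 218143313465, 47878769948, 147534683706, - 265453738352,
     243939966754, - 94293740855, - 104881426946, 248966341092, - 262278636275, 137825866456,
     59021627238, - 224867288574, 272598653347, - 177144237794, - 11357357587, 193893361839,
     - 274584503785, 211046773148, - 36654140891, - 156991527657, 268175474124, - 238496969308,
     83545011244, 115289986889, - 253567507816, 258655590622, - 127881657515, - 70063681965,
     231207214645, - 270906326968, 168308574116, 22695318035, - 201778216511, 274874636224,
     - 203589787738, 25366910521, 166180247037, - 270439195154, 232646644801, - 72653595777,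
     - 125501643989]"

text \<open>The numbers 7 (c - 2^38) for c in \<open>golden_cos\<close>, written out so that the
  certificates start from literals.\<close>

definition symbol_re :: "int list" where
  "symbol_re = [- 3342950245572, - 1755925547047, - 753420544338, - 3818877221103, - 300637522717, - 2423661764363,
     - 2810997456372, - 116754645406, - 3702720550977, - 1108604048713, - 1348279692900,
     - 3588937473457, - 44879201647, - 3030777964550, - 2171418594646, - 452849540640, - 3846647581056,
     - 560254528092, - 2013024404447, - 3156962869753, - 17183747889, - 3503596099584, - 1501831292878,
     - 967497080571, - 3757264724577, - 177423261358, - 2666982984218, - 2575376727938, - 220912209910,
     - 3784736186455, - 883494929975, - 1598240974071, - 3445419253269, - 6569658480, - 3230792714464,
     - 1914758834331, - 631340629752, - 3840079793123, - 391449203817, - 2268535777529, - 2948955925020,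
     - 68428069745, - 3636031108087]"

definition symbol_im :: "int list" where
  "symbol_im = [- 557032074744, 821476232016, - 654429940395, 143636309844, 442604051118, - 796361215056,
     731819900262, - 282881222565, - 314644280838, 746899023276, - 786835908825, 413477599368,
     177064881714, - 674601865722, 817795960041, - 531432713382, - 34072072761, 581680085517,
     - 823753511355, 633140319444, - 109962422673, - 470974582971, 804526422372, - 715490907924,
     250635033732, 345869960667, - 760702523448, 775966771866, - 383644972545, - 210191045895,
     693621643935, - 812718980904, 504925722348, 68085954105, - 605334649533, 824623908672,
     - 610769363214, 76100731563, 498540741111, - 811317585462, 697939934403, - 217960787331,
     - 376504931967]"

definition weight_list :: "int list" where
  "weight_list = [4352, 4624, 4913, 5221, 5548, 5895, 6264, 6656, 7072, 7514, 7984, 8483, 9014, 9578, 10177, 10814,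
     11490, 12209, 12973, 13784, 14646, 15562, 16535, 17569, 18668, 19835, 21075, 22393, 23793, 25281,
     26862, 28541, 30325, 32221, 34235, 36375, 38649, 41065, 43632, 46359, 49257, 52336, 55607, 59083,
     62776, 66700, 70869, 75299, 80006, 85007, 90320, 95965, 101963, 108336, 115107, 122302, 129946,
     138068, 146698, 155867, 165609, 175960, 186958, 198643, 211059, 224251, 238267, 253159, 268982,
     285794, 303657, 322636, 342801, 364227, 386992, 411179, 436878, 464183, 493195, 524020, 556772,
     591571, 628545, 667830, 709570, 753919, 801039, 851104, 904298, 960817, 1020869, 1084674, 1152467,
     1224497, 1301029, 1382344, 1468741, 1560538, 1658072, 1761702, 1871809, 1988798]"

fun weight_chain :: "int \<Rightarrow> int list \<Rightarrow> bool" where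
  "weight_chain w [] \<longleftrightarrow> True"
| "weight_chain w (w' # ws) \<longleftrightarrow> 17 * w \<le> 16 * w' \<and> weight_chain w' ws"

text \<open>Comparing neighbours in the ratio 17 : 16 replaces powers of 17/16 by integer
  inequalities.\<close>

lemma weights_weight_chain:
  "weight_chain w ws \<Longrightarrow> 0 \<le> k \<Longrightarrow> 4096 * (17/16) ^ nat k \<le> (of_int w :: real) \<Longrightarrow> weights ws (k + 1)"
proof (induction w ws arbitrary: k rule: weight_chain.induct)
  case (2 w w' ws)
  have "nat (k + 1) = Suc (nat k)" using 2 by simp
  then have "4096 * (17/16) ^ nat (k + 1) = (17/16) * (4096 * (17/16) ^ nat k :: real)" by simp
  also have "\<dots> \<le> (17/16) * of_int w" using 2 by (intro mult_left_mono) auto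
  also have "\<dots> \<le> of_int w'"
  proof -
    have "17 * w \<le> 16 * w'" using 2 by simp
    then have "real_of_int (17 * w) \<le> of_int (16 * w')" by (simp only: of_int_le_iff)
    then show ?thesis by simp
  qed
  finally have "4096 * (17/16) ^ nat (k + 1) \<le> (of_int w' :: real)" .
  moreover from this 2 have "weights ws (k + 1 + 1)" by (intro 2(1)) auto
  ultimately show ?case using 2(3) by simp
qed simp

lemma weights_weight_list: "weights (4096 # weight_list) 0"
proof -
  have "weight_chain 4096 weight_list" by (simp add: weight_list_def)
  from weights_weight_chain[OF this, of 0] show ?thesis by simp
qed

text \<open>43 (12/10^12 + 2/2^38) \<le> 11/10^10, and 7 * 11/10^10 stays below the 8/10^9 that a
  certificate tolerates.\<close>

lemma symbol_table_golden:
  "symbol_table (2 * pi * ((sqrt 5 - 1) / 2)) (2^38) (7 * of_int (2^38) * (11/10^10)) symbol_re symbol_im 1"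
proof -
  have "rotation_table (2^38) (-202686413852) (-185677358248) (2^38) 0 golden_cos golden_sin"
    by (simp add: golden_cos_def golden_sin_def)
  moreover have "length golden_cos = 43" by (simp add: golden_cos_def)
  moreover have "symbol_re = map (\<lambda>c. 7 * (c - 2^38)) golden_cos"
    by (simp add: symbol_re_def golden_cos_def)
  moreover have "symbol_im = map (\<lambda>s. 3 * s) golden_sin"
    by (simp add: symbol_im_def golden_sin_def)
  ultimately show ?thesis
    using symbol_table_rotation[of "2^38" "-202686413852" "-185677358248" "2^38" 0 golden_cos golden_sin
        "2 * pi * ((sqrt 5 - 1) / 2)" "6/10^12" 1 "11/10^10"] cis_golden_approx
    by (simp add: complex_eq_iff one_complex.ctr[symmetric])
qed

definition golden_circle :: "real \<Rightarrow> bool" where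
  "golden_circle \<epsilon> \<longleftrightarrow> (\<exists>U c C. wiener_real (3/100) U C \<and>
     (\<forall>t. circle_defect (2 * pi * ((sqrt 5 - 1) / 2)) (2/5) \<epsilon> U c t = 0))"

text \<open>The abbreviations of the locale are expanded and its fixed tables inserted, so that for
  concrete lists every hypothesis becomes a closed statement of integer arithmetic.\<close>

lemma golden_certificate:
  fixes D Db e xc yc bc m :: int
  assumes pos: "0 < D" "0 < Db" "0 \<le> e" "e \<le> 7"
    and m: "m = int (length xm)"
    and len: "length be = length al" "length ym = length xm" "length hb = length gb" "length al \<le> length symbol_re"
    and A: "wle (wrev al weight_list (4096 # weight_list)) (revapp (derl be 1) (2 * D # derl be 1))
        (revapp (smul (-1) (derl al 1)) (0 # derl al 1)) Ab" "100 * Ab \<le> 208 * 8192 * D"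
    and B: "wle (wrev gb weight_list (4096 # weight_list)) (revapp gb (bc # gb)) (revapp (smul (-1) hb) (0 # hb)) Bb"
      "100 * Bb \<le> 195 * 4096 * Db"
    and Q: "wle (wrev (zpad al gb) weight_list (4096 # weight_list))
        (subl (subl (pmul (revapp gb (bc # gb)) (revapp (derl be 1) (2 * D # derl be 1)))
            (pmul (revapp (smul (-1) hb) (0 # hb)) (revapp (smul (-1) (derl al 1)) (0 # derl al 1)))) (zpad al (zpad gb [2 * D * Db])))
        (addl (pmul (revapp gb (bc # gb)) (revapp (smul (-1) (derl al 1)) (0 # derl al 1)))
            (pmul (revapp (smul (-1) hb) (0 # hb)) (revapp (derl be 1) (2 * D # derl be 1)))) Qb" "100 * Qb \<le> 8192 * D * Db"
    and U: "wle weight_list al be Ub" "10 * Ub \<le> 6 * 4096 * D"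
    and init: "sum_list (revapp xm (xc # xp)) = D" "sum_list (revapp ym (yc # yp)) = 0"
    and R: "wle (wrev (zpad al xm) weight_list (4096 # weight_list))
        (subl (zpad al (smul (2 * D) (derl (revapp xm (xc # xp)) (- m))))
          (subl (pmul (revapp (derl be 1) (2 * D # derl be 1)) (revapp xm (xc # xp)))
            (pmul (revapp (smul (-1) (derl al 1)) (0 # derl al 1)) (revapp ym (yc # yp)))))
        (subl (zpad al (smul (2 * D) (derl (revapp ym (yc # yp)) (- m))))
          (addl (pmul (revapp (derl be 1) (2 * D # derl be 1)) (revapp ym (yc # yp)))
            (pmul (revapp (smul (-1) (derl al 1)) (0 # derl al 1)) (revapp xm (xc # xp))))) Rb"
      "10^9 * Rb \<le> 2 * 8192 * D * D"
    and E: "wle weight_list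
        (addl (smul 2 (addl (mull al symbol_re) (mull be symbol_im))) (smul (- (e * 2^38)) (addl yp ym)))
        (addl (smul 2 (subl (mull al symbol_im) (mull be symbol_re))) (smul (e * 2^38) (subl xp xm))) Eb"
      "10^9 * Eb \<le> 8 * 40960 * 2^38 * D"
    and \<epsilon>: "\<epsilon> = of_int e / 10"
  shows "golden_circle \<epsilon>"
proof -
  have "circle_certificate D (2^38) Db e xc yc bc m al be xm xp ym yp gb hb symbol_re symbol_im (derl be 1) (derl al 1)
      (revapp (derl be 1) (2 * D # derl be 1)) (revapp (smul (-1) (derl al 1)) (0 # derl al 1))
      (revapp xm (xc # xp)) (revapp ym (yc # yp)) (revapp gb (bc # gb)) (revapp (smul (-1) hb) (0 # hb)) weight_list
      Ab Bb Qb Ub Rb Eb (2 * pi * ((sqrt 5 - 1) / 2)) (7 * of_int (2^38) * (11/10^10))"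
    by (rule circle_certificate.intro[OF refl refl refl refl refl refl refl refl pos(1) _ pos(2-) m len
          weights_weight_list A B Q U init R E symbol_table_golden]) simp_all
  from circle_certificate.invariant_circle[OF this golden_diophantine]
  show ?thesis unfolding golden_circle_def \<epsilon> by blast
qed

lemma length_eval:
  "length [] = length [] \<longleftrightarrow> True" "length (x # xs) = length (y # ys) \<longleftrightarrow> length xs = length ys"
  "length [] \<le> length ys \<longleftrightarrow> True" "length (x # xs) \<le> length (y # ys) \<longleftrightarrow> length xs \<le> length ys"
  "int (length []) = 0" "int (length (x # xs)) = 1 + int (length xs)"
  by simp_all

text \<open>List recursion together with binary arithmetic on numerals: the rewrite rules by which
  closed certificates are evaluated.\<close>

lemmas certificate_eval = length_eval

  wle.simps wrev.simps subl.simps addl.simps pmul.simps smul.simps mull.simps derl.simps zpad.simps revapp.simps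
  weight_list_def symbol_re_def symbol_im_def
  arith_simps rel_simps abs_numeral abs_neg_numeral abs_zero abs_one add_0_left add_0_right mult_zero_left mult_zero_right
  mult_1_left mult_1_right mult_minus_left mult_minus_right minus_minus power_numeral Num.pow.simps Num.sqr.simps
  diff_0 diff_0_right minus_zero arith_special abs_neg_one inc.simps BitM.simps sum_list.Nil sum_list.Cons

section \<open>Approximate solutions\<close>

text \<open>In all seven certificates \<open>e\<close> is 10 \<epsilon> and \<open>D\<close> is ten
  times a power of 2. The approximate inverse of \<open>a\<close> needs only an error of 1/100,
  hence the coarse \<open>Db\<close>, \<open>gb\<close>, \<open>hb\<close>; the values
  \<open>Ab\<close> to \<open>Eb\<close> are budgets for the weighted sums. From \<epsilon> = 1/10
  to 7/10 the number of harmonics grows as 6, 9, 12, 16, 22, 29, 43.\<close>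

lemma circle_1:
  "golden_circle (1 / 10)"
proof (rule golden_certificate[where e = 1 and D = 42949672960 and Db = 256 and m = 6
      and xc = "859550761" and yc = "142639574" and bc = "256"
      and al = "[298543266, 15665049, 2972454, - 49144, - 14310, - 17]"
      and be = "[- 1716158072, 59815566, - 4387068, 105084, - 27788, 973]"
      and xm = "[- 21553115, 1632420, - 10434, 11568, - 153, - 15]"
      and xp = "[42930820082, - 856204039, 38192488, - 2856944, 106713, - 17255, 908, - 25]"
      and ym = "[10948520, 1556066, 7202, - 8194, - 41, 4]"
      and yp = "[- 316976723, 155825853, 4587717, 1483542, - 58146, - 5340, - 33, - 1]"
      and gb = "[5]"
      and hb = "[- 1]"
      and Ab = 371001562203572 and Bb = 1100800 and Qb = 594460012556824 and Ub = 9154204538464 and Rb = 28752993141578624 and Eb = 1787288217565166484],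
    goal_cases)
qed (simp_all only: certificate_eval)

lemma circle_2:
  "golden_circle (2 / 10)"
proof (rule golden_certificate[where e = 2 and D = 85899345920 and Db = 512 and m = 9
      and xc = "3444451359" and yc = "564704588" and bc = "514"
      and al = "[1251533263, 114872333, 49500850, - 1666704, - 834656, - 9100, - 1285, - 9782, 395]"
      and be = "[- 6856415412, 483344646, - 68893747, 3339647, - 1824012, 124455, - 11123, 4440, - 209]"
      and xm = "[- 175371701, 25638252, - 373142, 761427, - 19407, 1662, - 1562, 21, 16]"
      and xp = "[85745683275, - 3405274452, 306311390, - 44765336, 3319488, - 1122055, 115606, - 11929, 3235, - 249,
     24, - 2]"
      and ym = "[84463198, 25343595, 255245, - 497641, - 6301, 250, - 4782, - 21, 13]"
      and yp = "[- 1410761629, 685331467, 28088879, 25398274, - 2017821, - 280574, - 11693, - 394, - 5071, 439,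
     - 25, 4]"
      and gb = "[20, - 2]"
      and hb = "[- 4, - 1]"
      and Ab = 789182419672562 and Bb = 2341984 and Qb = 2708583517867426 and Ub = 38675473011749 and Rb = 113062318598457471 and Eb = 3559632204838234178],
    goal_cases)
qed (simp_all only: certificate_eval)

lemma circle_3:
  "golden_circle (3 / 10)"
proof (rule golden_certificate[where e = 3 and D = 343597383680 and Db = 512 and m = 13
      and xc = "20732716919" and yc = "3333096174" and bc = "516"
      and al = "[7920061469, 910020235, 699794043, - 35857771, - 22243474, - 808855, 9166, - 1045061, 64109,
     - 13322, 4981, - 448]"
      and be = "[- 41084040154, 4410355627, - 908235887, 67348850, - 57027135, 5643784, - 783592, 364247, - 26232,
     20305, - 1628, 320]"
      and xm = "[- 1618575935, 338273132, - 8886139, 23908019, - 866790, 125344, - 121088, 4090, - 6933, 438, - 66,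
     - 52, 2]"
      and xp = "[342179226195, - 20257091561, 2761434118, - 587385223, 64591480, - 34611934, 5204832, - 816046,
     277562, - 30017, 14717, - 1620, 293, - 63, 6]"
      and ym = "[719056403, 349020072, 6028760, - 14086716, - 351666, 58521, - 502597, - 2784, - 2999, 1218, - 5,
     - 72, 7]"
      and yp = "[- 9428967993, 4562432125, 156801224, 369663163, - 44645810, - 6204523, - 950687, 48809, - 552697,
     71383, - 13190, 4414, - 629, 116, - 21]"
      and gb = "[30, - 5, 1]"
      and hb = "[- 6, - 2, - 2]"
      and Ab = 3396491251169472 and Bb = 2521094 and Qb = 13992344314470050 and Ub = 246799489745342 and Rb = 1532003159355445668 and Eb = 16097737531450969760],
    goal_cases)
qed (simp_all only: certificate_eval)

lemma circle_4:
  "golden_circle (4 / 10)"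
proof (rule golden_certificate[where e = 4 and D = 687194767360 and Db = 4096 and m = 17
      and xc = "55553113777" and yc = "8701044925" and bc = "4153"
      and al = "[22436404146, 2675533243, 3492756610, - 242057723, - 154505478, - 14581123, 2070483, - 21712789,
     1799673, - 577141, 247081, - 30551, 7352, - 5643, 875, - 2470]"
      and be = "[- 109393408262, 15946995362, - 4179737966, 425034954, - 495803613, 62675137, - 11995717, 4982913,
     - 498981, 658897, - 43361, 19612, - 133387, 11356, - 3078, 713]"
      and xm = "[- 5944708823, 1561533944, - 68443450, 209198147, - 9435073, 2018988, - 1452780, 128010, - 237064,
     14757, - 11017, 63293, - 479, 475, - 134, - 40, 28]"
      and xp = "[681987111478, - 53371261236, 9817518310, - 2680062842, 386089476, - 295413382, 57127243,
     - 12102726, 4153692, - 529831, 448960, - 41763, 8041, - 69056, 10713, - 2947, 700, - 62, 36, - 4, 1]"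
      and ym = "[2362024093, 1690453775, 45301807, - 107676009, - 4971385, 1758674, - 10267297, - 58124, - 138692,
     60110, 1098, - 5797, - 622, 206, - 917, - 127, 10]"
      and yp = "[- 27951831631, 13592768826, 143565832, 1900179427, - 309703856, - 28265601, - 16287815, 2105390,
     - 11696898, 1998896, - 545005, 219989, - 42939, 16969, - 7107, 1348, - 1732, 209, - 41, 13, - 2]"
      and gb = "[318, - 66, 24]"
      and hb = "[- 73, - 31, - 33]"
      and Ab = 7421621664659330 and Bb = 21871090 and Qb = 215805867547978008 and Ub = 705370704527209 and Rb = 7200356157379838687 and Eb = 39077242541220276670],
    goal_cases)
qed (simp_all only: certificate_eval)

lemma circle_5:
  "golden_circle (5 / 10)"
proof (rule golden_certificate[where e = 5 and D = 2748779069440 and Db = 2048 and m = 24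
      and xc = "279639975445" and yc = "42452564421" and bc = "2095"
      and al = "[120052566808, 12406019276, 28845570408, - 2543319081, - 1382627609, - 325009809, 86252129,
     - 534473442, 56097231, - 25712724, 11877963, - 1982252, 2622271, - 749237, 197514, - 373575, 49899,
     - 38794, 12702, - 3812, 8337, - 726]"
      and be = "[- 546025069705, 101573401815, - 31487882376, 4154362096, - 6245309214, 933416277, - 228497026,
     51062938, - 7398633, 21157649, - 156530, 1113323, - 9554075, 905673, - 322588, 7793, - 7307, 39825,
     - 2005, - 1031, 21219, - 2236]"
      and xm = "[- 38620450365, 11854204461, - 832188321, 2660139547, - 136265625, 38749796, - 6756559, 4484828,
     - 8291556, 408505, - 962679, 4672491, - 28873, 48830, 12253, 5855, - 15429, - 313, 1822, - 10291,
     - 88, 230, - 92, 10]"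
      and xp = "[2714904257804, - 262517182052, 61160458344, - 19894871856, 3486478596, - 3629948899, 836066412,
     - 224204829, 57258627, - 5777000, 12944666, 50758, - 80580, - 4681022, 796523, - 288180, 27946, 55,
     22921, - 2050, 746, 10774, - 2388, 372, - 156, 39, - 18, 7, - 2]"
      and ym = "[13242606798, 13500443608, 521991479, - 1141429391, - 97712754, 55588571, - 248719285, - 1034729,
     - 6536198, 2902092, 5916, 497030, - 69951, 44882, - 135266, 1519, - 12140, 2635, - 1346, 3677,
     - 17, - 181, - 7, - 5]"
      and yp = "[- 154652705489, 76220974694, - 2160875267, 16143494354, - 3319847348, 8988938, - 347433662,
     70822093, - 292337487, 61574326, - 23131315, 10525338, - 2563038, 2370449, - 872739, 238634,
     - 266810, 62703, - 33453, 12874, - 3543, 5014, - 826, 238, - 29, 5, - 14, 3, - 1]"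
      and gb = "[195, - 52, 22, 1, 9]"
      and hb = "[- 49, - 23, - 33, - 2, 5]"
      and Ab = 33105683878660354 and Bb = 12125596 and Qb = 354701872082483676 and Ub = 3813865647373594 and Rb = 102969541220643916790 and Eb = 115334139797390538650],
    goal_cases)
qed (simp_all only: certificate_eval)

lemma circle_6:
  "golden_circle (6 / 10)"
proof (rule golden_certificate[where e = 6 and D = 5497558138880 and Db = 2048 and m = 33
      and xc = "677248581494" and yc = "99291436002" and bc = "2120"
      and al = "[310438827540, 20861237298, 105649354055, - 11459859272, - 3758218583, - 2676269890, 1023688122,
     - 4680133541, 596299731, - 370550744, 178718027, - 41158159, 107649656, - 25425036, 9358123,
     - 13695126, 2321302, - 2800097, 818904, - 260670, - 58277, 27473, 51335, 34420, - 1286, - 31869,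
     1317, - 462, - 5825]"
      and be = "[- 1307823885055, 298434764965, - 104180515834, 17286366260, - 31998455838, 5327381496,
     - 1567142849, - 262735290, 17752923, 204205675, 29054065, 18868282, - 189248371, 17748154,
     - 7930101, - 3987193, 378774, 1293688, 228000, - 272498, 2186956, - 270289, 138235, - 83481, 18718,
     - 39110, 9483, - 3704, 4566]"
      and xm = "[- 116247573315, 39839513933, - 4346042460, 13816952772, - 734982964, 246266891, 223498031,
     54219066, - 93539421, 2834726, - 24162519, 97031438, - 155639, 1047624, 1889636, 257642, - 554159,
     - 127766, 249004, - 1043483, - 2651, - 30705, 21274, - 2468, 12802, - 1119, 884, - 1671, - 363,
     149, - 11, 21, - 35]"
      and xp = "[5395186712101, - 616410921710, 174681127661, - 64240076459, 12947866742, - 17995830175, 4657077607,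
     - 1514048518, 54269459, 63929427, 98860288, 35550679, - 12970611, - 84981468, 13490585, - 6378565,
     - 2225106, 968437, 510460, 199864, - 55993, 1133355, - 280563, 125339, - 72090, 20651, - 28552,
     10259, - 3844, 3319, - 529, 260, - 58, 24, - 40, 10, - 5, 0, 0, 1, 0]"
      and ym = "[32949814191, 47679910622, 2478334985, - 4562513067, - 763622491, 593196917, - 2148960296, - 611104,
     - 99261791, 45122922, - 3751323, 34086439, - 2127673, 2122877, - 4818379, 196646, - 935289, 149797,
     - 60509, - 39598, - 10491, 21138, 7438, 4364, - 16204, - 232, 297, - 2327, - 440, 32, - 58, 6, - 24]"
      and yp = "[- 408003240622, 205191493287, - 16326355968, 60644072944, - 15040708969, 2127832974, - 2731328889,
     753369810, - 2584981007, 637986511, - 316175770, 154501134, - 44366268, 76802711, - 27687697,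
     9893599, - 9908476, 2665126, - 2166284, 828308, - 279918, 16509, 33934, 27686, 27752, - 9317,
     - 13309, 317, - 482, - 3613, 675, - 175, 119, - 36, 43, - 19, 7, - 6, 2, - 1, 1]"
      and gb = "[229, - 75, 34, 4, 24, 0, - 1, 2]"
      and hb = "[- 64, - 32, - 60, - 3, 9, 0, 0, 6]"
      and Ab = 76028081710811192 and Bb = 13705258 and Qb = 869241476357965258 and Ub = 10009203764360364 and Rb = 422111210262115326875 and Eb = 406954786795990935376],
    goal_cases)
qed (simp_all only: certificate_eval)

text \<open>The entries of \<open>al\<close> at the Fibonacci frequencies 8, 13, 21 and 34 stand out
  from their neighbours. These are denominators of convergents of the golden mean, where the
  divisors are smallest, and they keep the decay slow.\<close>

lemma circle_7:
  "golden_circle (7 / 10)"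
proof (rule golden_certificate[where e = 7 and D = 43980465111040 and Db = 4096 and m = 53
      and xc = "6397008002423" and yc = "903361164514" and bc = "4316"
      and al = "[3140628342713, 38346411557, 1424551143543, - 187087487886, 2656224959, - 71448107735, 35098106800,
     - 128058720951, 19201090648, - 15600150168, 7731430681, - 2550156613, 9681917973, - 2134256209,
     999091231, - 1129363060, 239828819, - 419325410, 93936746, - 16033667, - 221980644, 37645456,
     - 6724414, 24469707, - 4070607, - 2511841, - 2420057, 1325647, - 5612680, 967687, - 801717, 512790,
     - 118765, 710806, - 242061, 100439, - 210710, 44663, - 60687, 25120, - 11957, 21478, - 3408]"
      and be = "[- 12176866308038, 3315041895137, - 1256829876406, 257526846264, - 566224554157, 99067343673,
     - 32746078506, - 29681044424, 4107431752, 4862210433, 2767128585, 815059119, - 9283954452,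
     648804270, - 348253851, - 835673677, 138930813, - 5397839, 96984110, - 83343875, 417573627,
     - 57574273, 43546474, - 19527988, 6772756, - 23861047, 4737708, - 2173529, 231963, - 114593,
     743296, - 157749, 363816, - 2569689, 322870, - 179318, 25217, - 12064, 65944, - 3857, - 2409,
     43673, - 7039]"
      and xm = "[- 1329923759013, 494507006683, - 81520480705, 249310457951, - 12110242895, 3886848915, 14877770965,
     2047131394, - 3112190487, 38997574, - 1594668421, 5173555052, 50399641, 11535614, 331491124,
     17299646, - 8676645, - 38662635, 62192270, - 199198245, 924235, - 11302017, 5573853, - 2208906,
     9249769, - 467934, 436041, - 105958, 142700, - 357705, 169736, - 340347, 1271345, - 1945, 34024,
     - 3900, 8039, - 25860, - 1524, 4205, - 18973, - 483, 1172, - 694, 127, - 136, 59, - 23, 29, - 7, 7,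
     - 5, 5]"
      and xp = "[42799891036188, - 5588679404505, 1871752301883, - 744991611116, 163606930935, - 304826040226,
     83857643421, - 32004358271, - 12640741545, 6547311257, 850577214, 3229041263, - 1298429019,
     - 3528898489, 268244462, - 213188175, - 555669015, 218009662, - 60304356, 84839631, - 31905935,
     216796190, - 56780572, 35627242, - 16139998, 4835486, - 14610983, 4643161, - 2148728, 304514,
     65160, 354895, 30762, - 34703, - 1202523, 266894, - 142280, 18770, 3088, 34461, - 2987, 1471,
     24726, - 8594, 2278, - 1389, 535, - 407, 222, - 100, 76, - 32, 21, - 11, 6, - 12, 4, - 2]"
      and ym = "[294823626607, 618943601667, 39640364202, - 53209366276, - 20265448157, 19310864177, - 58314966052,
     416722242, - 4432166083, 2148563433, - 617113434, 3602408972, - 162752853, 227674918, - 388646681,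
     39640122, - 147193002, 7386462, 12616994, - 102919782, - 2991909, 1518580, 5496520, 1375251,
     - 3266960, - 537064, 622046, - 2206525, - 13997, - 163636, 96149, 60544, 135547, - 12214, 18398,
     - 66188, 2705, - 17338, 4649, - 3950, 8511, - 41, - 1217, 42, - 135, 278, - 33, 12, 20, 0, - 7,
     - 1, 1]"
      and yp = "[- 4157379215768, 2141653130924, - 300305700176, 834287939425, - 241057681698, 78678257838,
     - 69144137730, 23851361986, - 70810229619, 19602360815, - 12481072864, 6261046847, - 1997561125,
     6040845413, - 2162351737, 953565378, - 816632945, 233540393, - 292209141, 100684319, - 40770843,
     - 110427665, 41415970, - 11460012, 20928658, - 7577874, 2340584, - 3095182, 1210287, - 3618148,
     1175978, - 779156, 480722, - 174495, 591331, - 287403, 119552, - 161863, 54188, - 51939, 26202,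
     - 10949, 14013, - 3667, 1545, - 216, 55, - 267, 62, - 32, - 25, 17, 0, 5, - 3, 9, - 5, 3]"
      and gb = "[519, - 202, 96, 18, 109, - 2, - 5, 24, 4, 0, 2, 1, 7]"
      and hb = "[- 157, - 76, - 198, - 9, 31, - 3, 1, 37, 5, 2, - 1, - 1, - 3]"
      and Ab = 735567084307073522 and Bb = 32223020 and Qb = 13613251107842781968 and Ub = 103989719321820912 and Rb = 27225284842823228789553 and Eb = 2778285224226902791016],
    goal_cases)
qed (simp_all only: certificate_eval)

section \<open>Invariant circles\<close>

text \<open>\<open>rep_circle\<close> picks an arbitrary representative; a 1-periodic function does
  not see which one.\<close>

lemma rep_circle_to_circle:
  fixes p :: "real \<Rightarrow> 'a"
  assumes "\<And>x. p (x + 1) = p x"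
  shows "p (rep_circle (to_circle x)) = p x"
proof -
  have "to_circle (rep_circle (to_circle x)) = to_circle x"
    using Quotient_abs_rep[OF Quotient_circle] by simp
  then have "rep_circle (to_circle x) - x \<in> \<int>" by (simp add: to_circle_eq_iff)
  then obtain n where n: "rep_circle (to_circle x) = x + of_int n" by (metis Ints_cases add.commute diff_add_cancel)
  have nat: "p (x + of_nat k) = p x" for k x
  proof (induction k)
    case (Suc k)
    have "x + of_nat (Suc k) = (x + of_nat k) + 1" by simp
    then show ?case using assms[of "x + of_nat k"] Suc by (simp only:)
  qed simp
  show ?thesis
  proof (cases "0 \<le> n")
    case True
    then show ?thesis using nat[of x "nat n"] n by simp
  next
    case False
    then show ?thesis using nat[of "x + of_int n" "nat (- n)"] n by simp
  qed
qed

lemma to_circle_cases: obtains x where "\<theta> = to_circle x"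
  by (metis Quotient_abs_rep[OF Quotient_circle])

text \<open>The change of variable t = 2 \<pi> \<theta> turns period 2 \<pi> into 1 and the half
  width \<rho> into \<rho>/(2 \<pi>).\<close>

lemma wiener_real_analytic_on_circle:
  assumes f: "wiener_real \<rho> f C" "0 < \<rho>"
  shows "real_analytic_on_circle (\<lambda>\<theta>. f (2 * pi * rep_circle \<theta>))"
proof -
  obtain F where F: "F holomorphic_on {z. \<bar>Im z\<bar> < \<rho>}" "\<And>z. F (z + 2 * of_real pi) = F z"
    "\<And>t. F (of_real t) = of_real (f t)"
    by (rule wiener_holomorphic_extension[OF f]) (rule that)
  let ?r = "\<rho> / (2 * pi)"
  have "(\<lambda>z. F (2 * of_real pi * z)) holomorphic_on strip ?r"
  proof (rule holomorphic_on_compose_gen[OF _ F(1), unfolded o_def])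
    show "(\<lambda>z. 2 * of_real pi * z) holomorphic_on strip ?r" by (intro holomorphic_intros)
    show "(\<lambda>z. 2 * of_real pi * z) ` strip ?r \<subseteq> {z. \<bar>Im z\<bar> < \<rho>}"
      by (auto simp: strip_def field_simps abs_mult)
  qed
  moreover have "F (2 * of_real pi * (z + 1)) = F (2 * of_real pi * z)" for z
    using F(2)[of "2 * of_real pi * z"] by (simp add: algebra_simps)
  moreover have "f (2 * pi * (x + 1)) = f (2 * pi * x)" for x
    using wiener_periodic[OF f(1), of "2 * pi * x"] by (simp add: algebra_simps)
  then have "F (2 * of_real pi * of_real x) = of_real (f (2 * pi * rep_circle (to_circle x)))" for x
    using F(3)[of "2 * pi * x"] rep_circle_to_circle[of "\<lambda>x. f (2 * pi * x)" x] by simp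
  moreover have "0 < ?r" using f(2) by simp
  ultimately show ?thesis unfolding real_analytic_on_circle_def by blast
qed

lemma analytic_invariant_circle_exists:
  assumes U: "wiener_real \<rho> U C" "0 < \<rho>" and eq: "\<And>t. circle_defect (2 * pi * \<omega>) lam \<epsilon> U c t = 0"
  shows "\<exists>\<mu> K. analytic_invariant_circle (dissipative_standard_map lam \<epsilon> \<mu>) \<omega> K"
proof -
  define u where "u t = 1 / (2 * pi) * U t" for t
  \<comment> \<open>Invariance forces the second component at \<theta> + \<omega> to be the
    increment of the lifted first component from \<theta> to \<theta> + \<omega>; this is that
    increment, shifted back.\<close>
  define v where "v t = \<omega> + (u t - u (t + - (2 * pi * \<omega>)))" for t
  have u: "wiener_real \<rho> u (\<bar>1 / (2 * pi)\<bar> * C)"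
    unfolding u_def using U by (intro wiener_real_cmult) auto
  have v: "wiener_real \<rho> v (\<bar>\<omega>\<bar> + (\<bar>1 / (2 * pi)\<bar> * C + \<bar>1 / (2 * pi)\<bar> * C))"
    unfolding v_def using U(2)
    by (intro wiener_real_add wiener_real_diff wiener_real_const u wiener_shift[OF u, of "- (2 * pi * \<omega>)"]) auto
  define Kp where "Kp \<theta> = (u (2 * pi * rep_circle \<theta>), v (2 * pi * rep_circle \<theta>))" for \<theta>
  define K where "K \<theta> = cylinder_translate (\<theta>, 0) (Kp \<theta>)" for \<theta>
  have per: "u (2 * pi * (x + 1)) = u (2 * pi * x)" "v (2 * pi * (x + 1)) = v (2 * pi * x)" for x
    using wiener_periodic[OF u, of "2 * pi * x"] wiener_periodic[OF v, of "2 * pi * x"]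
    by (simp_all add: algebra_simps)
  have K: "K (to_circle x) = (to_circle (x + u (2 * pi * x)), v (2 * pi * x))" for x
    unfolding K_def Kp_def cylinder_translate_def
      rep_circle_to_circle[of "\<lambda>x. u (2 * pi * x)", OF per(1)] rep_circle_to_circle[of "\<lambda>x. v (2 * pi * x)", OF per(2)]
    by (simp add: to_circle_add)
  have "dissipative_standard_map lam \<epsilon> (c / (2 * pi)) (K \<theta>) = K (\<theta> + to_circle \<omega>)" for \<theta>
  proof -
    obtain x where x: "\<theta> = to_circle x" by (rule to_circle_cases)
    \<comment> \<open>After inserting \<open>v\<close>, this is the equation of vanishing defect
      divided by 2 \<pi>, with \<mu> = c/(2 \<pi>).\<close>
    have phi: "dsm_phi lam \<epsilon> (c / (2 * pi)) (to_circle (x + u (2 * pi * x))) (v (2 * pi * x)) = v (2 * pi * (x + \<omega>))"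
    proof -
      have 1: "2 * pi * (x + u (2 * pi * x)) = 2 * pi * x + U (2 * pi * x)"
        by (simp add: u_def algebra_simps)
      have 2: "2 * pi * (x + \<omega>) = 2 * pi * x + 2 * pi * \<omega>" by (simp add: algebra_simps)
      show ?thesis
        unfolding dsm_phi_def sin_2pi.abs_eq 1 2
        using eq[of "2 * pi * x"] unfolding v_def u_def circle_defect_def
        by (simp add: field_simps)
    qed
    have sum: "x + u (2 * pi * x) + v (2 * pi * (x + \<omega>)) = (x + \<omega>) + u (2 * pi * (x + \<omega>))"
      by (simp add: v_def algebra_simps)
    show ?thesis
      unfolding x K dissipative_standard_map_def to_circle_add[symmetric] prod.case phi sum by simp
  qed
  moreover have "real_analytic_circle_to_plane Kp"
    unfolding real_analytic_circle_to_plane_def Kp_def fst_conv snd_conv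
    using u v U(2) by (intro conjI wiener_real_analytic_on_circle)
  ultimately have "analytic_invariant_circle (dissipative_standard_map lam \<epsilon> (c / (2 * pi))) \<omega> K"
    unfolding analytic_invariant_circle_def using K_def by blast
  then show ?thesis by blast
qed

theorem mainTheorem1:
  fixes \<omega> lam \<epsilon> :: real
  assumes "\<omega> = (sqrt 5 - 1) / 2"
    and "lam = 2 / 5"
    and "\<epsilon> \<in> {1/10, 2/10, 3/10, 4/10, 5/10, 6/10, 7/10}"
  shows "\<exists>\<mu>::real. \<exists>K. analytic_invariant_circle (dissipative_standard_map lam \<epsilon> \<mu>) \<omega> K"
proof -
  have "golden_circle \<epsilon>"
    using assms(3) circle_1 circle_2 circle_3 circle_4 circle_5 circle_6 circle_7
    by (elim insertE emptyE) (simp_all only:)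
  then obtain U c C where U: "wiener_real (3/100) U C"
    and eq: "\<And>t. circle_defect (2 * pi * ((sqrt 5 - 1) / 2)) (2/5) \<epsilon> U c t = 0"
    unfolding golden_circle_def by blast
  show ?thesis
    unfolding assms(1,2) by (rule analytic_invariant_circle_exists[OF U _ eq]) simp
qed

end
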